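(* Let $k$ be a positive integer. (a) Let $m$ be a positive integer and let $G$ be an $m$-connected graph of order $n \ge 5k-2$. If $\sigma_{\lceil m/k \rceil + 1}(G) > \frac{1}{2}(\lceil m/k \rceil + 1)(n-1)$, then $G$ has a 2-factor with exactly $k$ cycles. (b) Let $G$ be a graph of order at least $5k-2$. If $\alpha(G) \le \lceil \kappa(G)/k \rceil$, then $G$ has a 2-factor with exactly $k$ cycles.
   Context: All graphs are finite and simple; the order of a graph is its number of vertices. $\alpha(G)$ is the independence number and $\kappa(G)$ the vertex-connectivity of $G$ (with $\kappa(K_n)=n-1$); $G$ is $m$-connected if $\kappa(G)\ge m$. $d_G(x)$ is the degree of $x$ in $G$. For a positive integer $s$, if $\alpha(G) \ge s$, let $\sigma_{s}(G) = \min\{\sum_{x\in X} d_G(x) : X \text{ is an independent set of } G \text{ with } |X| = s\}$; otherwise $\sigma_{s}(G) = +\infty$. A 2-factor of $G$ is a spanning subgraph of $G$ in which every component is a cycle; it has exactly $k$ cycles if it has exactly $k$ components. *)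

theory Defs
  imports "Graph_Theory.Graph_Theory" "HOL-Library.Extended_Real"
begin

text \<open>
  A finite simple undirected graph is a digraph satisfying the locale predicate \<open>graph\<close> (finite,
  loop-free, no parallel arcs, symmetric); an undirected edge \<open>uv\<close> is the pair of opposite arcs
  from \<open>u\<close> to \<open>v\<close> and from \<open>v\<close> to \<open>u\<close>. In such a graph \<open>out_degree G x\<close> is therefore the
  ordinary degree of \<open>x\<close>.
\<close>

definition independent_set :: "('a,'b) pre_digraph \<Rightarrow> 'a set \<Rightarrow> bool" where
  "independent_set G X \<longleftrightarrow> X \<subseteq> verts G \<and> (\<forall>u\<in>X. \<forall>v\<in>X. \<not> u \<rightarrow>\<^bsub>G\<^esub> v)"

definition independence_number :: "('a,'b) pre_digraph \<Rightarrow> nat" where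
  "independence_number G = Max {card X | X. independent_set G X}"

definition sigma :: "nat \<Rightarrow> ('a,'b) pre_digraph \<Rightarrow> enat" where
  "sigma s G =
    (if s \<le> independence_number G
     then enat (Min {(\<Sum>x\<in>X. out_degree G x) | X. independent_set G X \<and> card X = s})
     else \<infinity>)"

definition vertex_cut :: "('a,'b) pre_digraph \<Rightarrow> 'a set \<Rightarrow> bool" where
  "vertex_cut G S \<longleftrightarrow> S \<subset> verts G \<and> \<not> Digraph_Component.connected (G \<restriction> (verts G - S))"

text \<open>
  The first case is the convention \<open>\<kappa>(K\<^sub>n) = n - 1\<close>; a graph that is not complete has a vertex cut,
  so the minimum is over a nonempty set.
\<close>

definition vertex_connectivity :: "('a,'b) pre_digraph \<Rightarrow> nat" where
  "vertex_connectivity G =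
    (if complete_digraph (card (verts G)) G
     then card (verts G) - 1
     else Min {card S | S. vertex_cut G S})"

definition m_connected :: "nat \<Rightarrow> ('a,'b) pre_digraph \<Rightarrow> bool" where
  "m_connected m G \<longleftrightarrow> m \<le> vertex_connectivity G"

definition components :: "('a,'b) pre_digraph \<Rightarrow> ('a,'b) pre_digraph set" where
  "components H = {C. pre_digraph.max_subgraph H Digraph_Component.connected C}"

text \<open>
  \<open>C\<close> consists of the vertices and edges of one cycle. The closed walk \<open>p\<close> traverses the cycle in
  one direction, and the symmetric closure adds the opposite arcs. The length bound is needed since
  \<open>pre_digraph.cycle\<close> also admits the closed walk \<open>a, b, a\<close> along a single undirected edge.
\<close>

definition cycle_graph :: "('a,'b) pre_digraph \<Rightarrow> bool" where
  "cycle_graph C \<longleftrightarrow> graph C \<and>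
    (\<exists>p. pre_digraph.cycle C p \<and> 3 \<le> length p \<and>
         verts C = head C ` set p \<and>
         arcs_ends C = symcl (arc_to_ends C ` set p))"

definition two_factor :: "('a,'b) pre_digraph \<Rightarrow> ('a,'b) pre_digraph \<Rightarrow> bool" where
  "two_factor H G \<longleftrightarrow> graph H \<and> spanning H G \<and> (\<forall>C\<in>components H. cycle_graph C)"

definition has_two_factor_with_cycles :: "('a,'b) pre_digraph \<Rightarrow> nat \<Rightarrow> bool" where
  "has_two_factor_with_cycles G k \<longleftrightarrow> (\<exists>H. two_factor H G \<and> card (components H) = k)"

end

theory Submission
  imports Defs "HOL-Library.Disjoint_Sets"
begin

text \<open>
  Write \<open>t\<close> for the ceiling of \<open>m / k\<close>. Both parts reduce to one statement about an \<open>m\<close>-connected graph of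
  order \<open>n \<ge> 5 k - 2\<close> in which every independent set of size \<open>t + 1\<close> contains two vertices whose degrees add up
  to at least \<open>n\<close>: in (a) by averaging, in (b) because there is no such set.

  First there are \<open>k\<close> disjoint cycles. By induction on \<open>k\<close>, choose \<open>k - 1\<close> disjoint cycles with as few vertices as
  possible and then with a longest path in the remaining forest as long as possible. Minimality bounds the number of
  edges from a vertex of the forest, or from a long cycle, to each cycle; this contradicts the lower bounds for
  degree sums of two and three independent vertices.

  Next choose \<open>k\<close> disjoint cycles with as many vertices as possible, and suppose that \<open>H\<close> is a component of the rest.
  Some cycle \<open>C\<close> has at least \<open>t\<close> neighbours of \<open>H\<close>, because \<open>H\<close> has at least \<open>m > k (t - 1)\<close> in total. If there are two,
  absorb into the other cycles as many vertices as possible right after each neighbour; the first vertices that are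
  not absorbed and a vertex of \<open>H\<close> are independent, and a crossing argument bounds each of their pairwise degree sums
  by \<open>n - 1\<close>. If every cycle has at most one neighbour of \<open>H\<close>, then \<open>t = 1\<close>, so Ore's condition makes the graph so dense
  that two of the cycles can be rebuilt with one of them passing through \<open>H\<close>.
\<close>

section \<open>Paths, cycles and disjoint cycle systems\<close>

text \<open>The order bound enters twice. In the step from \<open>k\<close> to \<open>k + 1\<close>
  cycles it reads \<open>5 * k + 3 \<le> card V\<close>: a cycle of six or more vertices can occur
  only if at least ten vertices are left over, and cycles of at most five vertices leave at least
  three. For \<open>t = 2\<close> it gives the triple bound without slack: two of three independent
  vertices have degree sum at least \<open>n\<close>, the third has degree at least
  \<open>k + 1\<close>, in total \<open>6 * k - 1\<close>.

  The obstacle in the second half is that absorptions interfere. The first vertex \<open>y p\<close>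
  that is not absorbed may be blocked only because some other segment is absorbed at the same time,
  and then its degree bound grows by up to half the length of that segment. For two such vertices
  and a third segment of length \<open>m\<close> the surplus is at most \<open>m\<close> in all. It
  is paid on the cycle itself: neither vertex has a neighbour in an absorbable prefix of a third
  segment, so the count on the arc that contains it drops by \<open>m\<close>. The crossing argument
  removes two segments at a time, hence a labelling is required to make any two prefixes, and only
  two, absorbable together.\<close>

locale fin_sgraph =
  fixes V :: "'a set" and E :: "'a \<Rightarrow> 'a \<Rightarrow> bool"
  assumes finV: "finite V"
    and E_sym: "E u v \<Longrightarrow> E v u"
    and E_irrefl: "\<not> E u u"
    and E_V: "E u v \<Longrightarrow> u \<in> V"
begin

lemma E_V2: "E u v \<Longrightarrow> v \<in> V"
  using E_V E_sym by blast

lemma E_commute: "E u v \<longleftrightarrow> E v u"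
  using E_sym by blast

definition dg :: "'a set \<Rightarrow> 'a \<Rightarrow> nat" where
  "dg S v = card {w\<in>S. E v w}"

definition eb :: "'a set \<Rightarrow> 'a set \<Rightarrow> nat" where
  "eb A B = (\<Sum>v\<in>A. dg B v)"

text \<open>Every edge inside \<open>S\<close> is counted from both ends, so \<open>es S\<close> is
  twice the number of edges: \<open>2 * card S \<le> es S\<close> says that there are at least as
  many edges as vertices.\<close>

abbreviation es :: "'a set \<Rightarrow> nat" where
  "es S \<equiv> eb S S"

definition pth :: "'a list \<Rightarrow> bool" where
  "pth xs \<longleftrightarrow> distinct xs \<and> successively E xs"

definition cyc :: "'a list \<Rightarrow> bool" where
  "cyc xs \<longleftrightarrow> distinct xs \<and> 3 \<le> length xs \<and> successively E xs \<and> E (last xs) (hd xs)"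

text \<open>The extremal choices see only the vertex set of a cycle, so cycles on the same vertices
  are identified.\<close>

definition cycset :: "'a set \<Rightarrow> bool" where
  "cycset X \<longleftrightarrow> (\<exists>xs. cyc xs \<and> set xs = X)"

definition hascyc :: "'a set \<Rightarrow> bool" where
  "hascyc S \<longleftrightarrow> (\<exists>X\<subseteq>S. cycset X)"

section \<open>Degrees and edge counts\<close>

lemma fin_nb[simp]: "finite {w\<in>S. E v w}"
  by (rule finite_subset[OF _ finV]) (auto dest: E_V2)

lemma dg_mono: "A \<subseteq> B \<Longrightarrow> dg A v \<le> dg B v"
  unfolding dg_def by (intro card_mono) auto

lemma dg_Un: "A \<inter> B = {} \<Longrightarrow> dg (A \<union> B) v = dg A v + dg B v"
proof -
  assume "A \<inter> B = {}"
  then have "card ({w\<in>A. E v w} \<union> {w\<in>B. E v w}) = card {w\<in>A. E v w} + card {w\<in>B. E v w}"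
    by (intro card_Un_disjoint) auto
  moreover have "{w\<in>A. E v w} \<union> {w\<in>B. E v w} = {w\<in>A \<union> B. E v w}" by auto
  ultimately show ?thesis by (simp add: dg_def)
qed

lemma dg_empty[simp]: "dg {} v = 0"
  by (simp add: dg_def)

lemma dg_insert: "w \<notin> S \<Longrightarrow> dg (insert w S) v = dg S v + (if E v w then 1 else 0)"
proof -
  assume a: "w \<notin> S"
  have "{x\<in>insert w S. E v x} = (if E v w then insert w {x\<in>S. E v x} else {x\<in>S. E v x})" by auto
  then show ?thesis using a by (simp add: dg_def)
qed

lemma dg_le_card: "finite S \<Longrightarrow> dg S v \<le> card S"
  unfolding dg_def by (intro card_mono) auto

lemma dg_self: "dg (insert v S) v = dg S v"
  unfolding dg_def by (rule arg_cong[where f=card]) (auto simp: E_irrefl)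

lemma dg_Diff_self: "dg (S - {v}) v = dg S v"
  unfolding dg_def by (rule arg_cong[where f=card]) (auto simp: E_irrefl)

lemma dg_less_card: "finite S \<Longrightarrow> v \<in> S \<Longrightarrow> dg S v < card S"
  using dg_le_card[of "S - {v}" v] dg_Diff_self[of S v] card_gt_0_iff[of S] by fastforce

lemma dg_eq_0: "dg S v = 0 \<longleftrightarrow> (\<forall>w\<in>S. \<not> E v w)"
  unfolding dg_def using card_0_eq[OF fin_nb] by auto

lemma dg_full: "finite S \<Longrightarrow> dg S v = card S \<longleftrightarrow> (\<forall>w\<in>S. E v w)"
proof -
  assume f: "finite S"
  have "dg S v = card S \<longleftrightarrow> {w\<in>S. E v w} = S"
    unfolding dg_def using card_subset_eq[OF f, of "{w\<in>S. E v w}"] by auto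
  then show ?thesis by auto
qed

lemma dg_non: "finite S \<Longrightarrow> dg S v + card {w\<in>S. \<not> E v w} = card S"
proof -
  assume f: "finite S"
  have "S = {w\<in>S. E v w} \<union> {w\<in>S. \<not> E v w}" by auto
  then have "card S = card ({w\<in>S. E v w} \<union> {w\<in>S. \<not> E v w})" by simp
  also have "\<dots> = card {w\<in>S. E v w} + card {w\<in>S. \<not> E v w}"
    using f by (intro card_Un_disjoint) auto
  finally show ?thesis by (simp add: dg_def)
qed

lemma eb_Un1: "A \<inter> B = {} \<Longrightarrow> finite A \<Longrightarrow> finite B \<Longrightarrow> eb (A \<union> B) C = eb A C + eb B C"
  unfolding eb_def by (rule sum.union_disjoint) auto

lemma eb_Un2: "B \<inter> C = {} \<Longrightarrow> eb A (B \<union> C) = eb A B + eb A C"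
  unfolding eb_def by (simp add: dg_Un sum.distrib)

lemma eb_commute: "finite A \<Longrightarrow> finite B \<Longrightarrow> eb A B = eb B A"
proof -
  assume f: "finite A" "finite B"
  have g: "dg S v = (\<Sum>w\<in>S. if E v w then 1 else 0)" if "finite S" for S v
  proof -
    have "S \<inter> {w. E v w} = {w\<in>S. E v w}" by auto
    then show ?thesis using that by (simp add: dg_def sum.If_cases)
  qed
  have "eb A B = (\<Sum>v\<in>A. \<Sum>w\<in>B. if E v w then 1 else 0)" using f by (simp add: eb_def g)
  also have "\<dots> = (\<Sum>w\<in>B. \<Sum>v\<in>A. if E w v then 1 else 0)"
    by (subst sum.swap) (simp add: E_commute)
  finally show ?thesis using f by (simp add: eb_def g)
qed

lemma eb_mono1: "A \<subseteq> B \<Longrightarrow> finite B \<Longrightarrow> eb A C \<le> eb B C"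
  unfolding eb_def by (intro sum_mono2) auto

lemma eb_insert1: "v \<notin> A \<Longrightarrow> finite A \<Longrightarrow> eb (insert v A) B = dg B v + eb A B"
  unfolding eb_def by simp

lemma eb_empty[simp]: "eb {} B = 0" "eb A {} = 0"
  by (auto simp: eb_def)

lemma dg_self_single[simp]: "dg {v} v = 0"
  by (simp add: dg_eq_0 E_irrefl)

lemma eb_single[simp]: "eb {v} B = dg B v"
  by (simp add: eb_def)

lemma es_insert: "v \<notin> S \<Longrightarrow> finite S \<Longrightarrow> es (insert v S) = es S + 2 * dg S v"
proof -
  assume a: "v \<notin> S" "finite S"
  have "es (insert v S) = dg S v + eb S (insert v S)"
    using a by (simp add: eb_insert1 dg_self)
  also have "eb S (insert v S) = eb S S + eb S {v}"
    using eb_Un2[of S "{v}" S] a by simp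
  also have "eb S {v} = dg S v" using eb_commute[of S "{v}"] a by simp
  finally show ?thesis by simp
qed

lemma es_Un: "A \<inter> B = {} \<Longrightarrow> finite A \<Longrightarrow> finite B \<Longrightarrow> es (A \<union> B) = es A + es B + 2 * eb A B"
  using eb_commute[of A B] by (simp add: eb_Un1 eb_Un2)

lemma es_remove: "v \<in> S \<Longrightarrow> finite S \<Longrightarrow> es S = es (S - {v}) + 2 * dg S v"
  using es_insert[of v "S - {v}"] by (simp add: insert_absorb dg_Diff_self)

lemma hascyc_mono: "hascyc A \<Longrightarrow> A \<subseteq> B \<Longrightarrow> hascyc B"
  unfolding hascyc_def by blast

lemma cycset_hascyc: "cycset X \<Longrightarrow> hascyc X"
  unfolding hascyc_def by blast

section \<open>Paths and cycles as vertex lists\<close>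

lemma successively_V: "successively E xs \<Longrightarrow> 2 \<le> length xs \<Longrightarrow> set xs \<subseteq> V"
proof (induction xs)
  case (Cons x xs)
  then show ?case
  proof (cases xs)
    case (Cons y ys)
    then have "x \<in> V" "y \<in> V" using Cons.prems E_V E_V2 by auto
    then show ?thesis using Cons Cons.IH Cons.prems by (cases ys) auto
  qed auto
qed auto

lemma cyc_V: "cyc xs \<Longrightarrow> set xs \<subseteq> V"
  using successively_V unfolding cyc_def by auto

lemma cycset_V: "cycset X \<Longrightarrow> X \<subseteq> V"
  using cyc_V unfolding cycset_def by auto

lemma cycset_fin: "cycset X \<Longrightarrow> finite X"
  unfolding cycset_def by auto

lemma cycset_card: "cycset X \<Longrightarrow> 3 \<le> card X"
  unfolding cycset_def cyc_def using distinct_card by metis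

lemma pth_Nil[simp]: "pth []" by (simp add: pth_def)

lemma pth_single[simp]: "pth [x]" by (simp add: pth_def)

lemma pth_Cons: "pth (x # xs) \<longleftrightarrow> x \<notin> set xs \<and> pth xs \<and> (xs \<noteq> [] \<longrightarrow> E x (hd xs))"
  by (cases xs) (auto simp: pth_def)

lemma pth_rev: "pth (rev xs) \<longleftrightarrow> pth xs"
proof -
  have "(\<lambda>x y. E y x) = E" using E_commute by blast
  then have "successively (\<lambda>x y. E y x) xs = successively E xs" by (rule arg_cong)
  then show ?thesis by (simp add: pth_def)
qed

lemma pth_append: "pth (xs @ ys) \<longleftrightarrow> pth xs \<and> pth ys \<and> set xs \<inter> set ys = {}
    \<and> (xs \<noteq> [] \<and> ys \<noteq> [] \<longrightarrow> E (last xs) (hd ys))"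
  by (auto simp: pth_def successively_append_iff)

lemma cyc_pth: "cyc xs \<longleftrightarrow> pth xs \<and> 3 \<le> length xs \<and> E (last xs) (hd xs)"
  by (auto simp: cyc_def pth_def)

lemma cycsetI: "pth xs \<Longrightarrow> 3 \<le> length xs \<Longrightarrow> E (last xs) (hd xs) \<Longrightarrow> cycset (set xs)"
  unfolding cycset_def cyc_pth by blast

lemma pth_es: "pth xs \<Longrightarrow> 2 * (length xs - 1) \<le> es (set xs)"
proof (induction xs)
  case (Cons x xs)
  then have p: "x \<notin> set xs" "pth xs" "xs \<noteq> [] \<Longrightarrow> E x (hd xs)" by (auto simp: pth_Cons)
  have e: "es (set (x # xs)) = es (set xs) + 2 * dg (set xs) x" using p by (simp add: es_insert)
  show ?case
  proof (cases "xs = []")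
    case False
    then have "dg (set xs) x \<noteq> 0" using p by (auto simp: dg_eq_0)
    then show ?thesis using e Cons.IH p by simp
  qed simp
qed simp

lemma cyc_rotate1: "cyc (x # xs) \<Longrightarrow> cyc (xs @ [x])"
proof -
  assume a: "cyc (x # xs)"
  then have "xs \<noteq> []" by (auto simp: cyc_def)
  then show ?thesis using a by (auto simp: cyc_pth pth_Cons pth_append E_commute)
qed

lemma cyc_rotate: "cyc (xs @ ys) \<Longrightarrow> cyc (ys @ xs)"
proof (induction xs arbitrary: ys)
  case (Cons x xs)
  then have "cyc (xs @ (ys @ [x]))" using cyc_rotate1[of x "xs @ ys"] by simp
  then show ?case using Cons.IH by fastforce
qed simp

lemma cyc_startE:
  assumes "cycset X" "x \<in> X"
  obtains xs where "cyc (x # xs)" "set (x # xs) = X"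
proof -
  obtain zs where z: "cyc zs" "set zs = X" using assms cycset_def by auto
  then obtain as bs where "zs = as @ x # bs" using assms split_list by metis
  then have "cyc ((x # bs) @ as)" "set (x # bs @ as) = X" using z cyc_rotate[of as "x # bs"] by auto
  then show ?thesis using that by simp
qed

section \<open>Cycles forced by the number of edges\<close>

lemma longest_path:
  assumes "finite S" "S \<noteq> {}"
  obtains xs where "pth xs" "set xs \<subseteq> S" "xs \<noteq> []"
    "\<And>ys. pth ys \<Longrightarrow> set ys \<subseteq> S \<Longrightarrow> length ys \<le> length xs"
proof -
  let ?P = "\<lambda>xs. pth xs \<and> set xs \<subseteq> S"
  obtain x where x: "x \<in> S" using assms by auto
  have b: "\<forall>xs. ?P xs \<longrightarrow> length xs < card S + 1"
    using assms(1) by (metis card_mono distinct_card pth_def less_add_one le_imp_less_Suc Suc_eq_plus1)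
  obtain xs where xs: "?P xs" "\<forall>ys. ?P ys \<longrightarrow> length ys \<le> length xs"
    using ex_has_greatest_nat[of ?P "[x]" length "card S + 1"] x b by auto
  have "?P [x]" using x by simp
  then have "length [x] \<le> length xs" using xs(2) by blast
  then have "xs \<noteq> []" by auto
  then show ?thesis using that xs by blast
qed

lemma two_elems: "2 \<le> card A \<Longrightarrow> \<exists>a b. a \<in> A \<and> b \<in> A \<and> a \<noteq> b"
  by (metis card_le_Suc0_iff_eq card.infinite not_less_eq_eq numeral_2_eq_2 zero_le)

lemma path_chord_cycset:
  assumes "pth (x # xs)" "i < length xs" "1 \<le> i" "E x (xs ! i)"
  shows "cycset (set (x # take (Suc i) xs))"
proof (rule cycsetI)
  have "x # xs = (x # take (Suc i) xs) @ drop (Suc i) xs" by simp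
  then show "pth (x # take (Suc i) xs)" using assms(1) by (metis pth_append)
  show "3 \<le> length (x # take (Suc i) xs)" using assms by simp
  have "last (take (Suc i) xs) = xs ! i" using assms(2)
    by (simp add: take_Suc_conv_app_nth)
  then show "E (last (x # take (Suc i) xs)) (hd (x # take (Suc i) xs))"
    using assms E_sym by (auto simp: take_eq_Nil)
qed

text \<open>All neighbours of an end of a longest path lie on that path, so a second neighbour of
  the end gives a chord that closes a cycle.\<close>

lemma min_deg2_hascyc:
  assumes "finite S" "S \<noteq> {}" "\<And>v. v \<in> S \<Longrightarrow> 2 \<le> dg S v"
  shows "hascyc S"
proof -
  obtain ys where ys: "pth ys" "set ys \<subseteq> S" "ys \<noteq> []"
    "\<And>zs. pth zs \<Longrightarrow> set zs \<subseteq> S \<Longrightarrow> length zs \<le> length ys"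
    using longest_path[OF assms(1,2)] by blast
  then obtain x xs where xs: "ys = x # xs" by (cases ys) auto
  have inn: "w \<in> set xs" if "w \<in> S" "E x w" for w
  proof (rule ccontr)
    assume "w \<notin> set xs"
    then have "pth (w # ys)" using ys xs that E_sym E_irrefl by (auto simp: pth_Cons)
    then show False using ys(4)[of "w # ys"] ys that by auto
  qed
  have "2 \<le> card {w\<in>S. E x w}" using assms(3)[of x] ys xs by (simp add: dg_def)
  then obtain a b where ab: "a \<in> S" "b \<in> S" "E x a" "E x b" "a \<noteq> b" using two_elems by blast
  then obtain i j where ij: "i < length xs" "xs ! i = a" "j < length xs" "xs ! j = b"
    using inn by (metis in_set_conv_nth)
  then have "i \<noteq> j" using ab by auto
  then obtain l where l: "l < length xs" "1 \<le> l" "E x (xs ! l)"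
    using ij ab by (metis less_one not_le)
  have "cycset (set (x # take (Suc l) xs))" using path_chord_cycset l ys xs by auto
  moreover have "set (x # take (Suc l) xs) \<subseteq> S" using ys xs set_take_subset by fastforce
  ultimately show ?thesis unfolding hascyc_def by blast
qed

text \<open>Deleting a vertex of degree at most one keeps at least as many edges as vertices, so the
  deletions stop at a nonempty set of minimum degree two.\<close>

lemma es_hascyc:
  assumes "finite S" "S \<noteq> {}" "2 * card S \<le> es S"
  shows "hascyc S"
  using assms
proof (induction "card S" arbitrary: S)
  case 0
  then show ?case by simp
next
  case (Suc n)
  show ?case
  proof (cases "\<forall>v\<in>S. 2 \<le> dg S v")
    case True
    then show ?thesis using min_deg2_hascyc Suc by blast
  next
    case False
    then obtain v where v: "v \<in> S" "dg S v \<le> 1" by force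
    have e: "es S = es (S - {v}) + 2 * dg S v" using es_remove v Suc by blast
    have c: "card (S - {v}) = n" using v Suc by simp
    have "S - {v} \<noteq> {}"
    proof
      assume "S - {v} = {}"
      then have "S = {v}" using v by blast
      then show False using Suc by simp
    qed
    moreover have "2 * card (S - {v}) \<le> es (S - {v})" using e c v Suc by simp
    ultimately have "hascyc (S - {v})" using Suc.hyps(1)[of "S - {v}"] c Suc.prems by simp
    then show ?thesis using hascyc_mono by blast
  qed
qed

text \<open>One edge more allows a vertex to be spared: a vertex of degree at most two takes at most
  two edges with it, and if all degrees are at least three, any vertex may go. The spared vertex
  makes a rebuilt cycle strictly smaller, as in \<open>C_induced\<close> and
  \<open>eb_long\<close>.\<close>

lemma es_hascyc_proper:
  assumes "finite S" "2 * card S + 2 \<le> es S"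
  shows "\<exists>v\<in>S. hascyc (S - {v})"
proof -
  have ne: "S \<noteq> {}" using assms by auto
  show ?thesis
  proof (cases "\<exists>v\<in>S. dg S v \<le> 2")
    case True
    then obtain v where v: "v \<in> S" "dg S v \<le> 2" by blast
    have e: "es S = es (S - {v}) + 2 * dg S v" using es_remove v assms by blast
    have "card S = card (S - {v}) + 1" using v assms(1) by (simp add: card_gt_0_iff ne)
    then have le: "2 * card (S - {v}) \<le> es (S - {v})" using e v assms by simp
    have "S - {v} \<noteq> {}"
    proof
      assume "S - {v} = {}"
      then have "S = {v}" using v by blast
      then show False using assms by simp
    qed
    then show ?thesis using es_hascyc le v assms by blast
  next
    case False
    obtain v where v: "v \<in> S" using ne by blast
    have d: "2 \<le> dg (S - {v}) w" if "w \<in> S - {v}" for w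
    proof -
      have "dg S w = dg (S - {v}) w + (if E w v then 1 else 0)"
        using dg_insert[of v "S - {v}" w] v by (simp add: insert_absorb)
      then show ?thesis using False that by (auto split: if_splits)
    qed
    have "dg S v \<noteq> 0" using False v by auto
    then have "S - {v} \<noteq> {}" by (metis dg_Diff_self dg_empty)
    then have "hascyc (S - {v})" using min_deg2_hascyc[of "S - {v}"] d assms(1) by blast
    then show ?thesis using v by blast
  qed
qed

end

lemma mod_neq:
  fixes a b n :: nat
  assumes "a < b" "b < a + n"
  shows "a mod n \<noteq> b mod n"
proof
  assume "a mod n = b mod n"
  then have "n dvd b - a" using mod_eq_dvd_iff_nat[of a b n] assms by simp
  then show False using assms nat_dvd_not_less[of "b - a" n] by simp
qed

section \<open>Consecutive vertices and arcs of a cycle\<close>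

context fin_sgraph
begin

lemma even_es: "finite S \<Longrightarrow> even (es S)"
proof (induction S rule: finite_induct)
  case (insert x F)
  then show ?case using es_insert[of x F] by simp
qed simp

lemma cyc_rotate_n: "cyc xs \<Longrightarrow> cyc (rotate n xs)"
  by (metis cyc_rotate rotate_drop_take append_take_drop_id)

text \<open>More than half of the positions satisfy \<open>P\<close>, so this set of positions meets
  its cyclic shift by one. The list is rotated so that the two consecutive vertices become its ends,
  between which a new vertex can be placed.\<close>

lemma consecutive_pair:
  assumes "cyc xs" "length xs < 2 * card {w\<in>set xs. P w}"
  obtains ys where "cyc ys" "set ys = set xs" "P (hd ys)" "P (last ys)"
proof -
  let ?N = "length xs"
  have N: "3 \<le> ?N" and d: "distinct xs" using assms by (auto simp: cyc_def)
  let ?I = "{i. i < ?N \<and> P (xs ! i)}"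
  let ?s = "\<lambda>i. Suc i mod ?N"
  have "bij_betw (\<lambda>i. xs ! i) ?I {w\<in>set xs. P w}"
    using d by (auto simp: bij_betw_def inj_on_def nth_eq_iff_index_eq in_set_conv_nth)
  then have cI: "card ?I = card {w\<in>set xs. P w}" by (rule bij_betw_same_card)
  have inj: "inj_on ?s {..<?N}"
  proof (rule inj_onI)
    fix x y assume "x \<in> {..<?N}" "y \<in> {..<?N}" "?s x = ?s y"
    then show "x = y" by (auto simp: mod_Suc split: if_splits)
  qed
  have "card (?s ` ?I) = card ?I"
    by (rule card_image) (rule inj_on_subset[OF inj], auto)
  moreover have "?s ` ?I \<union> ?I \<subseteq> {..<?N}" using N by (auto intro!: mod_less_divisor)
  then have "card (?s ` ?I \<union> ?I) \<le> ?N" using card_mono[of "{..<?N}"] by simp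
  ultimately have "?s ` ?I \<inter> ?I \<noteq> {}"
    using card_Un_disjoint[of "?s ` ?I" ?I] assms(2) cI by fastforce
  then obtain i where i: "i < ?N" "P (xs ! i)" "P (xs ! ?s i)" by auto
  let ?ys = "rotate (Suc i) xs"
  have ne: "xs \<noteq> []" using N by auto
  have "hd ?ys = xs ! ?s i" using hd_rotate_conv_nth[OF ne] by blast
  moreover have "last ?ys = xs ! i"
  proof -
    have "last ?ys = ?ys ! (?N - 1)" using ne by (subst last_conv_nth) auto
    also have "\<dots> = xs ! ((Suc i + (?N - 1)) mod ?N)" using nth_rotate N by (metis diff_less le_trans less_numeral_extra(1) not_less_eq_eq numeral_3_eq_3 not_le zero_less_Suc gr0I)
    also have "Suc i + (?N - 1) = i + ?N" using N by simp
    finally show ?thesis using i by simp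
  qed
  ultimately show ?thesis
    using that[OF cyc_rotate_n[OF assms(1), of "Suc i"]] i by (simp del: rotate_Suc)
qed

lemma cycset_consecutive:
  assumes "cycset C" "card C < 2 * card {w\<in>C. P w}"
  obtains ys where "cyc ys" "set ys = C" "P (hd ys)" "P (last ys)"
proof -
  obtain xs where "cyc xs" "set xs = C" using assms cycset_def by auto
  then show ?thesis using consecutive_pair[of xs P] assms(2) that
    by (metis cyc_def distinct_card)
qed

text \<open>A vertex adjacent to more than half of a cycle fits between two consecutive
  neighbours.\<close>

lemma cycset_insert:
  assumes "cycset C" "y \<notin> C" "card C < 2 * dg C y"
  shows "cycset (insert y C)"
proof -
  obtain ys where ys: "cyc ys" "set ys = C" "E y (hd ys)" "E y (last ys)"
    using cycset_consecutive[of C "E y"] assms by (auto simp: dg_def)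
  have "cycset (set (y # ys))"
    by (rule cycsetI) (use ys assms in \<open>auto simp: pth_Cons cyc_pth E_commute\<close>)
  then show ?thesis using ys by simp
qed

lemma triangle_cycset:
  assumes "E a b" "E b c" "E a c"
  shows "cycset {a,b,c}"
proof -
  have "cycset (set [a,b,c])"
    by (rule cycsetI) (use assms in \<open>auto simp: pth_Cons E_commute, (metis E_irrefl)+\<close>)
  then show ?thesis by simp
qed

lemma quad_cycset:
  assumes "E a b" "E b c" "E c d" "E d a" "a \<noteq> c" "b \<noteq> d"
  shows "cycset {a,b,c,d}"
proof -
  have "cycset (set [a,b,c,d])"
    by (rule cycsetI) (use assms in \<open>auto simp: pth_Cons E_commute, (metis E_irrefl)+\<close>)
  then show ?thesis by simp
qed

lemma cycset_dg:
  assumes "cycset C" "v \<in> C"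
  shows "2 \<le> dg C v"
proof -
  obtain xs where xs: "cyc (v # xs)" "set (v # xs) = C" using cyc_startE assms by blast
  then have l: "2 \<le> length xs" "distinct xs" by (auto simp: cyc_def)
  then have "hd xs \<noteq> last xs" by (cases xs) (auto split: if_splits)
  moreover have "xs \<noteq> []" using l by auto
  then have "{hd xs, last xs} \<subseteq> {w\<in>C. E v w}" using xs by (auto simp: cyc_pth pth_Cons E_commute)
  then have "card {hd xs, last xs} \<le> dg C v" unfolding dg_def by (intro card_mono) auto
  ultimately show ?thesis by simp
qed

lemma cycset_remove_es:
  assumes "cycset C" "v \<in> C"
  shows "2 * (card C - 2) \<le> es (C - {v})"
proof -
  obtain xs where xs: "cyc (v # xs)" "set (v # xs) = C" using cyc_startE assms by blast
  then have "pth xs" "v \<notin> set xs" by (auto simp: cyc_pth pth_Cons)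
  moreover from this have "card C = length xs + 1" "card (set xs) = length xs"
    using xs distinct_card[of xs] by (auto simp: pth_def)
  moreover have "C - {v} = set xs" using xs calculation by auto
  ultimately show ?thesis using pth_es[of xs] by simp
qed

lemma pth_es': "pth xs \<Longrightarrow> 2 * (card (set xs) - 1) \<le> es (set xs)"
  using pth_es distinct_card pth_def by metis

text \<open>The sets \<open>A\<close> are the three closed arcs into which the \<open>w\<close> divide the cycle.\<close>
lemma three_arcs:
  assumes "cycset C" "w1 \<in> C" "w2 \<in> C" "w3 \<in> C" "w1 \<noteq> w2" "w2 \<noteq> w3" "w1 \<noteq> w3"
  shows "\<exists>\<A>. \<Inter>\<A> = {} \<and> finite \<A> \<and> card \<A> \<le> 3 \<and> (\<forall>A\<in>\<A>. A \<subseteq> C \<and> 2 * (card A - 1) \<le> es A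
      \<and> 2 * (card (C - A) - 1) \<le> es (C - A) \<and> (\<exists>u v. u \<noteq> v \<and> u \<in> A \<and> v \<in> A \<and> u \<in> {w1,w2,w3} \<and> v \<in> {w1,w2,w3}))"
    (is "?Q {w1,w2,w3}")
proof -
  have main: "?Q {w1,w2,w3}" if wc: "cyc (w1 # as @ w2 # bs @ w3 # cs)" "set (w1 # as @ w2 # bs @ w3 # cs) = C"
    for w1 w2 w3 as bs cs
  proof -
    let ?A1 = "set (w1 # as @ [w2])" and ?A2 = "set (w2 # bs @ [w3])" and ?A3 = "set (w3 # cs @ [w1])"
    have c1: "cyc (w2 # bs @ w3 # cs @ w1 # as)" using cyc_rotate[of "w1 # as" "w2 # bs @ w3 # cs"] wc by simp
    have c2: "cyc (w3 # cs @ w1 # as @ w2 # bs)" using cyc_rotate[of "w1 # as @ w2 # bs" "w3 # cs"] wc by simp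
    have p: "pth (w1 # as @ [w2])" "pth (bs @ w3 # cs)"
      "pth (w2 # bs @ [w3])" "pth (cs @ w1 # as)" "pth (w3 # cs @ [w1])" "pth (as @ w2 # bs)"
      using wc c1 c2 by (auto simp: cyc_pth pth_Cons pth_append hd_append split: if_splits)
    have d: "distinct (w1 # as @ w2 # bs @ w3 # cs)" using wc by (simp add: cyc_def)
    have compl: "C - ?A1 = set (bs @ w3 # cs)" "C - ?A2 = set (cs @ w1 # as)" "C - ?A3 = set (as @ w2 # bs)"
      using wc d by auto
    have inter: "\<Inter>{?A1,?A2,?A3} = {}" using d by auto
    have sub: "?A1 \<subseteq> C" "?A2 \<subseteq> C" "?A3 \<subseteq> C" using wc by auto
    have two: "\<exists>u v. u \<noteq> v \<and> u \<in> ?A1 \<and> v \<in> ?A1 \<and> u \<in> {w1,w2,w3} \<and> v \<in> {w1,w2,w3}"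
      "\<exists>u v. u \<noteq> v \<and> u \<in> ?A2 \<and> v \<in> ?A2 \<and> u \<in> {w1,w2,w3} \<and> v \<in> {w1,w2,w3}"
      "\<exists>u v. u \<noteq> v \<and> u \<in> ?A3 \<and> v \<in> ?A3 \<and> u \<in> {w1,w2,w3} \<and> v \<in> {w1,w2,w3}"
      subgoal by (rule exI[of _ w1], rule exI[of _ w2]) (use d in auto)
      subgoal by (rule exI[of _ w2], rule exI[of _ w3]) (use d in auto)
      subgoal by (rule exI[of _ w3], rule exI[of _ w1]) (use d in auto)
      done
    have card: "card {?A1,?A2,?A3} \<le> 3" by (simp add: card_insert_if)
    show ?thesis
      by (rule exI[of _ "{?A1,?A2,?A3}"])
        (use inter card sub two compl pth_es'[OF p(1)] pth_es'[OF p(2)] pth_es'[OF p(3)] pth_es'[OF p(4)]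
          pth_es'[OF p(5)] pth_es'[OF p(6)] in \<open>simp only: ball_simps finite.intros simp_thms insert_iff empty_iff HOL.simp_thms\<close>)
  qed
  obtain xs where xs: "cyc (w1 # xs)" "set (w1 # xs) = C" using cyc_startE assms by blast
  then have "w2 \<in> set xs" using assms by auto
  then obtain as ys where ys: "xs = as @ w2 # ys" using split_list by metis
  show ?thesis
  \<comment> \<open>The cyclic order may also be \<open>w1\<close>, \<open>w3\<close>,
    \<open>w2\<close>; the claim does not depend on the order of the three vertices.\<close>
  proof (cases "w3 \<in> set ys")
    case True
    then obtain bs cs where "ys = bs @ w3 # cs" using split_list by metis
    then show ?thesis using main[of w1 as w2 bs w3 cs] xs ys by simp
  next
    case False
    then have "w3 \<in> set as" using xs ys assms by auto
    then obtain bs cs where "as = bs @ w3 # cs" using split_list by metis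
    then show ?thesis using main[of w1 bs w3 cs w2 ys] xs ys by (simp add: insert_commute)
  qed
qed

text \<open>The two closed arcs between \<open>u\<close> and \<open>w\<close> have
  \<open>card C + 2\<close> vertices together, and the smaller one is taken.\<close>

lemma two_arcs:
  assumes "cycset C" "u \<in> C" "w \<in> C" "u \<noteq> w"
  shows "\<exists>A\<subseteq>C. u \<in> A \<and> w \<in> A \<and> 2 * card A \<le> card C + 2 \<and> 2 * (card A - 1) \<le> es A"
proof -
  obtain xs where xs: "cyc (u # xs)" "set (u # xs) = C" using cyc_startE assms by blast
  then have "w \<in> set xs" using assms by auto
  then obtain as bs where ab: "xs = as @ w # bs" using split_list by metis
  have p: "pth (u # as @ [w])" "pth (w # bs @ [u])"
    using xs ab by (auto simp: cyc_pth pth_Cons pth_append hd_append split: if_splits)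
  have c: "card C = length as + length bs + 2" using xs ab distinct_card[of "u # xs"] by (simp add: cyc_def)
  have "card (set (u # as @ [w])) = length as + 2" "card (set (w # bs @ [u])) = length bs + 2"
    using p distinct_card pth_def by (metis One_nat_def add_2_eq_Suc' length_Cons length_append_singleton)+
  moreover have "set (u # as @ [w]) \<subseteq> C" "set (w # bs @ [u]) \<subseteq> C" using xs ab by auto
  moreover have "u \<in> set (u # as @ [w])" "w \<in> set (u # as @ [w])" "u \<in> set (w # bs @ [u])" "w \<in> set (w # bs @ [u])" by auto
  moreover have "2 * (length as + 2) \<le> card C + 2 \<or> 2 * (length bs + 2) \<le> card C + 2" using c by arith
  ultimately show ?thesis using pth_es'[OF p(1)] pth_es'[OF p(2)] by metis
qed

section \<open>Systems of disjoint cycles\<close>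

definition csys :: "nat \<Rightarrow> 'a set set \<Rightarrow> bool" where
  "csys k \<C> \<longleftrightarrow> finite \<C> \<and> card \<C> = k \<and> disjoint \<C> \<and> (\<forall>C\<in>\<C>. cycset C)"

lemma csys_fin: "csys k \<C> \<Longrightarrow> finite (\<Union>\<C>)"
  unfolding csys_def using cycset_fin by auto

lemma csys_V: "csys k \<C> \<Longrightarrow> \<Union>\<C> \<subseteq> V"
  unfolding csys_def using cycset_V by blast

lemma cycset_ne: "\<not> cycset {}"
  using cycset_card[of "{}"] by auto

lemma csys_add:
  assumes "csys k \<C>" "cycset X" "X \<inter> \<Union>\<C> = {}"
  shows "csys (Suc k) (insert X \<C>)"
proof -
  have "X \<noteq> {}" using assms cycset_ne by blast
  then have "X \<notin> \<C>" using assms by blast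
  moreover have "disjoint (insert X \<C>)"
    using assms by (auto simp: csys_def disjoint_def)
  ultimately show ?thesis using assms by (auto simp: csys_def)
qed

lemma csys_remove: "csys (Suc k) \<C> \<Longrightarrow> C \<in> \<C> \<Longrightarrow> csys k (\<C> - {C})"
  by (auto simp: csys_def disjoint_def)

lemma csys_Diff: "csys k \<C> \<Longrightarrow> C \<in> \<C> \<Longrightarrow> \<Union>(\<C> - {C}) = \<Union>\<C> - C"
  unfolding csys_def disjoint_def by blast

lemma csys_card: "csys k \<C> \<Longrightarrow> C \<in> \<C> \<Longrightarrow> card (\<Union>\<C>) = card (\<Union>(\<C> - {C})) + card C"
  using csys_Diff[of k \<C> C] csys_fin[of k \<C>]
  by (metis Sup_upper card_Diff_subset card_mono finite_subset le_add_diff_inverse2)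

lemma csys_replace:
  assumes "csys k \<C>" "C \<in> \<C>" "cycset X" "X \<inter> (\<Union>\<C> - C) = {}"
  shows "csys k (insert X (\<C> - {C}))" "\<Union>(insert X (\<C> - {C})) = X \<union> (\<Union>\<C> - C)"
    "card (\<Union>(insert X (\<C> - {C}))) + card C = card (\<Union>\<C>) + card X"
proof -
  obtain j where j: "k = Suc j" using assms by (metis csys_def card_0_eq empty_iff not0_implies_Suc)
  have r: "csys j (\<C> - {C})" using csys_remove assms j by blast
  have u: "\<Union>(\<C> - {C}) = \<Union>\<C> - C" using csys_Diff assms by blast
  show "csys k (insert X (\<C> - {C}))" using csys_add[OF r assms(3)] u assms j by simp
  show uu: "\<Union>(insert X (\<C> - {C})) = X \<union> (\<Union>\<C> - C)" using u by simp
  have "card (X \<union> (\<Union>\<C> - C)) = card X + card (\<Union>\<C> - C)"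
    using assms csys_fin cycset_fin by (intro card_Un_disjoint) auto
  then show "card (\<Union>(insert X (\<C> - {C}))) + card C = card (\<Union>\<C>) + card X"
    using uu u csys_card[OF assms(1,2)] by simp
qed

lemma dg_Union:
  assumes "finite \<D>" "disjoint \<D>"
  shows "dg (\<Union>\<D>) v = (\<Sum>D\<in>\<D>. dg D v)"
  using assms
proof (induction \<D> rule: finite_induct)
  case (insert D \<D>)
  then have "D \<inter> \<Union>\<D> = {}" "disjoint \<D>" by (auto simp: disjoint_def)
  then show ?case using dg_Un[of D "\<Union>\<D>" v] insert by simp
qed simp

lemma dg_csys: "csys k \<C> \<Longrightarrow> dg (\<Union>\<C>) v = (\<Sum>D\<in>\<C>. dg D v)"
  by (simp add: csys_def dg_Union)

lemma eb_csys: "csys k \<C> \<Longrightarrow> eb A (\<Union>\<C>) = (\<Sum>D\<in>\<C>. eb A D)"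
  unfolding eb_def using sum.swap by (simp add: dg_csys sum.swap[of _ \<C> A])

lemma csys_cards: "csys k \<C> \<Longrightarrow> card (\<Union>\<C>) = (\<Sum>D\<in>\<C>. card D)"
  unfolding csys_def using card_Union_disjoint cycset_fin by (metis disjoint_def pairwise_def disjnt_def)

lemma sum_cyclic_shift:
  assumes "distinct xs"
  shows "(\<Sum>i<length xs. g (xs ! ((s + i) mod length xs))) = (\<Sum>v\<in>set xs. g v)"
proof -
  have "(\<Sum>v\<in>set xs. g v) = (\<Sum>v\<in>set (rotate s xs). g v)" by simp
  also have "\<dots> = sum_list (map g (rotate s xs))"
    using assms by (simp add: sum_list_distinct_conv_sum_set)
  also have "\<dots> = (\<Sum>i<length xs. g (rotate s xs ! i))"
    by (simp add: sum_list_sum_nth atLeast0LessThan)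
  also have "\<dots> = (\<Sum>i<length xs. g (xs ! ((s + i) mod length xs)))"
    by (intro sum.cong) (auto simp: nth_rotate)
  finally show ?thesis by simp
qed

end

section \<open>Disjoint cycles with a minimum number of vertices\<close>

text \<open>Applied to the even number \<open>es S\<close>, where a strict inequality improves by
  two, that is, by one edge.\<close>

lemma even_less_double:
  fixes a b :: nat
  shows "even a \<Longrightarrow> a < 2 * b \<Longrightarrow> a + 2 \<le> 2 * b" "even a \<Longrightarrow> 2 * b < a \<Longrightarrow> 2 * b + 2 \<le> a"
  by presburger+

text \<open>The step from \<open>k\<close> to \<open>k + 1\<close> cycles by contradiction:
  \<open>max_number\<close> is the assumption to be refuted, and \<open>F\<close> will be the vertex
  set of the remaining forest.\<close>

locale min_csys = fin_sgraph V E for V :: "'a set" and E +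
  fixes k :: nat and \<C> :: "'a set set"
  assumes sys: "csys k \<C>"
    and min_total: "csys k \<D> \<Longrightarrow> card (\<Union>\<C>) \<le> card (\<Union>\<D>)"
    and max_number: "\<not> csys (Suc k) \<D>"
begin

definition F :: "'a set" where "F = V - \<Union>\<C>"

lemma finF[simp]: "finite F" by (simp add: F_def finV)

lemma C_cyc: "C \<in> \<C> \<Longrightarrow> cycset C" using sys by (simp add: csys_def)

lemma C_fin: "C \<in> \<C> \<Longrightarrow> finite C" using C_cyc cycset_fin by blast

lemma C_F: "C \<in> \<C> \<Longrightarrow> C \<inter> F = {}" unfolding F_def by blast

lemma C_sub: "C \<in> \<C> \<Longrightarrow> C \<subseteq> V" using C_cyc cycset_V by blast

lemma C_card: "C \<in> \<C> \<Longrightarrow> 3 \<le> card C" using C_cyc cycset_card by blast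

lemma C_disj: "C \<in> \<C> \<Longrightarrow> D \<in> \<C> \<Longrightarrow> C \<noteq> D \<Longrightarrow> C \<inter> D = {}"
  using sys by (auto simp: csys_def disjoint_def)

lemma F_acyclic: "\<not> hascyc F"
proof
  assume "hascyc F"
  then obtain X where "X \<subseteq> F" "cycset X" by (auto simp: hascyc_def)
  then show False using csys_add[OF sys, of X] max_number by (auto simp: F_def)
qed

text \<open>A cycle inside \<open>S\<close> could take the place of \<open>C\<close>, since it
  avoids all other cycles of the system.\<close>

lemma one_cycle:
  assumes "C \<in> \<C>" "S \<subseteq> C \<union> F" "hascyc S"
  shows "card C \<le> card S"
proof -
  obtain X where X: "X \<subseteq> S" "cycset X" using assms by (auto simp: hascyc_def)
  have i: "X \<inter> (\<Union>\<C> - C) = {}" using X assms by (auto simp: F_def)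
  have "finite (C \<union> F)" using C_fin assms(1) by simp
  then have "finite S" using assms(2) finite_subset by blast
  then have "card X \<le> card S" using X card_mono by blast
  then show ?thesis using csys_replace(3)[OF sys assms(1) X(2) i]
      min_total[OF csys_replace(1)[OF sys assms(1) X(2) i]] by linarith
qed

text \<open>Exchanging \<open>C\<close> for two disjoint cycles would raise the number of cycles to
  \<open>k + 1\<close>.\<close>

lemma no_two_cycles:
  assumes "C \<in> \<C>" "S \<subseteq> C \<union> F" "T \<subseteq> C \<union> F" "S \<inter> T = {}"
  shows "\<not> (hascyc S \<and> hascyc T)"
proof
  assume "hascyc S \<and> hascyc T"
  then obtain X Y where X: "X \<subseteq> S" "cycset X" and Y: "Y \<subseteq> T" "cycset Y" by (auto simp: hascyc_def)
  have i: "X \<inter> (\<Union>\<C> - C) = {}" using X assms by (auto simp: F_def)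
  note r = csys_replace[OF sys assms(1) X(2) i]
  have "Y \<inter> \<Union>(insert X (\<C> - {C})) = {}" unfolding r(2) using X Y assms by (auto simp: F_def)
  then show False using csys_add[OF r(1) Y(2)] max_number by blast
qed

text \<open>The two cycles found could be exchanged for \<open>C\<close> and \<open>D\<close>
  without touching the rest of the system.\<close>

lemma two_cycles:
  assumes "C \<in> \<C>" "D \<in> \<C>" "C \<noteq> D" "S \<subseteq> C \<union> D \<union> F" "T \<subseteq> C \<union> D \<union> F" "S \<inter> T = {}" "hascyc S" "hascyc T"
  shows "card C + card D \<le> card S + card T"
proof -
  obtain X Y where X: "X \<subseteq> S" "cycset X" and Y: "Y \<subseteq> T" "cycset Y"
    using assms(7,8) by (auto simp: hascyc_def)
  have "k \<noteq> 0" using assms(1) sys unfolding csys_def by (metis card_0_eq empty_iff)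
  then obtain j where j: "k = Suc j" using not0_implies_Suc by blast
  have r: "csys j (\<C> - {C})" using csys_remove[OF sys[unfolded j] assms(1)] .
  have u: "\<Union>(\<C> - {C}) = \<Union>\<C> - C" using csys_Diff[OF sys assms(1)] .
  have D: "D \<in> \<C> - {C}" using assms(2,3) by simp
  have i: "X \<inter> (\<Union>(\<C> - {C}) - D) = {}" unfolding u using X(1) assms(4) unfolding F_def by blast
  note r2 = csys_replace[OF r D X(2) i]
  have "Y \<inter> X = {}" "Y \<inter> (\<Union>\<C> - C - D) = {}"
    using X(1) Y(1) assms(5,6) unfolding F_def by blast+
  then have i2: "Y \<inter> \<Union>(insert X (\<C> - {C} - {D})) = {}" unfolding r2(2) u by blast
  have n: "csys k (insert Y (insert X (\<C> - {C} - {D})))" using csys_add[OF r2(1) Y(2) i2] j by simp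
  have "card (\<Union>(insert Y (insert X (\<C> - {C} - {D})))) = card Y + card (\<Union>(insert X (\<C> - {C} - {D})))"
    unfolding Union_insert[of Y] by (rule card_Un_disjoint[OF cycset_fin[OF Y(2)] csys_fin[OF r2(1)] i2])
  then have "card (\<Union>\<C>) \<le> card Y + card (\<Union>(insert X (\<C> - {C} - {D})))" using min_total[OF n] by simp
  moreover have "card (\<Union>\<C>) = card (\<Union>(\<C> - {C})) + card C" using csys_card[OF sys assms(1)] .
  moreover have "finite (C \<union> D \<union> F)" using C_fin assms(1,2) by simp
  then have "finite S" "finite T" using finite_subset[OF assms(4)] finite_subset[OF assms(5)] by blast+
  then have "card X \<le> card S" "card Y \<le> card T" using X Y by (auto intro: card_mono)
  ultimately show ?thesis using r2(3) by linarith
qed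

lemma F_es: "S \<subseteq> F \<Longrightarrow> S \<noteq> {} \<Longrightarrow> es S + 2 \<le> 2 * card S"
proof -
  assume a: "S \<subseteq> F" "S \<noteq> {}"
  then have f: "finite S" using finF finite_subset by blast
  have "\<not> hascyc S" using a F_acyclic hascyc_mono by blast
  then have "es S < 2 * card S" using es_hascyc f a by force
  then show ?thesis using even_es[OF f] even_less_double(1) by blast
qed

lemma small_set: "finite {a,b,c}" "card {a,b,c} \<le> 3" by (auto simp: card_insert_if)

lemma no_triangle:
  assumes "C \<in> \<C>" "4 \<le> card C" "{a,b,c} \<subseteq> C \<union> F" "E a b" "E b c"
  shows "\<not> E a c"
proof
  assume "E a c"
  then have "hascyc {a,b,c}" using triangle_cycset assms cycset_hascyc by blast
  then have "card C \<le> 3" using one_cycle[OF assms(1,3)] small_set(2)[of a b c] by linarith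
  then show False using assms by simp
qed

lemma dg3: "C \<in> \<C> \<Longrightarrow> card C = 3 \<Longrightarrow> dg C v \<le> 3"
  using dg_le_card[of C v] C_fin by simp

text \<open>Two consecutive neighbours on the cycle would form a triangle with \<open>v\<close>,
  which is smaller than \<open>C\<close>.\<close>

lemma dg_4:
  assumes "C \<in> \<C>" "v \<in> F" "4 \<le> card C"
  shows "2 * dg C v \<le> card C"
proof (rule ccontr)
  assume "\<not> ?thesis"
  then obtain ys where ys: "cyc ys" "set ys = C" "E v (hd ys)" "E v (last ys)"
    using cycset_consecutive[of C "E v"] C_cyc assms by (auto simp: dg_def)
  then have "E (last ys) (hd ys)" "ys \<noteq> []" by (auto simp: cyc_def)
  then have "hd ys \<in> C" "last ys \<in> C" "E (last ys) (hd ys)" using ys by auto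
  then show False using no_triangle[OF assms(1,3), of v "hd ys" "last ys"] ys assms E_sym by auto
qed

text \<open>Two neighbours, the shorter arc between them and \<open>v\<close> carry a cycle of at
  most \<open>card C / 2 + 2\<close> vertices, which is less than \<open>card C\<close> from five
  vertices on.\<close>

lemma dg_5:
  assumes "C \<in> \<C>" "v \<in> F" "5 \<le> card C"
  shows "dg C v \<le> 1"
proof (rule ccontr)
  assume "\<not> ?thesis"
  then obtain u w where uw: "u \<in> C" "w \<in> C" "E v u" "E v w" "u \<noteq> w"
    using two_elems[of "{w\<in>C. E v w}"] by (auto simp: dg_def)
  then obtain A where A: "A \<subseteq> C" "u \<in> A" "w \<in> A" "2 * card A \<le> card C + 2" "2 * (card A - 1) \<le> es A"
    using two_arcs[of C u w] C_cyc assms by blast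
  have fA: "finite A" "v \<notin> A" using A assms C_fin C_F finite_subset by blast+
  have "{u,w} \<subseteq> {x\<in>A. E v x}" using uw A by auto
  then have "card {u,w} \<le> dg A v" unfolding dg_def by (intro card_mono) auto
  then have "2 \<le> dg A v" using uw by simp
  then have "2 * card (insert v A) \<le> es (insert v A)" using fA A by (simp add: es_insert)
  then have "hascyc (insert v A)" using es_hascyc fA by blast
  then have "card C \<le> card A + 1" using one_cycle[OF assms(1), of "insert v A"] A assms fA by auto
  then show False using A assms by linarith
qed

lemma dg_le:
  assumes "C \<in> \<C>" "v \<in> F"
  shows "dg C v \<le> 3" "4 \<le> card C \<Longrightarrow> dg C v \<le> 2" "5 \<le> card C \<Longrightarrow> dg C v \<le> 1"
proof -
  show 5: "5 \<le> card C \<Longrightarrow> dg C v \<le> 1" using dg_5 assms by blast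
  show 4: "4 \<le> card C \<Longrightarrow> dg C v \<le> 2"
    using 5 dg_4[OF assms] by (cases "card C = 4") auto
  show "dg C v \<le> 3" using 4 dg3[OF assms(1), of v] C_card[OF assms(1)] by (cases "card C = 3") auto
qed

text \<open>A chord would give more edges than vertices on \<open>C\<close>, hence a cycle that
  avoids one of its vertices.\<close>

lemma C_induced:
  assumes "C \<in> \<C>" "v \<in> C"
  shows "dg C v = 2"
proof (rule ccontr)
  assume n: "dg C v \<noteq> 2"
  note c = C_cyc[OF assms(1)] C_fin[OF assms(1)]
  have "(\<Sum>v\<in>C. 2) < es C" unfolding eb_def
  proof (rule sum_strict_mono_ex1)
    show "finite C" by (rule c)
    show "\<forall>x\<in>C. 2 \<le> dg C x" using cycset_dg[OF c(1)] by blast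
    show "\<exists>a\<in>C. 2 < dg C a" using n cycset_dg[OF c(1) assms(2)] assms(2) by (intro bexI[of _ v]) auto
  qed
  then have "2 * card C < es C" by simp
  then have "2 * card C + 2 \<le> es C" using even_es[OF c(2)] even_less_double(2) by blast
  then obtain w where "w \<in> C" "hascyc (C - {w})" using es_hascyc_proper c by blast
  moreover from this have "card (C - {w}) < card C" using c by (intro card_Diff1_less)
  ultimately show False using one_cycle[OF assms(1), of "C - {w}"] by fastforce
qed

text \<open>Otherwise, as \<open>D\<close> is not larger than \<open>C\<close>, some
  \<open>u\<close> in \<open>D\<close> has three neighbours on \<open>C\<close>. Each closed arc
  \<open>A\<close> between two of them contains a cycle together with \<open>u\<close>. Were there
  three edges between \<open>C - A\<close> and \<open>D - {u}\<close>, these two paths would carry a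
  cycle that spares a vertex, and the new pair would be smaller than \<open>C\<close> and
  \<open>D\<close>. The three complements cover \<open>C\<close>, so at most six edges avoid
  \<open>u\<close>.\<close>

lemma eb_long:
  assumes C: "C \<in> \<C>" "6 \<le> card C" and D: "D \<in> \<C>" "C \<noteq> D" "card D \<le> card C"
  shows "eb C D \<le> 2 * card C"
proof (rule ccontr)
  assume "\<not> ?thesis"
  moreover have fin: "finite C" "finite D" using C D C_fin by auto
  ultimately have big: "2 * card C < (\<Sum>u\<in>D. dg C u)" using eb_commute[of C D] by (simp add: eb_def)
  have "\<exists>u\<in>D. 3 \<le> dg C u"
  proof (rule ccontr)
    assume "\<not> ?thesis"
    then have "(\<Sum>u\<in>D. dg C u) \<le> (\<Sum>u\<in>D. 2)" by (intro sum_mono) force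
    then show False using big D by simp
  qed
  then obtain u where u: "u \<in> D" "3 \<le> dg C u" by blast
  obtain W where "W \<subseteq> {w\<in>C. E u w}" "card W = 3"
    using obtain_subset_with_card_n[OF u(2)[unfolded dg_def]] by blast
  then obtain w1 w2 w3 where w: "{w1,w2,w3} \<subseteq> {w\<in>C. E u w}" "w1 \<noteq> w2" "w2 \<noteq> w3" "w1 \<noteq> w3"
    by (auto simp: card_3_iff)
  have w1: "w1 \<in> C" "w2 \<in> C" "w3 \<in> C" using w by auto
  obtain \<A> where A: "\<Inter>\<A> = {}" "finite \<A>" "card \<A> \<le> 3" "\<And>A. A \<in> \<A> \<Longrightarrow> A \<subseteq> C \<and> 2 * (card A - 1) \<le> es A
      \<and> 2 * (card (C - A) - 1) \<le> es (C - A) \<and> (\<exists>u v. u \<noteq> v \<and> u \<in> A \<and> v \<in> A \<and> u \<in> {w1,w2,w3} \<and> v \<in> {w1,w2,w3})"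
    using three_arcs[OF C_cyc[OF C(1)] w1 w(2-4)] by metis
  let ?D = "D - {u}"
  have CD: "C \<inter> D = {}" using C_disj C D by blast
  have cD: "card ?D = card D - 1" "3 \<le> card D" using fin u C_card D by auto
  have bound: "eb (C - A) ?D \<le> 2" if AA: "A \<in> \<A>" for A
  proof (rule ccontr)
    assume n: "\<not> ?thesis"
    note a = A(4)[OF AA]
    have fA: "finite A" "finite (C - A)" using a fin finite_subset by blast+
    have ne: "C - A \<noteq> {}" using n by (metis eb_empty(1) zero_le)
    let ?S = "(C - A) \<union> ?D"
    have disj: "(C - A) \<inter> ?D = {}" using CD by blast
    have cS: "card ?S = card (C - A) + card ?D" using disj fA fin by (simp add: card_Un_disjoint)
    have "es ?S = es (C - A) + es ?D + 2 * eb (C - A) ?D"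
      using es_Un[OF disj] fA fin by simp
    moreover have "2 * (card D - 2) \<le> es ?D" using cycset_remove_es C_cyc D u by blast
    moreover have "1 \<le> card (C - A)" using ne fA by (simp add: Suc_leI card_gt_0_iff)
    \<comment> \<open>The two paths have \<open>card ?S - 2\<close> edges, and at least three edges
      run between them.\<close>
    ultimately have "2 * card ?S + 2 \<le> es ?S" using a n cS cD by linarith
    then obtain v where v: "v \<in> ?S" "hascyc (?S - {v})"
      using es_hascyc_proper[of ?S] fA fin by auto
    have uA: "u \<notin> A" using a u CD by blast
    obtain x y where xy: "x \<noteq> y" "x \<in> A" "y \<in> A" "x \<in> {w1,w2,w3}" "y \<in> {w1,w2,w3}" using a by blast
    then have "E u x" "E u y" using w(1) by blast+
    then have "{x,y} \<subseteq> {z\<in>A. E u z}" using xy by blast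
    then have "card {x,y} \<le> dg A u" unfolding dg_def by (intro card_mono) auto
    then have "2 \<le> dg A u" using xy by simp
    then have "2 * card A + 2 \<le> es A + 2 * dg A u" using a by linarith
    then have "2 * card (insert u A) \<le> es (insert u A)" using fA uA by (simp add: es_insert)
    then have h: "hascyc (insert u A)" using es_hascyc fA by blast
    have "card C + card D \<le> card (insert u A) + card (?S - {v})"
    proof (rule two_cycles[OF C(1) D(1,2) _ _ _ h v(2)])
      show "insert u A \<subseteq> C \<union> D \<union> F" "?S - {v} \<subseteq> C \<union> D \<union> F" using a u(1) by blast+
      show "insert u A \<inter> (?S - {v}) = {}" using a u(1) CD by blast
    qed
    moreover have "card (?S - {v}) < card ?S" using v fA fin by (intro card_Diff1_less) auto
    moreover have "card (insert u A) = card A + 1" using uA fA by simp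
    moreover have "card C = card A + card (C - A)"
      using a fin fA by (simp add: card_Diff_subset card_mono)
    ultimately show False using cS cD by linarith
  qed
  have "C \<subseteq> (\<Union>A\<in>\<A>. C - A)" using A(1) by auto
  then have "eb C ?D \<le> eb (\<Union>A\<in>\<A>. C - A) ?D" using fin A(2) by (intro eb_mono1) auto
  also have "\<dots> \<le> (\<Sum>A\<in>\<A>. eb (C - A) ?D)" unfolding eb_def
  proof -
    show "sum (dg ?D) (\<Union>A\<in>\<A>. C - A) \<le> (\<Sum>A\<in>\<A>. sum (dg ?D) (C - A))"
      using A(2) fin
    proof (induction \<A> rule: finite_induct)
      case (insert x X)
      have "sum (dg ?D) ((C - x) \<union> (\<Union>A\<in>X. C - A)) \<le> sum (dg ?D) (C - x) + sum (dg ?D) (\<Union>A\<in>X. C - A)"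
        using insert by (subst sum.union_inter[symmetric]) auto
      then show ?case using insert by simp
    qed simp
  qed
  also have "\<dots> \<le> (\<Sum>A\<in>\<A>. 2)" by (intro sum_mono bound)
  also have "\<dots> \<le> 6" using A(3) by simp
  finally have "eb C ?D \<le> 6" .
  moreover have "eb C D = eb C ?D + dg C u"
  proof -
    have "eb C D = eb D C" using eb_commute fin by blast
    also have "\<dots> = dg C u + eb ?D C" using eb_insert1[of u ?D C] u fin by (simp add: insert_absorb)
    finally show ?thesis using eb_commute[of C ?D] fin by simp
  qed
  moreover have "dg C u \<le> card C" using dg_le_card fin by blast
  \<comment> \<open>Six edges that avoid \<open>u\<close> and at most \<open>card C\<close> at
    \<open>u\<close>; this is where six vertices on \<open>C\<close> are required.\<close>
  ultimately have "eb C D \<le> 2 * card C" using C by linarith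
  then show False using big eb_commute[of C D] fin by (simp add: eb_def)
qed

lemma dg_V: "dg V v = dg F v + (\<Sum>C\<in>\<C>. dg C v)"
proof -
  have "V = F \<union> \<Union>\<C>" using csys_V[OF sys] by (auto simp: F_def)
  moreover have "F \<inter> \<Union>\<C> = {}" by (auto simp: F_def)
  ultimately show ?thesis using dg_Un[of F "\<Union>\<C>" v] dg_csys[OF sys] by simp
qed

lemma card_V: "card V = card F + (\<Sum>C\<in>\<C>. card C)"
proof -
  have "V = F \<union> \<Union>\<C>" using csys_V[OF sys] by (auto simp: F_def)
  moreover have "F \<inter> \<Union>\<C> = {}" by (auto simp: F_def)
  ultimately show ?thesis using card_Un_disjoint[of F "\<Union>\<C>"] csys_cards[OF sys] csys_fin[OF sys] by simp
qed

text \<open>On a longest cycle \<open>C\<close> the positions \<open>i\<close>,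
  \<open>i + 2\<close>, \<open>i + 4\<close> are independent, because \<open>C\<close> is chordless
  and has at least six vertices. Adding the triple bound over all \<open>i\<close> counts every
  degree three times, while by \<open>eb_long\<close> the degrees into the cycles sum to at most
  \<open>2 * k * card C\<close>. The missing \<open>5 * card C\<close> must come from three times
  the edges to \<open>F\<close>, and by \<open>dg_5\<close> every vertex of \<open>F\<close> has at
  most one.\<close>

lemma long_cycle:
  assumes sigma3: "\<And>a b c. a \<in> V \<Longrightarrow> b \<in> V \<Longrightarrow> c \<in> V \<Longrightarrow> a \<noteq> b \<Longrightarrow> b \<noteq> c \<Longrightarrow> a \<noteq> c \<Longrightarrow>
      \<not> E a b \<Longrightarrow> \<not> E b c \<Longrightarrow> \<not> E a c \<Longrightarrow> 6 * k + 5 \<le> dg V a + dg V b + dg V c"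
    and "C0 \<in> \<C>" "6 \<le> card C0"
  shows "10 \<le> card F"
proof -
  have finC: "finite \<C>" "card \<C> = k" using sys by (auto simp: csys_def)
  have "Max (card ` \<C>) \<in> card ` \<C>" using finC assms(2) by (intro Max_in) auto
  then obtain C where "C \<in> \<C>" "card C = Max (card ` \<C>)" by auto
  then have C: "C \<in> \<C>" "\<And>D. D \<in> \<C> \<Longrightarrow> card D \<le> card C" using finC by auto
  then have C6: "6 \<le> card C" using assms by (metis le_trans)
  obtain xs where xs: "cyc xs" "set xs = C" using C_cyc C cycset_def by auto
  let ?N = "length xs"
  have N: "?N = card C" "6 \<le> ?N" "distinct xs" using xs C6 distinct_card[of xs] by (auto simp: cyc_def)
  let ?f = "\<lambda>s i. xs ! ((s + i) mod ?N)"
  have inC: "?f s i \<in> C" for s i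
  proof -
    have "0 < ?N" using N(2) by linarith
    then have "(s + i) mod ?N < ?N" by simp
    then show ?thesis using xs nth_mem by blast
  qed
  have E1: "E (xs ! i) (xs ! (Suc i mod ?N))" if "i < ?N" for i
  proof (cases "Suc i < ?N")
    case True
    then show ?thesis using xs by (simp add: cyc_def successively_conv_nth)
  next
    case False
    then have "i = ?N - 1" "Suc i = ?N" using that by auto
    moreover have "xs \<noteq> []" using N by auto
    ultimately show ?thesis using xs by (metis cyc_def hd_conv_nth last_conv_nth mod_self)
  qed
  have nth_neq: "xs ! (p mod ?N) \<noteq> xs ! (q mod ?N)" if "p < q" "q < p + ?N" for p q
  proof -
    have "0 < ?N" using N(2) by linarith
    then have "p mod ?N < ?N" "q mod ?N < ?N" by auto
    then show ?thesis using N(3) mod_neq[OF that] by (simp add: nth_eq_iff_index_eq)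
  qed
  have neq: "?f s i \<noteq> ?f t i" if "s < t" "t < s + ?N" for s t i
    using nth_neq[of "s + i" "t + i"] that by simp
  have nadj: "\<not> E (?f s i) (?f t i)" if st: "Suc s < t" "t + 1 < ?N + s" for s t i
  proof
    assume e: "E (?f s i) (?f t i)"
    \<comment> \<open>The predecessor on the cycle, written as a shift forward by
      \<open>?N - 1\<close>. Together with the successor and the far end of the chord it would be a
      third neighbour on the same cycle.\<close>
    let ?p = "s + i + (?N - 1)"
    have Np: "0 < ?N" using N(2) by linarith
    have e1: "E (?f s i) (?f (Suc s) i)"
      using E1[of "(s + i) mod ?N"] Np by (simp add: mod_Suc_eq)
    have "Suc ?p = s + i + ?N" using Np by simp
    then have "Suc (?p mod ?N) mod ?N = (s + i) mod ?N" by (metis mod_Suc_eq mod_add_self2)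
    moreover have "E (xs ! (?p mod ?N)) (xs ! (Suc (?p mod ?N) mod ?N))"
      by (rule E1) (rule mod_less_divisor[OF Np])
    ultimately have e2: "E (xs ! (?p mod ?N)) (?f s i)" by simp
    have n1: "?f (Suc s) i \<noteq> ?f t i" using neq[of "Suc s" t] st by simp
    have n2: "?f t i \<noteq> xs ! (?p mod ?N)" using nth_neq[of "t + i" ?p] st by simp
    have n3: "?f (Suc s) i \<noteq> xs ! (?p mod ?N)" using nth_neq[of "Suc s + i" ?p] N(2) by simp
    have "xs ! (?p mod ?N) \<in> C" using xs Np by auto
    then have "{?f (Suc s) i, ?f t i, xs ! (?p mod ?N)} \<subseteq> {w\<in>C. E (?f s i) w}"
      using e e1 e2 inC E_sym by blast
    then have "card {?f (Suc s) i, ?f t i, xs ! (?p mod ?N)} \<le> dg C (?f s i)"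
      unfolding dg_def by (intro card_mono) auto
    moreover have "card {?f (Suc s) i, ?f t i, xs ! (?p mod ?N)} = 3" using n1 n2 n3 by simp
    ultimately show False using C_induced[OF C(1) inC] by simp
  qed
  have tri: "6 * k + 5 \<le> dg V (?f 0 i) + dg V (?f 2 i) + dg V (?f 4 i)" for i
  proof (rule sigma3)
    show "?f 0 i \<in> V" "?f 2 i \<in> V" "?f 4 i \<in> V" using inC C C_sub by blast+
    show "?f 0 i \<noteq> ?f 2 i" "?f 2 i \<noteq> ?f 4 i" "?f 0 i \<noteq> ?f 4 i" by (rule neq; use N in linarith)+
    show "\<not> E (?f 0 i) (?f 2 i)" "\<not> E (?f 2 i) (?f 4 i)" "\<not> E (?f 0 i) (?f 4 i)" by (rule nadj; use N in linarith)+
  qed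
  have "(\<Sum>i<?N. 6 * k + 5) \<le> (\<Sum>i<?N. dg V (?f 0 i) + dg V (?f 2 i) + dg V (?f 4 i))"
    using tri by (intro sum_mono) blast
  also have "\<dots> = 3 * (\<Sum>v\<in>C. dg V v)"
    unfolding sum.distrib sum_cyclic_shift[OF N(3), of "dg V"] xs(2) by simp
  finally have low: "card C * (6 * k + 5) \<le> 3 * (\<Sum>v\<in>C. dg V v)" using N by simp
  have "(\<Sum>v\<in>C. dg V v) = eb C F + (\<Sum>D\<in>\<C>. eb C D)"
    using eb_csys[OF sys, of C] dg_csys[OF sys] by (simp add: dg_V sum.distrib eb_def)
  also have "(\<Sum>D\<in>\<C>. eb C D) = eb C C + (\<Sum>D\<in>\<C> - {C}. eb C D)" using C finC by (simp add: sum.remove)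
  also have "eb C C = 2 * card C" using C_induced[OF C(1)] by (simp add: eb_def)
  also have "(\<Sum>D\<in>\<C> - {C}. eb C D) \<le> (\<Sum>D\<in>\<C> - {C}. 2 * card C)"
    by (intro sum_mono) (use eb_long C C6 in auto)
  also have "(\<Sum>D\<in>\<C> - {C}. 2 * card C) = (k - 1) * (2 * card C)" using C finC by simp
  also have "eb C F \<le> card F"
  proof -
    have "eb C F = eb F C" using eb_commute C C_fin by auto
    also have "\<dots> \<le> (\<Sum>v\<in>F. 1)" unfolding eb_def by (intro sum_mono) (use dg_5 C C6 in auto)
    finally show ?thesis by simp
  qed
  finally have "(\<Sum>v\<in>C. dg V v) \<le> card F + (2 * card C + (k - 1) * (2 * card C))" by simp
  moreover have "0 < k" using C finC by (metis card_gt_0_iff empty_iff)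
  then have "2 * card C + (k - 1) * (2 * card C) = k * (2 * card C)" by (cases k) auto
  ultimately have "(\<Sum>v\<in>C. dg V v) \<le> card F + k * (2 * card C)" by simp
  then have "3 * (\<Sum>v\<in>C. dg V v) \<le> 3 * (card F + k * (2 * card C))" by (rule mult_le_mono2)
  then have "card C * (6 * k + 5) \<le> 3 * (card F + k * (2 * card C))" using low by (rule order_trans[rotated])
  then have "5 * card C \<le> 3 * card F" by (simp add: algebra_simps)
  then show ?thesis using C6 by linarith
qed

end

section \<open>A longest path outside the cycles\<close>

lemma bool_A:
  assumes "xa \<and> xb \<longrightarrow> \<not> pc \<and> \<not> qc" "xa \<and> xc \<longrightarrow> \<not> pb \<and> \<not> qb" "xb \<and> xc \<longrightarrow> \<not> pa \<and> \<not> qa"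
    and "pa \<and> pb \<and> qc \<longrightarrow> \<not> xc" "pa \<and> pc \<and> qb \<longrightarrow> \<not> xb" "pb \<and> pc \<and> qa \<longrightarrow> \<not> xa"
  shows "(of_bool xa + of_bool xb + of_bool xc) + (of_bool pa + of_bool pb + of_bool pc)
    + (of_bool qa + of_bool qb + of_bool qc) \<le> (6::nat)"
proof -
  have le1: "of_bool p \<le> (1::nat)" for p by simp
  note le = le1[of pa] le1[of pb] le1[of pc] le1[of qa] le1[of qb] le1[of qc]
  have s: "of_bool a + of_bool b + of_bool c \<le> (2::nat)" if "\<not> (a \<and> b \<and> c)" for a b c
    using that by (cases a; cases b; cases c; simp)
  consider "xa \<and> xb \<and> xc" | "xa \<and> xb \<and> \<not> xc" | "xa \<and> \<not> xb \<and> xc" | "\<not> xa \<and> xb \<and> xc"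
    | "xa \<and> \<not> xb \<and> \<not> xc" | "\<not> xa \<and> xb \<and> \<not> xc" | "\<not> xa \<and> \<not> xb \<and> xc" | "\<not> xa \<and> \<not> xb \<and> \<not> xc"
    by argo
  then show ?thesis
  proof cases
    case 5
    then show ?thesis using s[of pb pc qa] assms(6) le by simp
  next
    case 6
    then show ?thesis using s[of pa pc qb] assms(5) le by simp
  next
    case 7
    then show ?thesis using s[of pa pb qc] assms(4) le by simp
  qed (use assms(1-3) le in \<open>simp_all\<close>)
qed

text \<open>For a vertex \<open>a\<close> of a triangle, \<open>fa\<close> and \<open>ga\<close>
  stand for its numbers of neighbours in two disjoint edges outside the cycles, see
  \<open>tri8\<close>. This is the case in which the first edge sends at least half of the
  eight.\<close>

lemma weights_aux:
  fixes fa fb fc ga gb gc :: nat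
  assumes "fa \<le> 2" "fb \<le> 2" "fc \<le> 2"
    and "8 \<le> fa + fb + fc + ga + gb + gc" "4 \<le> fa + fb + fc" "ga \<le> 2" "gb \<le> 2" "gc \<le> 2"
    and "fa = 2 \<longrightarrow> gb + gc \<le> 1" "fb = 2 \<longrightarrow> ga + gc \<le> 1" "fc = 2 \<longrightarrow> ga + gb \<le> 1"
  shows False
proof -
  have "fa = 2 \<or> fa \<le> 1" "fb = 2 \<or> fb \<le> 1" "fc = 2 \<or> fc \<le> 1" using assms(1-3) by linarith+
  then show False using assms by (elim disjE; simp)
qed

lemma weights:
  fixes fa fb fc ga gb gc :: nat
  assumes "fa \<le> 2" "fb \<le> 2" "fc \<le> 2" "ga \<le> 2" "gb \<le> 2" "gc \<le> 2"
    and "8 \<le> fa + fb + fc + ga + gb + gc"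
    and "fa = 2 \<longrightarrow> gb + gc \<le> 1" "fb = 2 \<longrightarrow> ga + gc \<le> 1" "fc = 2 \<longrightarrow> ga + gb \<le> 1"
    and "ga = 2 \<longrightarrow> fb + fc \<le> 1" "gb = 2 \<longrightarrow> fa + fc \<le> 1" "gc = 2 \<longrightarrow> fa + fb \<le> 1"
  shows False
proof (cases "4 \<le> fa + fb + fc")
  case True
  show False by (rule weights_aux[of fa fb fc ga gb gc]) (use assms True in simp_all)
next
  case False
  then have "4 \<le> ga + gb + gc" using assms(7) by linarith
  then show False by (intro weights_aux[of ga gb gc fa fb fc]) (use assms in simp_all)
qed
text \<open>Here \<open>x\<close> and \<open>y\<close> stand for two vertices off the path and
  \<open>p\<close> for its first vertex. The more of the triangle \<open>p\<close> sees, the less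
  \<open>x\<close> and \<open>y\<close> can see: one vertex each if \<open>p\<close> sees all three,
  two each if it sees some.\<close>

lemma bool_B:
  assumes "xa \<and> xb \<longrightarrow> \<not> pc" "xa \<and> xc \<longrightarrow> \<not> pb" "xb \<and> xc \<longrightarrow> \<not> pa"
    and "ya \<and> yb \<longrightarrow> \<not> pc" "ya \<and> yc \<longrightarrow> \<not> pb" "yb \<and> yc \<longrightarrow> \<not> pa"
  shows "(of_bool xa + of_bool xb + of_bool xc) + (of_bool ya + of_bool yb + of_bool yc)
    + (of_bool pa + of_bool pb + of_bool pc) \<le> (6::nat)"
proof -
  have s2: "of_bool a + of_bool b + of_bool c \<le> (2::nat)" if "\<not> (a \<and> b \<and> c)" for a b c
    using that by (cases a; cases b; cases c; simp)
  have s1: "of_bool a + of_bool b + of_bool c \<le> (1::nat)" if "\<not> (a \<and> b)" "\<not> (b \<and> c)" "\<not> (a \<and> c)" for a b c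
    using that by (cases a; cases b; cases c; simp)
  have s3: "of_bool a + of_bool b + of_bool c \<le> (3::nat)" for a b c
    by (cases a; cases b; cases c; simp)
  consider "pa \<and> pb \<and> pc" | "(pa \<or> pb \<or> pc) \<and> \<not> (pa \<and> pb \<and> pc)" | "\<not> pa \<and> \<not> pb \<and> \<not> pc" by argo
  then show ?thesis
  proof cases
    case 1
    then show ?thesis using s1[of xa xb xc] s1[of ya yb yc] assms by simp
  next
    case 2
    then have "\<not> (xa \<and> xb \<and> xc)" "\<not> (ya \<and> yb \<and> yc)" using assms by blast+
    then show ?thesis using s2[of xa xb xc] s2[of ya yb yc] s2[of pa pb pc] 2 by linarith
  next
    case 3
    then show ?thesis using s3[of xa xb xc] s3[of ya yb yc] by simp
  qed
qed

text \<open>The path \<open>P\<close> is longest over the forests of all minimum systems, so a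
  triangle may be exchanged for another one before the path is extended. The degree bounds are those
  required for \<open>k + 1\<close> cycles.\<close>

locale extremal_csys = min_csys V E k \<C> for V :: "'a set" and E k \<C> +
  fixes P :: "'a list"
  assumes P_pth: "pth P" and P_F: "set P \<subseteq> F" and P_ne: "P \<noteq> []"
    and P_longest: "csys k \<D> \<Longrightarrow> card (\<Union>\<D>) = card (\<Union>\<C>) \<Longrightarrow> pth ys \<Longrightarrow> set ys \<subseteq> V - \<Union>\<D>
      \<Longrightarrow> length ys \<le> length P"
    and order: "5 * k + 3 \<le> card V"
    and sigma2: "a \<in> V \<Longrightarrow> b \<in> V \<Longrightarrow> a \<noteq> b \<Longrightarrow> \<not> E a b \<Longrightarrow>
      2 * k + 3 \<le> dg V a + dg V b \<and> (0 < k \<longrightarrow> 2 * k + 4 \<le> dg V a + dg V b)"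
    and sigma3: "a \<in> V \<Longrightarrow> b \<in> V \<Longrightarrow> c \<in> V \<Longrightarrow> a \<noteq> b \<Longrightarrow> b \<noteq> c \<Longrightarrow> a \<noteq> c \<Longrightarrow>
      \<not> E a b \<Longrightarrow> \<not> E b c \<Longrightarrow> \<not> E a c \<Longrightarrow> 6 * k + 5 \<le> dg V a + dg V b + dg V c"
begin

lemma F_V: "v \<in> F \<Longrightarrow> v \<in> V" by (simp add: F_def)

text \<open>\<open>z\<close> takes the place of \<open>c\<close> in the triangle, so \<open>ys\<close> is a path outside a system of the same size.\<close>
lemma swap:
  assumes "{a,b,c} \<in> \<C>" "a \<noteq> b" "b \<noteq> c" "a \<noteq> c" "z \<in> F" "E z a" "E z b"
    and "pth ys" "set ys \<subseteq> insert c (F - {z})"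
  shows "length ys \<le> length P"
proof -
  let ?C = "{a,b,c}"
  have zC: "z \<notin> ?C" using C_F[OF assms(1)] assms(5) by blast
  obtain xs where "cyc xs" "set xs = ?C" using C_cyc[OF assms(1)] cycset_def by auto
  have ab: "E a b"
  proof -
    have "dg ?C a = 2" using C_induced[OF assms(1)] by simp
    moreover have "{w\<in>?C. E a w} \<subseteq> {b,c}" using E_irrefl by blast
    moreover have "card {b,c} = 2" using assms by simp
    ultimately have "{w\<in>?C. E a w} = {b,c}" unfolding dg_def
      by (intro card_subset_eq) auto
    then show ?thesis by blast
  qed
  have X: "cycset {z,a,b}" using triangle_cycset[of z a b] ab assms(6,7) by simp
  have i: "{z,a,b} \<inter> (\<Union>\<C> - ?C) = {}" using assms(5) unfolding F_def by blast
  note r = csys_replace[OF sys assms(1) X i]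
  have "card {z,a,b} = card ?C" using zC assms(2-4) by simp
  then have c: "card (\<Union>(insert {z,a,b} (\<C> - {?C}))) = card (\<Union>\<C>)" using r(3) by linarith
  have "c \<in> V" using C_sub[OF assms(1)] by blast
  then have "insert c (F - {z}) \<subseteq> V - ({z,a,b} \<union> (\<Union>\<C> - ?C))"
    using zC assms(2-4) assms(1) unfolding F_def by blast
  then have "set ys \<subseteq> V - \<Union>(insert {z,a,b} (\<C> - {?C}))" using assms(9) r(2) by blast
  then show ?thesis using P_longest[OF r(1) c assms(8)] by blast
qed

lemma P_max: "pth ys \<Longrightarrow> set ys \<subseteq> F \<Longrightarrow> length ys \<le> length P"
  using P_longest[OF sys refl] by (simp add: F_def)

lemma end_nb:
  assumes "pth ys" "set ys \<subseteq> F" "length ys = length P" "E (hd ys) w" "w \<in> F"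
  shows "w \<in> set (tl ys)"
proof (rule ccontr)
  assume n: "w \<notin> set (tl ys)"
  have ne: "ys \<noteq> []" using assms P_ne by auto
  then have "ys = hd ys # tl ys" by simp
  then have "w \<notin> set ys" using n assms(4) E_irrefl by (metis set_ConsD)
  then have "pth (w # ys)" using assms E_sym by (auto simp: pth_Cons)
  then show False using P_max[of "w # ys"] assms by simp
qed

lemma end_dg:
  assumes "pth ys" "set ys \<subseteq> F" "length ys = length P"
  shows "dg F (hd ys) \<le> 1"
proof -
  have "ys \<noteq> []" using assms P_ne by auto
  then obtain x xs where xs: "ys = x # xs" by (cases ys) auto
  have "w = hd xs" if "w \<in> F" "E x w" for w
  proof -
    have "w \<in> set xs" using end_nb[OF assms] that xs by simp
    then obtain i where i: "i < length xs" "xs ! i = w" by (metis in_set_conv_nth)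
    have "i = 0"
    proof (rule ccontr)
      assume "i \<noteq> 0"
      then have "cycset (set (x # take (Suc i) xs))" using path_chord_cycset[of x xs i] assms(1) xs i that by simp
      moreover have "set (x # take (Suc i) xs) \<subseteq> F" using assms(2) xs set_take_subset[of "Suc i" xs] by auto
      ultimately show False using F_acyclic unfolding hascyc_def by blast
    qed
    then show ?thesis using i by (metis hd_conv_nth length_0_conv less_nat_zero_code)
  qed
  then have "{w\<in>F. E x w} \<subseteq> {hd xs}" by blast
  then have "card {w\<in>F. E x w} \<le> card {hd xs}" by (intro card_mono) auto
  then show ?thesis using xs by (simp add: dg_def)
qed

lemma hd_last:
  shows "hd P \<in> F" "last P \<in> F" "dg F (hd P) \<le> 1" "dg F (last P) \<le> 1"
    "w \<in> F \<Longrightarrow> E (hd P) w \<Longrightarrow> w \<in> set P" "w \<in> F \<Longrightarrow> E (last P) w \<Longrightarrow> w \<in> set P"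
proof -
  show "hd P \<in> F" "last P \<in> F" using P_F P_ne by auto
  show "dg F (hd P) \<le> 1" using end_dg[OF P_pth P_F] by simp
  show "dg F (last P) \<le> 1" using end_dg[of "rev P"] P_pth P_F P_ne by (simp add: pth_rev hd_rev)
  show "w \<in> F \<Longrightarrow> E (hd P) w \<Longrightarrow> w \<in> set P"
    using end_nb[OF P_pth P_F] by (metis list.set_sel(2) P_ne)
  show "w \<in> F \<Longrightarrow> E (last P) w \<Longrightarrow> w \<in> set P"
    using end_nb[of "rev P"] P_pth P_F P_ne
    by (simp add: pth_rev hd_rev) (metis list.set_sel(2) set_rev rev_is_Nil_conv)
qed

lemma P_edge: "Suc i < length P \<Longrightarrow> E (P ! i) (P ! Suc i)"
  using P_pth by (simp add: pth_def successively_conv_nth)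

lemma P_induced:
  assumes "i + 2 \<le> j" "j < length P"
  shows "\<not> E (P ! i) (P ! j)"
proof
  assume e: "E (P ! i) (P ! j)"
  let ?xs = "drop (Suc i) P"
  have d: "drop i P = P ! i # ?xs" using assms by (simp add: Cons_nth_drop_Suc)
  have "pth (drop i P)" using P_pth by (metis append_take_drop_id pth_append)
  moreover have "?xs ! (j - Suc i) = P ! j" using assms by simp
  ultimately have "cycset (set (P ! i # take (Suc (j - Suc i)) ?xs))"
    using path_chord_cycset[of "P ! i" ?xs "j - Suc i"] d e assms by simp
  moreover have "set (P ! i # take (Suc (j - Suc i)) ?xs) \<subseteq> set P"
    using assms by (auto dest: in_set_takeD in_set_dropD)
  ultimately show False using F_acyclic P_F unfolding hascyc_def by blast
qed

lemma P_neq: "i < j \<Longrightarrow> j < length P \<Longrightarrow> P ! i \<noteq> P ! j"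
  using P_pth by (simp add: pth_def nth_eq_iff_index_eq)

lemma P_in: "i < length P \<Longrightarrow> P ! i \<in> F"
  using P_F by auto

lemma triangle_cases:
  assumes "C \<in> \<C>" "card C = 3"
  obtains a b c where "C = {a,b,c}" "a \<noteq> b" "b \<noteq> c" "a \<noteq> c"
  using assms(2) card_3_iff by metis

lemma dg_tri: "a \<noteq> b \<Longrightarrow> b \<noteq> c \<Longrightarrow> a \<noteq> c \<Longrightarrow>
    dg {a,b,c} v = of_bool (E v a) + of_bool (E v b) + of_bool (E v c)"
  by (simp add: dg_insert)

text \<open>If \<open>x\<close> replaces \<open>c\<close> in the triangle, \<open>c\<close> becomes
  free and could extend \<open>P\<close> at any end adjacent to it.\<close>

lemma swap_out:
  assumes "{a,b,c} \<in> \<C>" "a \<noteq> b" "b \<noteq> c" "a \<noteq> c" "x \<in> F" "x \<notin> set P" "E x a" "E x b"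
  shows "\<not> E (hd P) c" "\<not> E (last P) c"
proof -
  have cP: "c \<notin> set P" using C_F[OF assms(1)] P_F by blast
  show "\<not> E (hd P) c"
  proof
    assume "E (hd P) c"
    then have "E c (hd P)" by (rule E_sym)
    then have "pth (c # P)" using P_pth cP by (simp add: pth_Cons)
    then show False using swap[OF assms(1-5,7,8), of "c # P"] P_F assms(6) by auto
  qed
  show "\<not> E (last P) c"
  proof
    assume "E (last P) c"
    then have "pth (P @ [c])" using P_pth cP by (simp add: pth_append)
    then show False using swap[OF assms(1-5,7,8), of "P @ [c]"] P_F assms(6) by auto
  qed
qed

text \<open>If the first vertex of \<open>P\<close> replaces \<open>c\<close> in the triangle, the
  rest of \<open>P\<close> could continue through \<open>c\<close> to \<open>x\<close>, which is one
  vertex longer than \<open>P\<close>.\<close>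

lemma swap_end:
  assumes "{a,b,c} \<in> \<C>" "a \<noteq> b" "b \<noteq> c" "a \<noteq> c" "x \<in> F" "x \<notin> set P" "2 \<le> length P"
    "E (hd P) a" "E (hd P) b" "E (last P) c"
  shows "\<not> E x c"
proof
  assume e: "E x c"
  obtain p ps where p: "P = p # ps" using P_ne by (cases P) auto
  have ps: "ps \<noteq> []" using assms(7) p by auto
  have c: "c \<notin> F" using C_F[OF assms(1)] by blast
  have "pth ps" "p \<notin> set ps" using P_pth p by (auto simp: pth_Cons)
  moreover have "c \<notin> set ps" "c \<noteq> x" "x \<notin> set ps" using c P_F p assms(5,6) by auto
  ultimately have "pth (ps @ [c, x])" using assms(10) e E_sym ps p by (auto simp: pth_append pth_Cons)
  moreover have "set (ps @ [c,x]) \<subseteq> insert c (F - {hd P})"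
    using P_F p assms(5,6) \<open>p \<notin> set ps\<close> by auto
  ultimately have "length (ps @ [c,x]) \<le> length P"
    using swap[OF assms(1-4) hd_last(1) assms(8,9)] by blast
  then show False using p by simp
qed

text \<open>Cycles of four or more vertices get at most two edges from each vertex. For a triangle,
  \<open>bool_A\<close> is used with \<open>x\<close> for the vertex off the path and
  \<open>p\<close>, \<open>q\<close> for the ends of \<open>P\<close>; its first three assumptions
  are instances of \<open>swap_out\<close>, the others of \<open>swap_end\<close>.\<close>

lemma triple_A:
  assumes "C \<in> \<C>" "x \<in> F" "x \<notin> set P" "2 \<le> length P"
  shows "dg C x + dg C (hd P) + dg C (last P) \<le> 6"
proof (cases "card C = 3")
  case True
  then obtain a b c where C: "C = {a,b,c}" and d: "a \<noteq> b" "b \<noteq> c" "a \<noteq> c" using triangle_cases assms(1) by metis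
  have m: "{a,b,c} \<in> \<C>" "{a,c,b} \<in> \<C>" "{b,c,a} \<in> \<C>" using assms(1) C by (simp_all add: insert_commute)
  note o1 = swap_out[OF m(1) d(1,2,3) assms(2,3)] swap_out[OF m(2) d(3) d(2)[symmetric] d(1) assms(2,3)]
    swap_out[OF m(3) d(2) d(3)[symmetric] d(1)[symmetric] assms(2,3)]
  note o2 = swap_end[OF m(1) d(1,2,3) assms(2-4)] swap_end[OF m(2) d(3) d(2)[symmetric] d(1) assms(2-4)]
    swap_end[OF m(3) d(2) d(3)[symmetric] d(1)[symmetric] assms(2-4)]
  show ?thesis unfolding C dg_tri[OF d]
    by (rule bool_A) (use o1 o2 in blast)+
next
  case False
  then have "4 \<le> card C" using C_card[OF assms(1)] by simp
  then have "dg C x \<le> 2" "dg C (hd P) \<le> 2" "dg C (last P) \<le> 2"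
    using dg_le(2)[OF assms(1)] assms(2) hd_last(1,2) by blast+
  then show ?thesis by linarith
qed

lemma triple_B:
  assumes "C \<in> \<C>" "x \<in> F" "x \<notin> set P" "y \<in> F" "y \<notin> set P"
  shows "dg C x + dg C y + dg C (hd P) \<le> 6"
proof (cases "card C = 3")
  case True
  then obtain a b c where C: "C = {a,b,c}" and d: "a \<noteq> b" "b \<noteq> c" "a \<noteq> c" using triangle_cases assms(1) by metis
  have m: "{a,b,c} \<in> \<C>" "{a,c,b} \<in> \<C>" "{b,c,a} \<in> \<C>" using assms(1) C by (simp_all add: insert_commute)
  note o1 = swap_out(1)[OF m(1) d(1,2,3) assms(2,3)] swap_out(1)[OF m(2) d(3) d(2)[symmetric] d(1) assms(2,3)]
    swap_out(1)[OF m(3) d(2) d(3)[symmetric] d(1)[symmetric] assms(2,3)]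
  note o2 = swap_out(1)[OF m(1) d(1,2,3) assms(4,5)] swap_out(1)[OF m(2) d(3) d(2)[symmetric] d(1) assms(4,5)]
    swap_out(1)[OF m(3) d(2) d(3)[symmetric] d(1)[symmetric] assms(4,5)]
  show ?thesis unfolding C dg_tri[OF d]
    by (rule bool_B) (use o1 o2 in blast)+
next
  case False
  then have "4 \<le> card C" using C_card[OF assms(1)] by simp
  then have "dg C x \<le> 2" "dg C y \<le> 2" "dg C (hd P) \<le> 2"
    using dg_le(2)[OF assms(1)] assms(2,4) hd_last(1) by blast+
  then show ?thesis by linarith
qed

lemma dg_V3: "dg V a + dg V b + dg V c = (dg F a + dg F b + dg F c) + (\<Sum>C\<in>\<C>. dg C a + dg C b + dg C c)"
  by (simp add: dg_V sum.distrib)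

lemma sum_C_le: "(\<And>C. C \<in> \<C> \<Longrightarrow> f C \<le> m) \<Longrightarrow> (\<Sum>C\<in>\<C>. f C) \<le> k * (m::nat)"
  using sum_bounded_above[of \<C> f m] sys by (simp add: csys_def)

text \<open>If all \<open>b\<close> vertices off the path had two neighbours in the forest, they
  would meet at least \<open>2 * b - (b - 1)\<close> edges, since fewer than \<open>b\<close> edges
  are counted twice. With the \<open>length P - 1\<close> edges of the path this is as many edges as
  vertices, too many for a forest.\<close>

lemma low_outside:
  assumes "F \<noteq> set P"
  shows "\<exists>x\<in>F - set P. dg F x \<le> 1"
proof (rule ccontr)
  assume n: "\<not> ?thesis"
  let ?B = "F - set P"
  have B: "?B \<noteq> {}" "finite ?B" using assms P_F by auto
  have d: "set P \<inter> ?B = {}" "set P \<union> ?B = F" using P_F by auto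
  have rP: "card (set P) = length P" "length P \<noteq> 0" using P_pth P_ne distinct_card by (auto simp: pth_def)
  have cF: "card F = length P + card ?B" using card_Un_disjoint[OF _ B(2) d(1)] d rP by simp
  have "es F = es (set P) + es ?B + 2 * eb (set P) ?B" using es_Un[OF d(1)] B d by simp
  moreover have "eb (set P) ?B = eb ?B (set P)" using eb_commute B by simp
  moreover have "eb ?B F = eb ?B (set P) + es ?B" using eb_Un2[OF d(1), of ?B] d by simp
  moreover have "2 * (length P - 1) \<le> es (set P)" using pth_es P_pth by blast
  moreover have "es ?B + 2 \<le> 2 * card ?B" using F_es[of ?B] B by blast
  moreover have "(\<Sum>v\<in>?B. 2) \<le> eb ?B F" unfolding eb_def by (intro sum_mono) (use n in force)
  moreover have "es F + 2 \<le> 2 * card F" using F_es[of F] B by blast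
  ultimately show False using cF rP by simp
qed

text \<open>A vertex of low degree off the path is independent of the two ends. The three have at
  most three neighbours in the forest and six edges to each cycle, which is two short of the triple
  bound.\<close>

lemma F_eq_P:
  assumes "3 \<le> length P"
  shows "F = set P"
proof (rule ccontr)
  assume "F \<noteq> set P"
  then obtain x where x: "x \<in> F" "x \<notin> set P" "dg F x \<le> 1" using low_outside by blast
  have hl: "hd P = P ! 0" "last P = P ! (length P - 1)" using P_ne by (auto simp: hd_conv_nth last_conv_nth)
  have n1: "\<not> E (hd P) (last P)" using P_induced[of 0 "length P - 1"] assms hl by simp
  have n2: "hd P \<noteq> last P" using P_neq[of 0 "length P - 1"] assms hl by simp
  have n3: "\<not> E x (hd P)" "\<not> E x (last P)" using x hd_last(5,6)[OF x(1)] E_sym by blast+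
  have n4: "x \<noteq> hd P" "x \<noteq> last P" using x P_ne by auto
  have "6 * k + 5 \<le> dg V x + dg V (hd P) + dg V (last P)"
    by (rule sigma3) (use n1 n2 n3 n4 x hd_last F_V in auto)
  also have "\<dots> \<le> 3 + k * 6" unfolding dg_V3
    by (intro add_mono sum_C_le triple_A) (use x hd_last(3,4) assms in auto)
  finally show False by simp
qed

text \<open>Otherwise \<open>x\<close>, \<open>y\<close> and an end of \<open>P\<close> form an
  independent triple, and \<open>triple_B\<close> keeps its degree sum below the triple
  bound.\<close>

lemma outside_adj:
  assumes "x \<in> F" "x \<notin> set P" "dg F x \<le> 1" "y \<in> F" "y \<notin> set P" "dg F y \<le> 1" "x \<noteq> y"
  shows "E x y"
proof (rule ccontr)
  assume n: "\<not> E x y"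
  have n3: "\<not> E x (hd P)" "\<not> E y (hd P)" using assms hd_last(5) E_sym by blast+
  have n4: "x \<noteq> hd P" "y \<noteq> hd P" using assms P_ne by auto
  have "6 * k + 5 \<le> dg V x + dg V y + dg V (hd P)"
    by (rule sigma3) (use n n3 n4 assms(1,4,7) hd_last(1) F_V in auto)
  also have "\<dots> \<le> 3 + k * 6" unfolding dg_V3
    by (intro add_mono sum_C_le triple_B) (use assms hd_last(3) in auto)
  finally show False by simp
qed

lemma short_P_dg:
  assumes "length P \<le> 2" "v \<in> F"
  shows "dg F v \<le> 1"
proof (rule ccontr)
  assume "\<not> ?thesis"
  then have "2 \<le> card {w\<in>F. E v w}" by (simp add: dg_def)
  then obtain a b where ab: "a \<in> F" "b \<in> F" "E v a" "E v b" "a \<noteq> b" using two_elems by blast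
  moreover have "a \<noteq> v" "v \<noteq> b" using ab E_irrefl by blast+
  ultimately have "pth [a,v,b]" using E_sym by (simp add: pth_Cons)
  then show False using P_max[of "[a,v,b]"] ab assms by simp
qed

lemma short_P_card:
  assumes "length P \<le> 2"
  shows "card (F - set P) \<le> 2"
proof (rule ccontr)
  assume "\<not> ?thesis"
  then have "3 \<le> card (F - set P)" by simp
  then obtain W where "W \<subseteq> F - set P" "card W = 3" using obtain_subset_with_card_n by metis
  then obtain x y z where w: "{x,y,z} \<subseteq> F - set P" "x \<noteq> y" "y \<noteq> z" "x \<noteq> z" by (auto simp: card_3_iff)
  then have "E x y" "E x z" using outside_adj short_P_dg[OF assms] by auto
  then have "{y,z} \<subseteq> {v\<in>F. E x v}" using w by auto
  then have "card {y,z} \<le> dg F x" unfolding dg_def by (intro card_mono) auto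
  then show False using short_P_dg[OF assms, of x] w by simp
qed

text \<open>Supplies the pair to which the pair bound is applied: the ends of \<open>P\<close> if it
  has three vertices; otherwise all degrees in the forest are at most one.\<close>

lemma nonadj_pair:
  assumes "3 \<le> card F"
  shows "\<exists>x y. x \<in> F \<and> y \<in> F \<and> x \<noteq> y \<and> \<not> E x y \<and> dg F x \<le> 1 \<and> dg F y \<le> 1"
proof (cases "3 \<le> length P")
  case True
  have hl: "hd P = P ! 0" "last P = P ! (length P - 1)" using P_ne by (auto simp: hd_conv_nth last_conv_nth)
  have n1: "\<not> E (hd P) (last P)" using P_induced[of 0 "length P - 1"] True hl by simp
  have n2: "hd P \<noteq> last P" using P_neq[of 0 "length P - 1"] True hl by simp
  show ?thesis using n1 n2 hd_last by blast
next
  case False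
  then have d: "\<And>v. v \<in> F \<Longrightarrow> dg F v \<le> 1" using short_P_dg by simp
  obtain W where "W \<subseteq> F" "card W = 3" using obtain_subset_with_card_n assms by metis
  then obtain x y z where w: "{x,y,z} \<subseteq> F" "x \<noteq> y" "y \<noteq> z" "x \<noteq> z" by (auto simp: card_3_iff)
  have "\<not> E x y \<or> \<not> E x z"
  proof (rule ccontr)
    assume "\<not> ?thesis"
    then have "{y,z} \<subseteq> {v\<in>F. E x v}" using w by auto
    then have "card {y,z} \<le> dg F x" unfolding dg_def by (intro card_mono) auto
    then show False using d[of x] w by simp
  qed
  then show ?thesis using w d by blast
qed

text \<open>The vertex \<open>z\<close> closes a triangle with the first edge. The opposite edge of
  \<open>C\<close>, the second edge and two edges between them are four edges on four vertices,
  hence carry a cycle disjoint from that triangle.\<close>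

lemma tri_pairs:
  assumes C: "C \<in> \<C>" "card C = 3" and z: "z \<in> C"
    and x: "{x1,x2} \<subseteq> F" "x1 \<noteq> x2" "E x1 x2" and y: "{y1,y2} \<subseteq> F" "y1 \<noteq> y2" "E y1 y2"
    and xy: "{x1,x2} \<inter> {y1,y2} = {}"
    and e: "dg {x1,x2} z = 2" "2 \<le> eb {y1,y2} (C - {z})"
  shows False
proof -
  have zF: "z \<notin> F" using C_F[OF C(1)] z by blast
  then have zx: "z \<notin> {x1,x2}" using x by blast
  have ex: "es {x1,x2} = 2" "es {y1,y2} = 2" using x y es_insert[of x1 "{x2}"] es_insert[of y1 "{y2}"]
    by (auto simp: dg_insert[of _ "{}"])
  have "es (insert z {x1,x2}) = 6" using es_insert[OF zx] ex e by simp
  moreover have "card (insert z {x1,x2}) = 3" using zx x by simp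
  ultimately have h1: "hascyc (insert z {x1,x2})" using es_hascyc[of "insert z {x1,x2}"] by simp
  have cz: "C - {z} \<subseteq> C" "card (C - {z}) = 2" using C z C_fin by auto
  have f: "finite (C - {z})" using C_fin[OF C(1)] by simp
  have "2 * (card C - 2) \<le> es (C - {z})" using cycset_remove_es[OF C_cyc[OF C(1)] z] .
  then have ecz: "2 \<le> es (C - {z})" using C by simp
  have d: "{y1,y2} \<inter> (C - {z}) = {}" using C_F[OF C(1)] y by blast
  have "es ({y1,y2} \<union> (C - {z})) = es {y1,y2} + es (C - {z}) + 2 * eb {y1,y2} (C - {z})"
    by (rule es_Un[OF d]) (use f in auto)
  then have "8 \<le> es ({y1,y2} \<union> (C - {z}))" using ex e ecz by linarith
  moreover have "card ({y1,y2} \<union> (C - {z})) = 4" using card_Un_disjoint[OF _ f d] cz y by simp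
  ultimately have h2: "hascyc ({y1,y2} \<union> (C - {z}))"
    using es_hascyc[of "{y1,y2} \<union> (C - {z})"] f by simp
  have "insert z {x1,x2} \<subseteq> C \<union> F" "{y1,y2} \<union> (C - {z}) \<subseteq> C \<union> F"
    using x(1) y(1) z by blast+
  moreover have "insert z {x1,x2} \<inter> ({y1,y2} \<union> (C - {z})) = {}"
    using xy x(1) y(1) zF C_F[OF C(1)] by blast
  ultimately show False using no_two_cycles[OF C(1)] h1 h2 by blast
qed

lemma tri8:
  assumes C: "C \<in> \<C>" "card C = 3"
    and x: "{x1,x2} \<subseteq> F" "x1 \<noteq> x2" "E x1 x2" and y: "{y1,y2} \<subseteq> F" "y1 \<noteq> y2" "E y1 y2"
    and xy: "{x1,x2} \<inter> {y1,y2} = {}"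
  shows "dg C x1 + dg C x2 + dg C y1 + dg C y2 \<le> 7"
proof (rule ccontr)
  assume n: "\<not> ?thesis"
  obtain a b c where Cabc: "C = {a,b,c}" and d: "a \<noteq> b" "b \<noteq> c" "a \<noteq> c" using triangle_cases C by metis
  have r: "C - {a} = {b,c}" "C - {b} = {a,c}" "C - {c} = {a,b}" "a \<in> C" "b \<in> C" "c \<in> C" using Cabc d by auto
  have yx: "{y1,y2} \<inter> {x1,x2} = {}" using xy by blast
  let ?f = "dg {x1,x2}" and ?g = "dg {y1,y2}"
  have two: "?f v \<le> 2" "?g v \<le> 2" for v using dg_le_card[of "{x1,x2}" v] dg_le_card[of "{y1,y2}" v] x y by auto
  have ebf: "eb {x1,x2} S = (\<Sum>v\<in>S. ?f v)" "eb {y1,y2} S = (\<Sum>v\<in>S. ?g v)" if "finite S" for S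
    using eb_commute[of _ S] that by (auto simp: eb_def)
  have tot: "dg C x1 + dg C x2 = ?f a + ?f b + ?f c" "dg C y1 + dg C y2 = ?g a + ?g b + ?g c"
    using ebf[of C] C_fin[OF C(1)] x y Cabc d by (auto simp: eb_def)
  note t1 = tri_pairs[OF C _ x y xy] and t2 = tri_pairs[OF C _ y x yx]
  show False
  proof (rule weights[of "?f a" "?f b" "?f c" "?g a" "?g b" "?g c"])
    show "8 \<le> ?f a + ?f b + ?f c + ?g a + ?g b + ?g c" using n tot by linarith
    show "?f a = 2 \<longrightarrow> ?g b + ?g c \<le> 1" using t1[OF r(4)] r(1) ebf(2)[of "{b,c}"] d by fastforce
    show "?f b = 2 \<longrightarrow> ?g a + ?g c \<le> 1" using t1[OF r(5)] r(2) ebf(2)[of "{a,c}"] d by fastforce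
    show "?f c = 2 \<longrightarrow> ?g a + ?g b \<le> 1" using t1[OF r(6)] r(3) ebf(2)[of "{a,b}"] d by fastforce
    show "?g a = 2 \<longrightarrow> ?f b + ?f c \<le> 1" using t2[OF r(4)] r(1) ebf(1)[of "{b,c}"] d by fastforce
    show "?g b = 2 \<longrightarrow> ?f a + ?f c \<le> 1" using t2[OF r(5)] r(2) ebf(1)[of "{a,c}"] d by fastforce
    show "?g c = 2 \<longrightarrow> ?f a + ?f b \<le> 1" using t2[OF r(6)] r(3) ebf(1)[of "{a,b}"] d by fastforce
  qed (use two in auto)
qed

end

section \<open>Excluding every size of the remaining forest\<close>

context extremal_csys
begin

text \<open>By \<open>long_cycle\<close> fewer than ten vertices outside force all cycles to have at
  most five vertices, and then the order bound leaves three.\<close>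

lemma card_F_ge: "3 \<le> card F" and short_cycles: "card F < 10 \<Longrightarrow> C \<in> \<C> \<Longrightarrow> card C \<le> 5"
proof -
  have short: "card C \<le> 5" if "card F < 10" "C \<in> \<C>" for C
    using long_cycle[OF sigma3 that(2)] that(1) by force
  then show "card F < 10 \<Longrightarrow> C \<in> \<C> \<Longrightarrow> card C \<le> 5" by blast
  show "3 \<le> card F"
  proof (cases "card F < 10")
    case True
    then have "(\<Sum>C\<in>\<C>. card C) \<le> k * 5" using short by (intro sum_C_le) blast
    then show ?thesis using card_V order by linarith
  qed simp
qed

lemma deficit:
  assumes "card F < 10"
  shows "(\<Sum>C\<in>\<C>. 5 - card C) + 3 \<le> card F"
proof -
  have "(\<Sum>C\<in>\<C>. 5 - card C) + (\<Sum>C\<in>\<C>. card C) = (\<Sum>C\<in>\<C>. 5)"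
    unfolding sum.distrib[symmetric] by (intro sum.cong) (use short_cycles[OF assms] in force)+
  also have "\<dots> = 5 * k" using sys by (simp add: csys_def)
  finally show ?thesis using card_V order by linarith
qed

text \<open>A vertex of the forest has at most 3, 2, 1 neighbours on a cycle of 3, 4, at least 5
  vertices. Each vertex by which a cycle falls short of five thus allows one more neighbour, and
  \<open>deficit\<close> limits the total by \<open>card F - 3\<close>.\<close>

lemma dg_def5:
  assumes "C \<in> \<C>" "v \<in> F"
  shows "dg C v \<le> 1 + (5 - card C)"
  using dg_le[OF assms] C_card[OF assms(1)] by (cases "card C = 3"; cases "card C = 4") auto

lemma dg_V_small:
  assumes "card F < 10" "v \<in> F"
  shows "dg V v + 3 \<le> dg F v + k + card F"
proof -
  have "(\<Sum>C\<in>\<C>. dg C v) \<le> (\<Sum>C\<in>\<C>. 1 + (5 - card C))" using dg_def5 assms(2) by (intro sum_mono) blast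
  also have "\<dots> = k + (\<Sum>C\<in>\<C>. 5 - card C)" using sys unfolding csys_def sum.distrib by simp
  finally show ?thesis using deficit[OF assms(1)] dg_V[of v] by linarith
qed

text \<open>With three vertices outside no cycle falls short of five, so two nonadjacent vertices of
  degree at most one in the forest have degree sum at most \<open>2 * k + 2\<close>.\<close>

lemma card_F_4: "4 \<le> card F"
proof (rule ccontr)
  assume n: "\<not> ?thesis"
  obtain x y where xy: "x \<in> F" "y \<in> F" "x \<noteq> y" "\<not> E x y" "dg F x \<le> 1" "dg F y \<le> 1"
    using nonadj_pair[OF card_F_ge] by blast
  have "2 * k + 3 \<le> dg V x + dg V y" using sigma2 xy F_V by blast
  then show False using dg_V_small[of x] dg_V_small[of y] n xy by linarith
qed

lemma k_pos: "0 < k"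
proof (rule ccontr)
  assume n: "\<not> ?thesis"
  obtain x y where xy: "x \<in> F" "y \<in> F" "x \<noteq> y" "\<not> E x y" "dg F x \<le> 1" "dg F y \<le> 1"
    using nonadj_pair[OF card_F_ge] by blast
  have "\<C> = {}" using sys n unfolding csys_def by auto
  then have "dg V x = dg F x" "dg V y = dg F y" using dg_V by simp_all
  then show False using sigma2[of x y] xy F_V by fastforce
qed

lemma quad_labels:
  assumes Q: "Q \<in> \<C>" "card Q = 4" and v: "v \<in> F" "dg Q v = 2"
  obtains a b c d where "Q = {a,b,c,d}" "distinct [a,b,c,d]" "E a b" "E b c" "E c d" "E d a"
    "E v a" "E v c" "\<not> E v b" "\<not> E v d"
proof -
  obtain w where w: "w \<in> Q" "E v w" using v(2) dg_eq_0[of Q v] by auto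
  obtain xs where xs: "cyc (w # xs)" "set (w # xs) = Q" using cyc_startE[OF C_cyc[OF Q(1)] w(1)] by blast
  then have "length (w # xs) = 4" using distinct_card[of "w # xs"] Q(2) by (simp add: cyc_def)
  then obtain b c d where bcd: "xs = [b,c,d]" by (auto simp: length_Suc_conv numeral_eq_Suc)
  have e: "E w b" "E b c" "E c d" "E d w" and ds: "distinct [w,b,c,d]" and q: "Q = {w,b,c,d}"
    using xs bcd by (auto simp: cyc_def)
  have "\<not> E v b" "\<not> E v d"
    using no_triangle[OF Q(1), of v w b] no_triangle[OF Q(1), of v w d] Q(2) w v(1) q e E_sym by auto
  moreover have "E v c"
  proof (rule ccontr)
    assume "\<not> E v c"
    then have "{x\<in>Q. E v x} \<subseteq> {w}" using q calculation by blast
    then have "card {x\<in>Q. E v x} \<le> card {w}" by (intro card_mono) auto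
    then show False using v(2) by (simp add: dg_def)
  qed
  ultimately show ?thesis using that[of w b c d] q ds e w(2) by blast
qed

lemma quad_two_cases:
  assumes Q: "{a,b,c,d} \<in> \<C>" "card {a,b,c,d} = 4" "E a b" "E b c" "E c d" "E d a" and v: "v \<in> F" "dg {a,b,c,d} v = 2"
  shows "(E v a \<and> E v c \<and> \<not> E v b \<and> \<not> E v d) \<or> (E v b \<and> E v d \<and> \<not> E v a \<and> \<not> E v c)"
proof -
  have n: "\<not> (E v a \<and> E v b)" "\<not> (E v b \<and> E v c)" "\<not> (E v c \<and> E v d)" "\<not> (E v d \<and> E v a)"
    using no_triangle[OF Q(1), of a v b] no_triangle[OF Q(1), of b v c] no_triangle[OF Q(1), of c v d]
      no_triangle[OF Q(1), of d v a] Q v(1) E_sym by auto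
  obtain x y where "x \<in> {a,b,c,d}" "y \<in> {a,b,c,d}" "E v x" "E v y" "x \<noteq> y"
    using two_elems[of "{w\<in>{a,b,c,d}. E v w}"] v(2) by (auto simp: dg_def)
  then show ?thesis using n by blast
qed

text \<open>As no triangle is allowed, the ends of an outside edge see complementary opposite pairs
  of the 4-cycle, so the edge lies on a 4-cycle with any side of it. Two disjoint edges and two
  opposite sides give two disjoint cycles.\<close>

lemma quad_edges:
  assumes Q: "Q \<in> \<C>" "card Q = 4"
    and x: "x1 \<in> F" "x2 \<in> F" "E x1 x2" and y: "y1 \<in> F" "y2 \<in> F" "E y1 y2" and xy: "{x1,x2} \<inter> {y1,y2} = {}"
    and d: "dg Q x1 = 2" "dg Q x2 = 2" "dg Q y1 = 2" "dg Q y2 = 2"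
  shows False
proof -
  obtain a b c e where q: "Q = {a,b,c,e}" "distinct [a,b,c,e]" "E a b" "E b c" "E c e" "E e a"
    and "E x1 a" "E x1 c" "\<not> E x1 b" "\<not> E x1 e" using quad_labels[OF Q x(1) d(1)] by blast
  note qc = quad_two_cases[OF Q[unfolded q(1)] q(3-6)]
  have alt: "(E u a \<and> E u c \<and> E w b \<and> E w e) \<or> (E u b \<and> E u e \<and> E w a \<and> E w c)"
    if "u \<in> F" "w \<in> F" "E u w" "dg Q u = 2" "dg Q w = 2" for u w
  proof -
    have "\<not> (E u v \<and> E w v)" if v: "v \<in> Q" for v
    proof
      assume "E u v \<and> E w v"
      then have "E v u" "E v w" using E_sym by blast+
      then show False using no_triangle[OF Q(1) _ _ _ \<open>E u w\<close>, of v] Q(2) v \<open>u \<in> F\<close> \<open>w \<in> F\<close> by simp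
    qed
    then have "\<not> (E u a \<and> E w a)" "\<not> (E u b \<and> E w b)" using q(1) by blast+
    then show ?thesis using qc[OF that(1)] qc[OF that(2)] that(4,5) q(1) by blast
  qed
  have h: "hascyc {u,w,a,b} \<and> hascyc {u,w,c,e}"
    if "u \<in> F" "w \<in> F" "E u w" "dg Q u = 2" "dg Q w = 2" for u w
  proof -
    have n: "u \<notin> Q" "w \<notin> Q" using that(1,2) C_F[OF Q(1)] by blast+
    then have n: "u \<noteq> a" "u \<noteq> b" "u \<noteq> c" "u \<noteq> e" "w \<noteq> a" "w \<noteq> b" "w \<noteq> c" "w \<noteq> e" using q(1) by auto
    from alt[OF that] show ?thesis
    proof
      assume "E u a \<and> E u c \<and> E w b \<and> E w e"
      then have *: "E w b" "E w e" "E a u" "E c u" using E_sym by blast+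
      have "cycset {u,w,b,a}" by (rule quad_cycset[OF that(3) *(1) E_sym[OF q(3)] *(3) n(2) n(5)])
      moreover have "cycset {u,w,e,c}" by (rule quad_cycset[OF that(3) *(2) E_sym[OF q(5)] *(4) n(4) n(7)])
      ultimately have "cycset {u,w,b,a}" "cycset {u,w,e,c}" .
      then show ?thesis using cycset_hascyc by (simp add: insert_commute)
    next
      assume "E u b \<and> E u e \<and> E w a \<and> E w c"
      then have *: "E w a" "E w c" "E b u" "E e u" using E_sym by blast+
      have "cycset {u,w,a,b}" by (rule quad_cycset[OF that(3) *(1) q(3) *(3) n(1) n(6)])
      moreover have "cycset {u,w,c,e}" by (rule quad_cycset[OF that(3) *(2) q(5) *(4) n(3) n(8)])
      ultimately have "cycset {u,w,a,b}" "cycset {u,w,c,e}" .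
      then show ?thesis using cycset_hascyc by simp
    qed
  qed
  have s1: "{x1,x2,a,b} \<subseteq> Q \<union> F" and s2: "{y1,y2,c,e} \<subseteq> Q \<union> F" using x(1,2) y(1,2) q(1) by auto
  have "a \<notin> F" "b \<notin> F" "c \<notin> F" "e \<notin> F" using C_F[OF Q(1)] q(1) by blast+
  then have "a \<notin> {y1,y2}" "b \<notin> {y1,y2}" "c \<notin> {x1,x2}" "e \<notin> {x1,x2}" using x(1,2) y(1,2) by blast+
  moreover have "{a,b} \<inter> {c,e} = {}" using q(2) by auto
  ultimately have s3: "{x1,x2,a,b} \<inter> {y1,y2,c,e} = {}" using xy by blast
  show False using no_two_cycles[OF Q(1) s1 s2 s3] h[OF x d(1,2)] h[OF y d(3,4)] by simp
qed

lemma P_dg: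
  assumes "i < length P" "F = set P"
  shows "dg F (P ! i) \<le> 2"
proof -
  have "{w\<in>F. E (P ! i) w} \<subseteq> {P ! (i - 1), P ! (i + 1)}"
  proof
    fix w assume "w \<in> {w\<in>F. E (P ! i) w}"
    then obtain j where j: "j < length P" "w = P ! j" "E (P ! i) (P ! j)"
      using assms(2) by (auto simp: in_set_conv_nth)
    have "\<not> i + 2 \<le> j" "\<not> j + 2 \<le> i" "i \<noteq> j"
      using P_induced[of i j] P_induced[of j i] j assms(1) E_sym E_irrefl by blast+
    then have "j = i - 1 \<or> j = i + 1" by linarith
    then show "w \<in> {P ! (i - 1), P ! (i + 1)}" using j by blast
  qed
  then have "dg F (P ! i) \<le> card {P ! (i - 1), P ! (i + 1)}" unfolding dg_def by (intro card_mono) auto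
  also have "\<dots> \<le> 2" by (simp add: card_insert_if)
  finally show ?thesis .
qed

lemma hd_last_nth: "hd P = P ! 0" "last P = P ! (length P - 1)"
  using P_ne by (auto simp: hd_conv_nth last_conv_nth)

lemma length_P: "F = set P \<Longrightarrow> length P = card F"
  using P_pth distinct_card by (metis pth_def)

lemma sum_ge_witness:
  assumes "12 * k \<le> (\<Sum>C\<in>\<C>. f C)"
  shows "\<exists>C\<in>\<C>. 12 \<le> f C"
proof (rule ccontr)
  assume "\<not> ?thesis"
  then have "(\<Sum>C\<in>\<C>. f C) \<le> k * 11" by (intro sum_C_le) force
  then show False using assms k_pos by linarith
qed

text \<open>A path of six vertices has room for three disjoint edges whose ends form two independent
  triples. Their degrees sum to at least \<open>12 * k + 10\<close>, of which at most ten lie in the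
  path, so some cycle gets twelve edges. Any two of the three edges send at most seven to a
  triangle, so all three send at most ten; on a 4-cycle all six ends would need two neighbours,
  which \<open>quad_edges\<close> excludes; longer cycles get at most six.\<close>

lemma not_long_path: "\<not> 6 \<le> card F"
proof
  assume f6: "6 \<le> card F"
  have r3: "3 \<le> length P"
  proof (rule ccontr)
    assume n: "\<not> ?thesis"
    then have "card (F - set P) \<le> 2" using short_P_card by simp
    moreover have "card (set P) = length P" using P_pth by (simp add: pth_def distinct_card)
    moreover have "card (F - set P) = card F - card (set P)" using P_F by (intro card_Diff_subset) auto
    ultimately show False using f6 n by linarith
  qed
  have FP: "F = set P" using F_eq_P[OF r3] .
  define r where "r = length P"
  have r: "6 \<le> r" "r = card F" using length_P[OF FP] f6 by (auto simp: r_def)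
  have inV: "P ! i \<in> V" if "i < r" for i using P_in[of i] F_V that by (simp add: r_def)
  have nadj: "\<not> E (P ! i) (P ! j)" if "i + 2 \<le> j" "j < r" for i j using P_induced that by (simp add: r_def)
  have neq: "P ! i \<noteq> P ! j" if "i < j" "j < r" for i j using P_neq that by (simp add: r_def)
  have t1: "6 * k + 5 \<le> dg V (P!0) + dg V (P!2) + dg V (P!(r-2))"
    by (rule sigma3) (rule inV neq nadj; use r in linarith)+
  have t2: "6 * k + 5 \<le> dg V (P!1) + dg V (P!3) + dg V (P!(r-1))"
    by (rule sigma3) (rule inV neq nadj; use r in linarith)+
  let ?e = "\<lambda>C. (dg C (P!0) + dg C (P!1)) + (dg C (P!2) + dg C (P!3)) + (dg C (P!(r-2)) + dg C (P!(r-1)))"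
  have dF: "dg F (P!0) \<le> 1" "dg F (P!(r-1)) \<le> 1" "dg F (P!1) \<le> 2" "dg F (P!2) \<le> 2" "dg F (P!3) \<le> 2" "dg F (P!(r-2)) \<le> 2"
    using hd_last(3,4) P_dg[OF _ FP] r hd_last_nth by (simp_all add: r_def)
  have "(\<Sum>C\<in>\<C>. ?e C) = ((\<Sum>C\<in>\<C>. dg C (P!0)) + (\<Sum>C\<in>\<C>. dg C (P!1))) + ((\<Sum>C\<in>\<C>. dg C (P!2)) + (\<Sum>C\<in>\<C>. dg C (P!3)))
     + ((\<Sum>C\<in>\<C>. dg C (P!(r-2))) + (\<Sum>C\<in>\<C>. dg C (P!(r-1))))" by (simp only: sum.distrib)
  moreover note dg_V[of "P!0"] dg_V[of "P!1"] dg_V[of "P!2"] dg_V[of "P!3"] dg_V[of "P!(r-2)"] dg_V[of "P!(r-1)"]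
  ultimately have "12 * k \<le> (\<Sum>C\<in>\<C>. ?e C)" using t1 t2 dF by linarith
  then obtain C where C: "C \<in> \<C>" "12 \<le> ?e C" using sum_ge_witness[of ?e] by blast
  have inF: "P!0 \<in> F" "P!1 \<in> F" "P!2 \<in> F" "P!3 \<in> F" "P!(r-2) \<in> F" "P!(r-1) \<in> F"
    using P_in r by (auto simp: r_def)
  note le = inF[THEN dg_le(1)[OF C(1)]] inF[THEN dg_le(2)[OF C(1)]] inF[THEN dg_le(3)[OF C(1)]]
  have ed: "E (P!0) (P!1)" "E (P!2) (P!3)" "E (P!(r-2)) (P!(r-1))"
  proof -
    show "E (P!0) (P!1)" "E (P!2) (P!3)" using P_edge[of 0] P_edge[of 2] r by (simp_all add: r_def numeral_eq_Suc)
    have "Suc (r - 2) = r - 1" using r by linarith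
    then show "E (P!(r-2)) (P!(r-1))" using P_edge[of "r-2"] r by (simp add: r_def)
  qed
  have n: "P!0 \<noteq> P!1" "P!2 \<noteq> P!3" "P!(r-2) \<noteq> P!(r-1)" "P!0 \<noteq> P!2" "P!0 \<noteq> P!3" "P!0 \<noteq> P!(r-2)" "P!0 \<noteq> P!(r-1)"
    "P!1 \<noteq> P!2" "P!1 \<noteq> P!3" "P!1 \<noteq> P!(r-2)" "P!1 \<noteq> P!(r-1)"
    "P!2 \<noteq> P!(r-2)" "P!2 \<noteq> P!(r-1)" "P!3 \<noteq> P!(r-2)" "P!3 \<noteq> P!(r-1)"
    by (rule neq; use r in linarith)+
  show False
  proof (cases "card C = 3")
    case True
    have "dg C (P!0) + dg C (P!1) + dg C (P!2) + dg C (P!3) \<le> 7"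
      by (rule tri8[OF C(1) True]) (use inF ed n in auto)
    moreover have "dg C (P!0) + dg C (P!1) + dg C (P!(r-2)) + dg C (P!(r-1)) \<le> 7"
      by (rule tri8[OF C(1) True]) (use inF ed n in auto)
    moreover have "dg C (P!2) + dg C (P!3) + dg C (P!(r-2)) + dg C (P!(r-1)) \<le> 7"
      by (rule tri8[OF C(1) True]) (use inF ed n in auto)
    ultimately show False using C(2) by linarith
  next
    case False
    then have c4: "4 \<le> card C" using C_card[OF C(1)] by simp
    note l2 = le(7-12)[OF c4]
    have all2: "dg C (P!0) = 2" "dg C (P!1) = 2" "dg C (P!2) = 2" "dg C (P!3) = 2" using l2 C(2) by linarith+
    have "card C = 4"
    proof (rule ccontr)
      assume "card C \<noteq> 4"
      then have "dg C (P!0) \<le> 1" using le(13) c4 by simp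
      then show False using all2 by simp
    qed
    then show False using quad_edges[OF C(1) _ inF(1,2) ed(1) inF(3,4) ed(2)] all2 n by simp
  qed
qed

end

text \<open>For \<open>five_path\<close>: \<open>x\<close>, \<open>y\<close>, \<open>z\<close> stand
  for the first, middle and last vertex of a path of five vertices, and \<open>c\<close> for a
  triangle vertex adjacent to the second one.\<close>

lemma bool_five:
  assumes "\<not> (xc \<and> ya \<and> yb)" "\<not> (xc \<and> za \<and> zb)" "\<not> (yc \<and> xa \<and> xb)" "\<not> (yc \<and> za \<and> zb)" "\<not> (zc \<and> xa \<and> xb)"
  shows "(of_bool xa + of_bool xb + of_bool xc) + (of_bool ya + of_bool yb + of_bool yc)
    + (of_bool za + of_bool zb + of_bool zc) \<le> (6::nat)"
proof -
  have le1: "of_bool p \<le> (1::nat)" for p by simp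
  note le = le1[of xa] le1[of xb] le1[of xc] le1[of ya] le1[of yb] le1[of yc] le1[of za] le1[of zb] le1[of zc]
  have s: "of_bool p + of_bool q \<le> (1::nat)" if "\<not> (p \<and> q)" for p q
    using that by (cases p; cases q; simp)
  consider "xc \<and> yc" | "xc \<and> \<not> yc" | "\<not> xc \<and> yc" | "\<not> xc \<and> \<not> yc \<and> zc" | "\<not> xc \<and> \<not> yc \<and> \<not> zc" by argo
  then show ?thesis
  proof cases
    case 1
    then show ?thesis using s[of ya yb] s[of za zb] s[of xa xb] assms le by simp
  next
    case 2
    then show ?thesis using s[of ya yb] s[of za zb] assms le by simp
  next
    case 3
    then show ?thesis using s[of xa xb] s[of za zb] assms le by simp
  next
    case 4
    then show ?thesis using s[of xa xb] assms le by simp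
  next
    case 5
    then show ?thesis using le by simp
  qed
qed

context extremal_csys
begin

lemma path_three: "5 \<le> card F \<Longrightarrow> 3 \<le> length P"
proof (rule ccontr)
  assume f: "5 \<le> card F" and n: "\<not> 3 \<le> length P"
  then have "card (F - set P) \<le> 2" using short_P_card by simp
  moreover have "card (set P) = length P" using P_pth by (simp add: pth_def distinct_card)
  moreover have "card (F - set P) = card F - card (set P)" using P_F by (intro card_Diff_subset) auto
  ultimately show False using f n by linarith
qed

lemma tri_edge:
  assumes "{a,b,c} \<in> \<C>" "a \<noteq> b" "b \<noteq> c" "a \<noteq> c"
  shows "E a b"
proof -
  have "dg {a,b,c} a = 2" using C_induced[OF assms(1)] by simp
  then show ?thesis using dg_tri[OF assms(2-4), of a] E_irrefl[of a] by (cases "E a b"; cases "E a c") simp_all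
qed

text \<open>A further edge to \<open>c\<close> closes a cycle through \<open>p1\<close> and
  \<open>c\<close>, using \<open>p0\<close>, or \<open>p2\<close>, or the path from
  \<open>p2\<close> to \<open>p4\<close>. A vertex off this cycle that sees both \<open>a\<close>
  and \<open>b\<close> then yields a second, disjoint cycle.\<close>

lemma five_path:
  assumes C: "C \<in> \<C>" "card C = 3" and c: "c \<in> C" "E p1 c"
    and p: "{p0,p1,p2,p3,p4} \<subseteq> F" "distinct [p0,p1,p2,p3,p4]" "E p0 p1" "E p1 p2" "E p2 p3" "E p3 p4"
  shows "dg C p0 + dg C p2 + dg C p4 \<le> 6"
proof -
  have "card (C - {c}) = 2" using C c C_fin by auto
  then obtain a b where ab: "C - {c} = {a,b}" "a \<noteq> b" by (auto simp: card_2_iff)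
  then have d: "a \<noteq> b" "b \<noteq> c" "a \<noteq> c" and Cabc: "C = {a,b,c}" using c by blast+
  have m: "{a,b,c} \<in> \<C>" using C Cabc by simp
  have eab: "E a b" using tri_edge[OF m d] .
  have nF: "a \<notin> F" "b \<notin> F" "c \<notin> F" using C_F[OF m] by blast+
  have two: "\<not> (hascyc S \<and> hascyc T)" if "S \<subseteq> insert a (insert b (insert c F))" "T \<subseteq> insert a (insert b (insert c F))" "S \<inter> T = {}" for S T
    using no_two_cycles[OF m, of S T] that by simp
  have tri: "hascyc {u,v,w}" if "E u v" "E v w" "E u w" for u v w
    using triangle_cycset[OF that] cycset_hascyc by blast
  have ab2: "hascyc {u,a,b}" if "E u a" "E u b" for u using tri[of u a b] that eab by blast
  show ?thesis unfolding Cabc dg_tri[OF d]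
  proof (rule bool_five)
    show "\<not> (E p0 c \<and> E p2 a \<and> E p2 b)"
      using two[of "{p0,p1,c}" "{p2,a,b}"] tri[of p0 p1 c] ab2[of p2] p c nF d by auto
    show "\<not> (E p0 c \<and> E p4 a \<and> E p4 b)"
      using two[of "{p0,p1,c}" "{p4,a,b}"] tri[of p0 p1 c] ab2[of p4] p c nF d by auto
    show "\<not> (E p2 c \<and> E p0 a \<and> E p0 b)"
      using two[of "{p1,p2,c}" "{p0,a,b}"] tri[of p1 p2 c] ab2[of p0] p c nF d by auto
    show "\<not> (E p2 c \<and> E p4 a \<and> E p4 b)"
      using two[of "{p1,p2,c}" "{p4,a,b}"] tri[of p1 p2 c] ab2[of p4] p c nF d by auto
    have "cycset (set [p1,p2,p3,p4,c])" if "E p4 c"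
      by (rule cycsetI) (use that p c nF E_sym in \<open>auto simp: pth_Cons\<close>)
    then show "\<not> (E p4 c \<and> E p0 a \<and> E p0 b)"
      using two[of "{p1,p2,p3,p4,c}" "{p0,a,b}"] cycset_hascyc[of "{p1,p2,p3,p4,c}"] ab2[of p0] p c nF d by auto
  qed
qed

lemma card_F_not_5: "card F \<noteq> 5"
proof
  assume f: "card F = 5"
  have FP: "F = set P" using F_eq_P path_three f by simp
  have r: "length P = 5" using length_P[OF FP] f by simp
  then obtain p0 p1 p2 p3 p4 where P: "P = [p0,p1,p2,p3,p4]" by (auto simp: length_Suc_conv numeral_eq_Suc)
  have inF: "{p0,p1,p2,p3,p4} \<subseteq> F" using P_F P by simp
  then have inF': "p0 \<in> F" "p1 \<in> F" "p2 \<in> F" "p3 \<in> F" "p4 \<in> F" by auto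
  have ds: "distinct [p0,p1,p2,p3,p4]" using P_pth P by (simp add: pth_def)
  have e: "E p0 p1" "E p1 p2" "E p2 p3" "E p3 p4" using P_pth P by (auto simp: pth_def)
  have n: "\<not> E p0 p2" "\<not> E p2 p4" "\<not> E p0 p4" "\<not> E p1 p3"
    using P_induced[of 0 2] P_induced[of 2 4] P_induced[of 0 4] P_induced[of 1 3] unfolding P by simp_all
  have dF: "dg F p0 \<le> 1" "dg F p4 \<le> 1" "dg F p2 \<le> 2" "dg F p1 \<le> 2" "dg F p3 \<le> 2"
    using hd_last(3,4) P_dg[OF _ FP, of 1] P_dg[OF _ FP, of 2] P_dg[OF _ FP, of 3] r unfolding P by simp_all
  note inV = inF'[THEN F_V]
  have t: "6 * k + 5 \<le> dg V p0 + dg V p2 + dg V p4"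
    by (rule sigma3[OF inV(1,3,5)]) (use n ds in simp_all)
  have "dg V p0 + 3 \<le> dg F p0 + k + 5" "dg V p2 + 3 \<le> dg F p2 + k + 5" "dg V p4 + 3 \<le> dg F p4 + k + 5"
    using dg_V_small[OF _ inF'(1)] dg_V_small[OF _ inF'(3)] dg_V_small[OF _ inF'(5)] f by simp_all
  \<comment> \<open>The three degrees sum to at most \<open>3 * k + 10\<close>, against the required
    \<open>6 * k + 5\<close>.\<close>
  then have k1: "k = 1" using t dF k_pos by linarith
  then have "card \<C> = 1" using sys unfolding csys_def by simp
  then obtain C where CC: "\<C> = {C}" by (rule card_1_singletonE)
  then have dV: "dg V v = dg F v + dg C v" for v using dg_V by simp
  have C: "C \<in> \<C>" using CC by simp
  have s7: "7 \<le> dg C p0 + dg C p2 + dg C p4" using t dF k1 unfolding dV by linarith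
  have c3: "card C = 3"
  proof (rule ccontr)
    assume "card C \<noteq> 3"
    then have "4 \<le> card C" using C_card[OF C] by simp
    then have "dg C p0 \<le> 2" "dg C p2 \<le> 2" "dg C p4 \<le> 2" using dg_le(2)[OF C] inF' by blast+
    then show False using s7 by linarith
  qed
  have "6 \<le> dg V p1 + dg V p3" using sigma2[OF inV(2,4) _ n(4)] ds k1 by simp
  then have "dg C p1 \<noteq> 0 \<or> dg C p3 \<noteq> 0" using dF unfolding dV by linarith
  then consider c where "c \<in> C" "E p1 c" | c where "c \<in> C" "E p3 c"
    unfolding dg_eq_0 by blast
  then show False
  proof cases
    case 1
    then show False using five_path[OF C c3 1 inF ds e] s7 by linarith
  next
    case 2
    have "{p4,p3,p2,p1,p0} \<subseteq> F" "distinct [p4,p3,p2,p1,p0]" using inF' ds by auto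
    from five_path[OF C c3 2 this E_sym[OF e(4)] E_sym[OF e(3)] E_sym[OF e(2)] E_sym[OF e(1)]]
    show False using s7 by linarith
  qed
qed

lemma no_common:
  assumes "C \<in> \<C>" "4 \<le> card C" "u \<in> F" "w \<in> F" "E u w" "v \<in> C"
  shows "\<not> (E u v \<and> E w v)"
proof
  assume "E u v \<and> E w v"
  then have "E v u" "E v w" using E_sym by blast+
  then show False using no_triangle[OF assms(1,2) _ _ assms(5), of v] assms(3,4,6) by simp
qed

text \<open>The cycles fall short of five vertices by at most one in total, and by exactly one
  because of the pair bound: a single 4-cycle \<open>Q\<close> among 5-cycles. The adjacencies
  between the forest and \<open>Q\<close> are then almost determined.\<close>

lemma card_F_not_4: "card F \<noteq> 4"
proof
  assume f: "card F = 4"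
  then have f10: "card F < 10" by simp
  obtain x y where xy: "x \<in> F" "y \<in> F" "x \<noteq> y" "\<not> E x y" "dg F x \<le> 1" "dg F y \<le> 1"
    using nonadj_pair[OF card_F_ge] by blast
  have finC: "finite \<C>" "card \<C> = k" using sys by (auto simp: csys_def)
  have def1: "(\<Sum>C\<in>\<C>. 5 - card C) \<le> 1" using deficit[OF f10] f by linarith
  have "\<exists>Q\<in>\<C>. card Q \<noteq> 5"
  proof (rule ccontr)
    assume n: "\<not> ?thesis"
    then have c5: "\<And>C. C \<in> \<C> \<Longrightarrow> card C = 5" by blast
    then have "(\<Sum>C\<in>\<C>. dg C x) \<le> k * 1" "(\<Sum>C\<in>\<C>. dg C y) \<le> k * 1"
      using dg_le(3) xy by (intro sum_C_le; simp)+
    then have "dg V x \<le> 1 + k" "dg V y \<le> 1 + k" using dg_V[of x] dg_V[of y] xy(5,6) by linarith+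
    then show False using sigma2[OF F_V[OF xy(1)] F_V[OF xy(2)] xy(3,4)] k_pos by simp
  qed
  then obtain Q where Q: "Q \<in> \<C>" "card Q \<noteq> 5" by blast
  have Qd: "5 - card Q \<ge> 1" using short_cycles[OF f10 Q(1)] Q(2) by simp
  have rem: "(\<Sum>C\<in>\<C>. 5 - card C) = (5 - card Q) + (\<Sum>C\<in>\<C> - {Q}. 5 - card C)"
    using finC Q by (simp add: sum.remove)
  then have "(\<Sum>C\<in>\<C> - {Q}. 5 - card C) = 0" using Qd def1 by linarith
  then have z: "\<And>D. D \<in> \<C> - {Q} \<Longrightarrow> 5 - card D = 0" using finC by simp
  have c5: "card D = 5" if "D \<in> \<C>" "D \<noteq> Q" for D
    using z[of D] that short_cycles[OF f10, of D] by simp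
  have Q4: "card Q = 4" using rem Qd def1 short_cycles[OF f10 Q(1)] by linarith
  then have Q4': "4 \<le> card Q" by simp
  have dV: "dg V v = dg F v + dg Q v + (\<Sum>C\<in>\<C> - {Q}. dg C v)" for v
    using dg_V[of v] finC Q by (simp add: sum.remove)
  have ck: "card (\<C> - {Q}) = k - 1" using finC Q by simp
  have dVle: "dg V v + 1 \<le> dg F v + dg Q v + k" if "v \<in> F" for v
  proof -
    have "(\<Sum>C\<in>\<C> - {Q}. dg C v) \<le> (\<Sum>C\<in>\<C> - {Q}. 1)"
      by (intro sum_mono) (use dg_le(3) c5 that in simp)
    then show ?thesis using dV[of v] ck k_pos by simp
  qed
  have s2: "2 * k + 4 \<le> dg V u + dg V w" if "u \<in> F" "w \<in> F" "u \<noteq> w" "\<not> E u w" for u w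
    using sigma2[OF F_V[OF that(1)] F_V[OF that(2)] that(3,4)] k_pos by simp
  have Qle: "dg Q v \<le> 2" if "v \<in> F" for v using dg_le(2)[OF Q(1) that Q4'] .
  \<comment> \<open>Each of the other \<open>k - 1\<close> cycles has at most one neighbour of a
    forest vertex, so \<open>2 * k + 4\<close> is reached only with two neighbours on
    \<open>Q\<close> each.\<close>
  have both2: "dg Q u = 2 \<and> dg Q w = 2" if "u \<in> F" "w \<in> F" "u \<noteq> w" "\<not> E u w" "dg F u \<le> 1" "dg F w \<le> 1" for u w
    using s2[OF that(1-4)] dVle[OF that(1)] dVle[OF that(2)] Qle[OF that(1)] Qle[OF that(2)] that(5,6) by linarith
  show False
  proof (cases "3 \<le> length P")
    case False
    then have r2: "length P \<le> 2" by simp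
    have "card (F - set P) \<le> 2" using short_P_card[OF r2] .
    moreover have "card (set P) = length P" using P_pth by (simp add: pth_def distinct_card)
    moreover have "card (F - set P) = card F - card (set P)" using P_F by (intro card_Diff_subset) auto
    ultimately have "length P = 2" "card (F - set P) = 2" using f r2 by linarith+
    then obtain p0 p1 where P: "P = [p0,p1]" by (auto simp: length_Suc_conv numeral_eq_Suc)
    obtain u w where uw: "F - set P = {u,w}" "u \<noteq> w" using \<open>card (F - set P) = 2\<close> card_2_iff by metis
    have inF: "p0 \<in> F" "p1 \<in> F" "u \<in> F" "w \<in> F" using uw P P_F by auto
    have out: "u \<notin> set P" "w \<notin> set P" using uw by blast+
    have d: "dg F v \<le> 1" if "v \<in> F" for v using short_P_dg[OF r2 that] .
    have e: "E p0 p1" using P_pth P by (simp add: pth_def)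
    have e2: "E u w" using outside_adj[OF inF(3) out(1) d inF(4) out(2) d uw(2)] inF by blast
    have "\<not> E p0 u" "\<not> E p1 w" using hd_last(5)[OF inF(3)] hd_last(6)[OF inF(4)] out P by auto
    moreover have "p0 \<noteq> u" "p1 \<noteq> w" "p0 \<noteq> w" "p1 \<noteq> u" using out P by auto
    ultimately have "dg Q p0 = 2" "dg Q u = 2" "dg Q p1 = 2" "dg Q w = 2"
      using both2[of p0 u] both2[of p1 w] inF d by blast+
    then show False using quad_edges[OF Q(1) Q4 inF(1,2) e inF(3,4) e2]
      \<open>p0 \<noteq> u\<close> \<open>p1 \<noteq> w\<close> \<open>p0 \<noteq> w\<close> \<open>p1 \<noteq> u\<close> by simp
  next
    case True
    have FP: "F = set P" using F_eq_P[OF True] .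
    have r: "length P = 4" using length_P[OF FP] f by simp
    then obtain p0 p1 p2 p3 where P: "P = [p0,p1,p2,p3]" by (auto simp: length_Suc_conv numeral_eq_Suc)
    have inF: "p0 \<in> F" "p1 \<in> F" "p2 \<in> F" "p3 \<in> F" using P_F P by auto
    have ds: "distinct [p0,p1,p2,p3]" using P_pth P by (simp add: pth_def)
    have e: "E p0 p1" "E p1 p2" "E p2 p3" using P_pth P by (auto simp: pth_def)
    have n: "\<not> E p0 p2" "\<not> E p1 p3" "\<not> E p0 p3"
      using P_induced[of 0 2] P_induced[of 1 3] P_induced[of 0 3] unfolding P by simp_all
    have dF: "dg F p0 \<le> 1" "dg F p3 \<le> 1" "dg F p1 \<le> 2" "dg F p2 \<le> 2"
      using hd_last(3,4) P_dg[OF _ FP, of 1] P_dg[OF _ FP, of 2] r unfolding P by simp_all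
    have q2: "dg Q p0 = 2" "dg Q p3 = 2" using both2[OF inF(1,4) _ n(3) dF(1,2)] ds by auto
    have "2 * k + 4 \<le> dg V p0 + dg V p2" "2 * k + 4 \<le> dg V p1 + dg V p3"
      using s2[OF inF(1,3) _ n(1)] s2[OF inF(2,4) _ n(2)] ds by auto
    then have "dg Q p2 \<noteq> 0" "dg Q p1 \<noteq> 0"
      using dVle[OF inF(1)] dVle[OF inF(2)] dVle[OF inF(3)] dVle[OF inF(4)] q2 dF by linarith+
    then obtain v1 v2 where v1: "v1 \<in> Q" "E p1 v1" and v2: "v2 \<in> Q" "E p2 v2" unfolding dg_eq_0 by blast
    obtain a b c d where q: "Q = {a,b,c,d}" "distinct [a,b,c,d]" "E a b" "E b c" "E c d" "E d a"
      and p0: "E p0 a" "E p0 c" "\<not> E p0 b" "\<not> E p0 d" using quad_labels[OF Q(1) Q4 inF(1) q2(1)] by blast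
    have nc01: "\<not> (E p0 v \<and> E p1 v)" and nc12: "\<not> (E p1 v \<and> E p2 v)" and nc23: "\<not> (E p2 v \<and> E p3 v)" if "v \<in> Q" for v
      using no_common[OF Q(1) Q4' _ _ _ that] inF e by blast+
    have "v1 = b \<or> v1 = d" using v1 nc01[OF v1(1)] p0 q(1) by blast
    then obtain \<beta> \<beta>' where B: "{\<beta>,\<beta>'} = {b,d}" "\<beta> \<noteq> \<beta>'" "E p1 \<beta>" using v1 q(2) by auto
    have EB: "E a \<beta>" "E \<beta> c" "E c \<beta>'" "E \<beta>' a" and QB: "\<beta> \<in> Q" "\<beta>' \<in> Q" "\<beta> \<noteq> a" "\<beta> \<noteq> c" "\<beta>' \<noteq> a" "\<beta>' \<noteq> c"
      using B q E_sym by (auto simp: doubleton_eq_iff)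
    have QF: "v \<notin> F" if "v \<in> Q" for v using C_F[OF Q(1)] that by blast
    have neq: "v \<noteq> u" if "v \<in> Q" "u \<in> F" for v u using QF that by blast
    have aQ: "a \<in> Q" "c \<in> Q" using q(1) by auto
    consider (bd) "E p3 b" "E p3 d" "\<not> E p3 a" "\<not> E p3 c" | (ac) "E p3 a" "E p3 c" "\<not> E p3 b" "\<not> E p3 d"
      using quad_two_cases[OF _ _ q(3-6) inF(4)] Q(1) Q4 q(1) q2(2) by blast
    then show False
    proof cases
      case bd
      \<comment> \<open>The first and the last edge of the path each close a 4-cycle with a side of
        \<open>Q\<close>, and the two sides can be chosen opposite.\<close>
      have "v2 = a \<or> v2 = c" using v2 nc23[OF v2(1)] bd q(1) by blast
      then obtain \<alpha> \<alpha>' where A: "{\<alpha>,\<alpha>'} = {a,c}" "\<alpha> \<noteq> \<alpha>'" "E p2 \<alpha>" using v2 q(2) by auto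
      have EA: "E \<beta> \<alpha>'" "E \<alpha>' p0" "E \<alpha> \<beta>'" "E \<beta>' p3" and QA: "\<alpha> \<in> Q" "\<alpha>' \<in> Q" "\<alpha> \<noteq> \<beta>" "\<alpha> \<noteq> \<beta>'" "\<alpha>' \<noteq> \<beta>" "\<alpha>' \<noteq> \<beta>'"
        using A B(1) EB QB p0 bd aQ E_sym by (auto simp: doubleton_eq_iff)
      have "cycset {p0,p1,\<beta>,\<alpha>'}"
        by (rule quad_cycset[OF e(1) B(3) EA(1,2)]) (use neq QB QA inF in metis)+
      moreover have "cycset {p3,p2,\<alpha>,\<beta>'}"
        by (rule quad_cycset[OF E_sym[OF e(3)] A(3) EA(3,4)]) (use neq QB QA inF in metis)+
      moreover have "{p0,p1,\<beta>,\<alpha>'} \<subseteq> Q \<union> F" "{p3,p2,\<alpha>,\<beta>'} \<subseteq> Q \<union> F" using QA QB inF by blast+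
      moreover have "{p0,p1,\<beta>,\<alpha>'} \<inter> {p3,p2,\<alpha>,\<beta>'} = {}"
      proof -
        have "{p0,p1} \<inter> {\<alpha>,\<beta>'} = {}" "{p3,p2} \<inter> {\<beta>,\<alpha>'} = {}" using neq QA QB inF by blast+
        moreover have "{p0,p1} \<inter> {p3,p2} = {}" using ds by auto
        moreover have "{\<beta>,\<alpha>'} \<inter> {\<alpha>,\<beta>'} = {}" using A(2) B(2) QA by auto
        ultimately show ?thesis by blast
      qed
      ultimately show False using no_two_cycles[OF Q(1)] cycset_hascyc by metis
    next
      case ac
      have "v2 \<noteq> a" "v2 \<noteq> c" "v2 \<noteq> \<beta>" using v2 nc23[OF v2(1)] nc12[OF v2(1)] ac B(3) by blast+
      then have "v2 = \<beta>'" using v2(1) q(1) B(1) by blast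
      then have p2: "\<not> E p2 \<beta>" using nc12[OF QB(1)] B(3) by blast
      have "\<beta> = b \<or> \<beta> = d" using B(1) by (auto simp: doubleton_eq_iff)
      then have p03: "\<not> E p0 \<beta>" "\<not> E p3 \<beta>" using p0 ac by auto
      \<comment> \<open>The ends have degree at most \<open>k + 2\<close>, which forces degree at
        least \<open>4 * k + 1\<close> on \<open>\<beta>\<close>. At most three of its neighbours
        lie in \<open>Q\<close> and the forest, so it sees more than four vertices of some other
        cycle, that is, a whole 5-cycle.\<close>
      have "6 * k + 5 \<le> dg V p0 + dg V p3 + dg V \<beta>"
      proof (rule sigma3)
        show "p0 \<in> V" "p3 \<in> V" using inF F_V by blast+
        show "\<beta> \<in> V" using C_sub[OF Q(1)] QB(1) by blast
        show "p0 \<noteq> p3" using ds by simp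
        show "p3 \<noteq> \<beta>" "p0 \<noteq> \<beta>" using neq QB(1) inF by blast+
      qed (use n p03 in blast)+
      then have big: "4 * k + 1 \<le> dg V \<beta>" using dVle[OF inF(1)] dVle[OF inF(4)] dF q2 by linarith
      have "{w\<in>F. E \<beta> w} \<subseteq> {p1}" using FP P p2 p03 E_sym by auto
      then have "dg F \<beta> \<le> card {p1}" unfolding dg_def by (intro card_mono) auto
      then have "4 * k \<le> 2 + (\<Sum>C\<in>\<C> - {Q}. dg C \<beta>)" using big dV[of \<beta>] C_induced[OF Q(1) QB(1)] by simp
      moreover have "(\<Sum>C\<in>\<C> - {Q}. dg C \<beta>) \<le> (k - 1) * 4" if "\<And>D. D \<in> \<C> - {Q} \<Longrightarrow> dg D \<beta> \<le> 4"
        using sum_bounded_above[of "\<C> - {Q}" "\<lambda>D. dg D \<beta>" 4] that ck by simp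
      ultimately obtain D where D: "D \<in> \<C>" "D \<noteq> Q" "\<not> dg D \<beta> \<le> 4" using k_pos by fastforce
      have cD: "card D = 5" using c5 D by blast
      then have "dg D \<beta> = card D" using dg_le_card[OF C_fin[OF D(1)], of \<beta>] D(3) by linarith
      then have full: "\<And>w. w \<in> D \<Longrightarrow> E \<beta> w" using dg_full C_fin[OF D(1)] by blast
      obtain u1 where u1: "u1 \<in> D" using cD by fastforce
      have "dg D u1 \<noteq> 0" using C_induced[OF D(1) u1] by simp
      then obtain u2 where u2: "u2 \<in> D" "E u1 u2" unfolding dg_eq_0 by blast
      have h1: "hascyc {\<beta>,u1,u2}" using triangle_cycset[of \<beta> u1 u2] full u1 u2 cycset_hascyc by blast
      have "cycset {p0,a,\<beta>',c}"
        by (rule quad_cycset) (use p0 EB E_sym neq QB inF q(2) in auto)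
      then have h2: "hascyc {p0,a,\<beta>',c}" by (rule cycset_hascyc)
      have QD: "Q \<inter> D = {}" using C_disj[OF Q(1) D(1)] D(2) by blast
      have DF: "p0 \<notin> D" using C_F[OF D(1)] inF by blast
      \<comment> \<open>A triangle and a 4-cycle, seven vertices, would replace the nine of
        \<open>Q\<close> and \<open>D\<close>.\<close>
      have "card Q + card D \<le> card {\<beta>,u1,u2} + card {p0,a,\<beta>',c}"
      proof (rule two_cycles[OF Q(1) D(1) D(2)[symmetric] _ _ _ h1 h2])
        show "{\<beta>,u1,u2} \<subseteq> Q \<union> D \<union> F" using QB(1) u1 u2(1) by blast
        show "{p0,a,\<beta>',c} \<subseteq> Q \<union> D \<union> F" using QB(2) aQ inF(1) by blast
        have "u1 \<notin> {p0,a,\<beta>',c}" "u2 \<notin> {p0,a,\<beta>',c}" using QD DF u1 u2(1) aQ QB(2) by blast+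
        moreover have "\<beta> \<notin> {p0,a,\<beta>',c}" using neq[OF QB(1) inF(1)] QB(3,4) B(2) by blast
        ultimately show "{\<beta>,u1,u2} \<inter> {p0,a,\<beta>',c} = {}" by blast
      qed
      moreover have "card {\<beta>,u1,u2} \<le> 3" "card {p0,a,\<beta>',c} \<le> 4" by (auto simp: card_insert_if)
      ultimately show False using Q4 cD by linarith
    qed
  qed
qed

lemma extremal_csys_False: False
  using card_F_4 card_F_not_4 card_F_not_5 not_long_path by linarith

end

section \<open>Existence of disjoint cycles\<close>

context fin_sgraph
begin

lemma next_cycle:
  assumes ex: "csys k \<C>0"
    and order: "5 * k + 3 \<le> card V"
    and sigma2: "\<And>a b. a \<in> V \<Longrightarrow> b \<in> V \<Longrightarrow> a \<noteq> b \<Longrightarrow> \<not> E a b \<Longrightarrow>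
      2 * k + 3 \<le> dg V a + dg V b \<and> (0 < k \<longrightarrow> 2 * k + 4 \<le> dg V a + dg V b)"
    and sigma3: "\<And>a b c. a \<in> V \<Longrightarrow> b \<in> V \<Longrightarrow> c \<in> V \<Longrightarrow> a \<noteq> b \<Longrightarrow> b \<noteq> c \<Longrightarrow> a \<noteq> c \<Longrightarrow>
      \<not> E a b \<Longrightarrow> \<not> E b c \<Longrightarrow> \<not> E a c \<Longrightarrow> 6 * k + 5 \<le> dg V a + dg V b + dg V c"
  shows "\<exists>\<D>. csys (Suc k) \<D>"
proof (rule ccontr)
  assume no: "\<not> ?thesis"
  obtain \<C>1 where C1: "csys k \<C>1" "\<And>\<D>. csys k \<D> \<Longrightarrow> card (\<Union>\<C>1) \<le> card (\<Union>\<D>)"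
    using ex_has_least_nat[of "csys k" \<C>0 "\<lambda>\<C>. card (\<Union>\<C>)"] ex by blast
  have mn: "min_csys V E k \<D>" if "csys k \<D>" "card (\<Union>\<D>) = card (\<Union>\<C>1)" for \<D>
    by unfold_locales (use that C1 no in auto)
  \<comment> \<open>A nonempty path outside is available: if the cycles covered everything,
    \<open>long_cycle\<close> would bound each of them by five vertices, and \<open>5 * k\<close>
    vertices are too few.\<close>
  have ne: "V - \<Union>\<D> \<noteq> {}" if D: "csys k \<D>" "card (\<Union>\<D>) = card (\<Union>\<C>1)" for \<D>
  proof
    assume e: "V - \<Union>\<D> = {}"
    interpret m: min_csys V E k \<D> using mn D by blast
    have F0: "card m.F = 0" unfolding m.F_def e by simp
    have "card C \<le> 5" if "C \<in> \<D>" for C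
      using m.long_cycle[OF sigma3 that] F0 by force
    then have "(\<Sum>C\<in>\<D>. card C) \<le> 5 * k" using sum_bounded_above[of \<D> card 5] D(1) by (simp add: csys_def)
    then show False using m.card_V order F0 by linarith
  qed
  let ?R = "\<lambda>(\<D>, ys). csys k \<D> \<and> card (\<Union>\<D>) = card (\<Union>\<C>1) \<and> pth ys \<and> set ys \<subseteq> V - \<Union>\<D>"
  have bnd: "\<forall>z. ?R z \<longrightarrow> length (snd z) < card V + 1"
  proof (clarsimp simp: pth_def)
    fix \<D> and ys :: "'a list" assume "distinct ys" "set ys \<subseteq> V - \<Union>\<D>"
    then have "length ys = card (set ys)" "set ys \<subseteq> V" using distinct_card by force+
    then show "length ys < Suc (card V)" using card_mono[OF finV] by (simp add: le_imp_less_Suc)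
  qed
  obtain v where v: "v \<in> V - \<Union>\<C>1" using ne[OF C1(1) refl] by blast
  have "?R (\<C>1, [v])" using v C1 by simp
  then obtain z where z: "?R z" "\<forall>y. ?R y \<longrightarrow> length (snd y) \<le> length (snd z)"
    using ex_has_greatest_nat[of ?R "(\<C>1, [v])" "\<lambda>z. length (snd z)" "card V + 1"] bnd by blast
  obtain \<D> P where DP: "z = (\<D>, P)" by (cases z)
  have D: "csys k \<D>" "card (\<Union>\<D>) = card (\<Union>\<C>1)" "pth P" "set P \<subseteq> V - \<Union>\<D>" using z(1) DP by auto
  have lng: "length ys \<le> length P" if "csys k \<D>'" "card (\<Union>\<D>') = card (\<Union>\<D>)" "pth ys" "set ys \<subseteq> V - \<Union>\<D>'" for \<D>' ys
    using z(2)[rule_format, of "(\<D>', ys)"] that D(2) DP by simp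
  obtain w where w: "w \<in> V - \<Union>\<D>" using ne[OF D(1,2)] by blast
  have "P \<noteq> []" using lng[OF D(1) refl, of "[w]"] w by auto
  interpret m: min_csys V E k \<D> using mn D by blast
  interpret extremal_csys V E k \<D> P
    by unfold_locales (use D lng \<open>P \<noteq> []\<close> order sigma2 sigma3 in \<open>auto simp: m.F_def\<close>)
  show False by (rule extremal_csys_False)
qed

text \<open>For \<open>K = 1\<close> Ore's condition on three vertices gives degree sum three only,
  hence the weaker pair bound there. The bounds for \<open>K\<close> imply those for every smaller
  number of cycles, so the induction runs inside one graph.\<close>

theorem disjoint_cycles:
  assumes order: "5 * K \<le> card V + 2"
    and sigma2: "\<And>a b. a \<in> V \<Longrightarrow> b \<in> V \<Longrightarrow> a \<noteq> b \<Longrightarrow> \<not> E a b \<Longrightarrow>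
      2 * K + 1 \<le> dg V a + dg V b \<and> (1 < K \<longrightarrow> 2 * K + 2 \<le> dg V a + dg V b)"
    and sigma3: "\<And>a b c. a \<in> V \<Longrightarrow> b \<in> V \<Longrightarrow> c \<in> V \<Longrightarrow> a \<noteq> b \<Longrightarrow> b \<noteq> c \<Longrightarrow> a \<noteq> c \<Longrightarrow>
      \<not> E a b \<Longrightarrow> \<not> E b c \<Longrightarrow> \<not> E a c \<Longrightarrow> 6 * K \<le> dg V a + dg V b + dg V c + 1"
  shows "\<exists>\<C>. csys K \<C>"
proof -
  have "\<exists>\<C>. csys k \<C>" if "k \<le> K" for k
    using that
  proof (induction k)
    case 0
    have "csys 0 {}" by (simp add: csys_def)
    then show ?case by blast
  next
    case (Suc k)
    then obtain \<C> where C: "csys k \<C>" by auto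
    show ?case
    proof (rule next_cycle[OF C])
      show "5 * k + 3 \<le> card V" using order Suc by linarith
      show "2 * k + 3 \<le> dg V a + dg V b \<and> (0 < k \<longrightarrow> 2 * k + 4 \<le> dg V a + dg V b)"
        if "a \<in> V" "b \<in> V" "a \<noteq> b" "\<not> E a b" for a b
        using sigma2[OF that] Suc by auto
      show "6 * k + 5 \<le> dg V a + dg V b + dg V c"
        if "a \<in> V" "b \<in> V" "c \<in> V" "a \<noteq> b" "b \<noteq> c" "a \<noteq> c" "\<not> E a b" "\<not> E b c" "\<not> E a c" for a b c
        using sigma3[OF that] Suc by linarith
    qed
  qed
  then show ?thesis by blast
qed

end

section \<open>Disjoint cycles with a maximum number of vertices\<close>

text \<open>The positions of \<open>P\<close>, the successors of the positions of \<open>Q\<close>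
  and the set \<open>T\<close> are disjoint parts of \<open>{s<..e}\<close>. Only a \<open>Q\<close>
  at \<open>e\<close> has its successor outside, which accounts for the extra one.\<close>

lemma shifted_count:
  fixes s e :: nat
  assumes "s \<le> e" "\<not> P s" "\<And>i. s \<le> i \<Longrightarrow> i < e \<Longrightarrow> \<not> (Q i \<and> P (Suc i))"
    and "T \<subseteq> {s<..e}" "\<And>i. i \<in> T \<Longrightarrow> \<not> P i \<and> \<not> Q (i - 1)"
  shows "card {i\<in>{s..e}. P i} + card {i\<in>{s..e}. Q i} + card T \<le> Suc e - s"
proof -
  let ?P = "{i\<in>{s..e}. P i}" and ?Q = "{i\<in>{s..<e}. Q i}"
  have f: "finite T" using assms(4) finite_subset by blast
  have "?P \<union> Suc ` ?Q \<union> T \<subseteq> {s<..e}"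
  proof -
    have "?P \<subseteq> {s<..e}"
    proof
      fix i assume "i \<in> ?P"
      then have "i \<noteq> s" "s \<le> i" "i \<le> e" using assms(2) by auto
      then show "i \<in> {s<..e}" by simp
    qed
    then show ?thesis using assms(4) by auto
  qed
  then have "card (?P \<union> Suc ` ?Q \<union> T) \<le> e - s" using card_mono[of "{s<..e}"] by fastforce
  moreover have "(?P \<union> Suc ` ?Q) \<inter> T = {}" using assms(5) by force
  then have "card (?P \<union> Suc ` ?Q \<union> T) = card (?P \<union> Suc ` ?Q) + card T"
    using f by (intro card_Un_disjoint) auto
  moreover have "?P \<inter> Suc ` ?Q = {}" using assms(3) by fastforce
  then have "card (?P \<union> Suc ` ?Q) = card ?P + card ?Q"
    by (subst card_Un_disjoint) (auto simp: card_image)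
  moreover have "{i\<in>{s..e}. Q i} \<subseteq> insert e ?Q" by auto
  then have "card {i\<in>{s..e}. Q i} \<le> card (insert e ?Q)" by (intro card_mono) auto
  then have "card {i\<in>{s..e}. Q i} \<le> Suc (card ?Q)" by (simp add: card_insert_if split: if_splits)
  ultimately show ?thesis using assms(1) by linarith
qed

text \<open>\<open>H\<close> is a component of the graph left over by a system with the most
  vertices: any two of its vertices are joined by a path inside, and no edge leads to the other
  leftover vertices.\<close>

locale max_csys = fin_sgraph V E for V :: "'a set" and E +
  fixes k :: nat and \<C> :: "'a set set" and H :: "'a set"
  assumes sys: "csys k \<C>"
    and max_total: "csys k \<D> \<Longrightarrow> card (\<Union>\<D>) \<le> card (\<Union>\<C>)"
    and H_sub: "H \<subseteq> V - \<Union>\<C>" and H_ne: "H \<noteq> {}"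
    and H_conn: "a \<in> H \<Longrightarrow> b \<in> H \<Longrightarrow> \<exists>h. pth h \<and> h \<noteq> [] \<and> set h \<subseteq> H \<and> hd h = a \<and> last h = b"
    and H_closed: "a \<in> H \<Longrightarrow> w \<in> V - \<Union>\<C> - H \<Longrightarrow> \<not> E a w"
begin

definition L :: "'a set" where "L = V - \<Union>\<C>"

definition NH :: "'a set" where "NH = {v\<in>\<Union>\<C>. \<exists>a\<in>H. E v a}"

lemma finL: "finite L" "finite H"
  using finV finite_subset[OF H_sub] by (auto simp: L_def)

lemma H_L: "H \<subseteq> L" using H_sub by (simp add: L_def)

lemma C_cyc: "C \<in> \<C> \<Longrightarrow> cycset C" using sys by (simp add: csys_def)

lemma C_fin: "C \<in> \<C> \<Longrightarrow> finite C" using C_cyc cycset_fin by blast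

lemma k_pos: "C \<in> \<C> \<Longrightarrow> 0 < k" using sys unfolding csys_def by (metis card_gt_0_iff empty_iff)

lemma no_larger: "csys k \<D> \<Longrightarrow> \<not> \<Union>\<C> \<subset> \<Union>\<D>"
  using max_total csys_fin psubset_card_mono by (metis not_le)

lemma H_path:
  assumes "a \<in> H" "E u a" "b \<in> H" "E b w"
  obtains h where "pth h" "h \<noteq> []" "set h \<subseteq> H" "E u (hd h)" "E (last h) w"
  using H_conn[OF assms(1,3)] assms(2,4) by metis

text \<open>The contradictions share one shape: \<open>k - 1\<close> cycles cover exactly
  \<open>W\<close>, and one more cycle covers the rest of the system together with a vertex outside
  it.\<close>

definition cov :: "'a set \<Rightarrow> bool" where
  "cov W \<longleftrightarrow> (\<exists>\<D>. csys (k - 1) \<D> \<and> \<Union>\<D> = W)"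

lemma cov_fin: "cov W \<Longrightarrow> finite W"
  unfolding cov_def using csys_fin by blast

lemma cov_rest: "C \<in> \<C> \<Longrightarrow> cov (\<Union>\<C> - C)"
  unfolding cov_def using csys_remove[of "k - 1" \<C> C] csys_Diff[OF sys, of C] sys k_pos[of C] by (metis Suc_pred')

lemma cov_cyc:
  assumes "cov W" "0 < k" "cycset X" "X \<inter> W = {}" "\<Union>\<C> \<subseteq> W \<union> X" "x \<in> X" "x \<notin> \<Union>\<C>"
  shows False
proof -
  obtain \<D> where D: "csys (k - 1) \<D>" "\<Union>\<D> = W" using assms(1) cov_def by blast
  have "csys k (insert X \<D>)" using csys_add[OF D(1) assms(3)] assms(2,4) D(2) by simp
  moreover have "\<Union>\<C> \<subset> \<Union>(insert X \<D>)" using D(2) assms(5-7) by auto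
  ultimately show False using no_larger by blast
qed

text \<open>A vertex adjacent to more than half of all vertices of the system is adjacent to more
  than half of some cycle, where it can be inserted.\<close>

lemma csys_insert_vertex:
  assumes "csys j \<D>" "y \<notin> \<Union>\<D>" "card (\<Union>\<D>) < 2 * dg (\<Union>\<D>) y"
  shows "\<exists>\<D>'. csys j \<D>' \<and> \<Union>\<D>' = insert y (\<Union>\<D>)"
proof -
  have "\<exists>D\<in>\<D>. card D < 2 * dg D y"
  proof (rule ccontr)
    assume "\<not> ?thesis"
    then have "(\<Sum>D\<in>\<D>. 2 * dg D y) \<le> (\<Sum>D\<in>\<D>. card D)" by (intro sum_mono) force
    then have "2 * (\<Sum>D\<in>\<D>. dg D y) \<le> (\<Sum>D\<in>\<D>. card D)" by (simp add: sum_distrib_left)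
    then show False using assms(3) csys_cards[OF assms(1)] dg_csys[OF assms(1)] by simp
  qed
  then obtain D where D: "D \<in> \<D>" "card D < 2 * dg D y" by blast
  have c: "cycset (insert y D)"
    using cycset_insert[of D y] D assms(1,2) by (auto simp: csys_def)
  have i: "insert y D \<inter> (\<Union>\<D> - D) = {}" using assms(2) by blast
  show ?thesis using csys_replace(1,2)[OF assms(1) D(1) c i] D(1) by blast
qed

lemma cov_insert:
  assumes "cov W" "y \<notin> W" "\<not> cov (insert y W)"
  shows "2 * dg W y \<le> card W"
  using csys_insert_vertex assms unfolding cov_def by (metis not_le)

end

section \<open>A cycle with two neighbours of the component\<close>

locale max_cycle = max_csys V E k \<C> H for V :: "'a set" and E k \<C> H +
  fixes C :: "'a set" and xs :: "'a list"
  assumes C_in: "C \<in> \<C>" and xs_cyc: "cyc xs" and xs_C: "set xs = C"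
    and two_nbs: "2 \<le> card (C \<inter> NH)"
begin

definition N :: nat where "N = length xs"
text \<open>All natural numbers serve as positions, so that an arc running past the end of
  \<open>xs\<close> is still an interval of indices.\<close>

definition c :: "nat \<Rightarrow> 'a" where "c i = xs ! (i mod N)"
definition U :: "'a set" where "U = \<Union>\<C> - C"
definition up :: "nat \<Rightarrow> bool" where "up i \<longleftrightarrow> c i \<in> NH"
text \<open>The distance to the next neighbour of \<open>H\<close>, less than \<open>N\<close>
  because there are at least two of them.\<close>

definition gap :: "nat \<Rightarrow> nat" where "gap i = (LEAST j. 0 < j \<and> up (i + j))"
definition I :: "nat \<Rightarrow> nat \<Rightarrow> 'a set" where "I i a = c ` {i<..i + a}"
definition seg :: "nat \<Rightarrow> nat \<Rightarrow> 'a list" where "seg a b = map c [a..<b]"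

lemma N3: "3 \<le> N" "0 < N" using xs_cyc by (auto simp: N_def cyc_def)

lemma xs_dist: "distinct xs" using xs_cyc by (simp add: cyc_def)

lemma c_eq: "c i = c j \<longleftrightarrow> i mod N = j mod N"
  unfolding c_def using xs_dist N3 by (simp add: N_def nth_eq_iff_index_eq)

lemma c_per[simp]: "c (i + N) = c i" by (simp add: c_def)

lemma c_shift: "c (i + m) = c (j + m) \<longleftrightarrow> c i = c j"
proof
  assume "c (i + m) = c (j + m)"
  then have "(i + m + (N * m - m)) mod N = (j + m + (N * m - m)) mod N"
    unfolding c_eq by (rule mod_add_cong) simp
  moreover have "m \<le> N * m" using N3 by simp
  ultimately have "(i + N * m) mod N = (j + N * m) mod N" by simp
  then show "c i = c j" unfolding c_eq by simp
next
  assume "c i = c j"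
  then show "c (i + m) = c (j + m)" unfolding c_eq by (rule mod_add_cong) simp
qed

lemma c_neq: "i < j \<Longrightarrow> j < i + N \<Longrightarrow> c i \<noteq> c j"
  unfolding c_eq by (rule mod_neq)

lemma c_E: "E (c i) (c (Suc i))"
proof -
  let ?j = "i mod N"
  have j: "?j < N" using N3 by simp
  have s: "c (Suc i) = xs ! (Suc ?j mod N)" by (simp add: c_def mod_Suc_eq)
  show ?thesis
  proof (cases "Suc ?j < N")
    case True
    then have "E (xs ! ?j) (xs ! Suc ?j)" using xs_cyc by (simp add: cyc_def N_def successively_conv_nth)
    then show ?thesis using s True by (simp add: c_def)
  next
    case False
    then have "?j = N - 1" "Suc ?j = N" using j by auto
    moreover have "xs \<noteq> []" using N3 by (auto simp: N_def)
    ultimately show ?thesis using xs_cyc s by (simp add: c_def cyc_def hd_conv_nth last_conv_nth N_def)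
  qed
qed

lemma c_C: "c i \<in> C"
proof -
  have "i mod N < length xs" using N3 by (simp add: N_def)
  then show ?thesis using xs_C nth_mem unfolding c_def by blast
qed

lemma c_inj: "b \<le> a + N \<Longrightarrow> inj_on c {a..<b}"
proof (rule inj_onI)
  fix i j assume b: "b \<le> a + N" and "i \<in> {a..<b}" "j \<in> {a..<b}" and e: "c i = c j"
  then have "a \<le> i" "i < a + N" "a \<le> j" "j < a + N" by auto
  then show "i = j" using c_neq[of i j] c_neq[of j i] e by fastforce
qed

lemma card_C: "card C = N" using xs_C xs_dist distinct_card N_def by metis

lemma c_full: "c ` {a..<a + N} = C"
proof -
  have "card (c ` {a..<a + N}) = N" using card_image[OF c_inj[of "a + N" a]] by simp
  moreover have "c ` {a..<a + N} \<subseteq> C" using c_C by blast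
  ultimately show ?thesis using card_subset_eq[OF C_fin[OF C_in]] card_C by simp
qed

lemma seg_simps: "set (seg a b) = c ` {a..<b}" "length (seg a b) = b - a"
  "a < b \<Longrightarrow> seg a b \<noteq> []" "a < b \<Longrightarrow> hd (seg a b) = c a" "a < b \<Longrightarrow> last (seg a b) = c (b - 1)"
  by (auto simp: seg_def hd_map last_map)

lemma seg_append: "a \<le> b \<Longrightarrow> b \<le> d \<Longrightarrow> seg a d = seg a b @ seg b d"
  using upt_add_eq_append[of a b "d - b"] by (simp add: seg_def flip: map_append)

lemma seg_pth: "b \<le> a + N \<Longrightarrow> pth (seg a b)"
proof -
  assume b: "b \<le> a + N"
  have "distinct (seg a b)" using c_inj[OF b] by (simp add: seg_def distinct_map)
  moreover have "successively E (seg a b)"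
    by (auto simp: seg_def successively_conv_nth c_E)
  ultimately show ?thesis by (simp add: pth_def)
qed

lemma C_V: "C \<subseteq> \<Union>\<C>" using C_in by blast

lemma C_H: "C \<inter> H = {}" "U \<inter> H = {}" "U \<inter> C = {}" using C_in H_sub unfolding U_def by blast+

lemma I_C: "I i a \<subseteq> C" using c_C by (auto simp: I_def)

lemma I_fin: "finite (I i a)" by (simp add: I_def)

lemma I_cong: "c i = c j \<Longrightarrow> I i a = I j a"
proof -
  have *: "I i a \<subseteq> I j a" if "c i = c j" for i j
  proof
    fix v assume "v \<in> I i a"
    then obtain m where m: "i < m" "m \<le> i + a" "v = c m" by (auto simp: I_def)
    have "c (i + (m - i)) = c (j + (m - i))" using c_shift[of i "m - i" j] that by blast
    then have "v = c (j + (m - i))" using m by simp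
    moreover have "j + (m - i) \<in> {j<..j + a}" using m by auto
    ultimately show "v \<in> I j a" unfolding I_def by blast
  qed
  assume "c i = c j"
  then show ?thesis using *[of i j] *[of j i] by (intro equalityI) simp_all
qed

lemma up_cong: "c i = c j \<Longrightarrow> up (i + m) = up (j + m)"
  using c_shift[of i m j] by (simp add: up_def)

lemma gap_cong: "c i = c j \<Longrightarrow> gap i = gap j"
  unfolding gap_def using up_cong[of i j] by simp

lemma up_next:
  assumes "up i"
  shows "0 < gap i" "up (i + gap i)" "gap i < N" "0 < j \<Longrightarrow> j < gap i \<Longrightarrow> \<not> up (i + j)" "0 < j \<Longrightarrow> up (i + j) \<Longrightarrow> gap i \<le> j"
proof -
  obtain u v where "u \<in> C \<inter> NH" "v \<in> C \<inter> NH" "u \<noteq> v" using two_elems[OF two_nbs] by blast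
  then obtain w where w: "w \<in> C \<inter> NH" "w \<noteq> c i" by (cases "u = c i") auto
  then have "w \<in> c ` {i..<i + N}" unfolding c_full by blast
  then obtain m where m: "w = c m" "i \<le> m" "m < i + N" by auto
  then have "m \<noteq> i" using w by auto
  then have j: "0 < m - i \<and> up (i + (m - i))" using m w by (simp add: up_def)
  have l: "0 < gap i \<and> up (i + gap i)" unfolding gap_def by (rule LeastI[where P="\<lambda>j. 0 < j \<and> up (i + j)", OF j])
  then show "0 < gap i" "up (i + gap i)" by auto
  have "gap i \<le> m - i" unfolding gap_def by (rule Least_le[where P="\<lambda>j. 0 < j \<and> up (i + j)", OF j])
  then show "gap i < N" using m by linarith
  have le: "gap i \<le> j" if "0 < j" "up (i + j)"
    unfolding gap_def by (rule Least_le[where P="\<lambda>j. 0 < j \<and> up (i + j)"]) (simp add: that)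
  show "0 < j \<Longrightarrow> up (i + j) \<Longrightarrow> gap i \<le> j" by (rule le)
  show "0 < j \<Longrightarrow> j < gap i \<Longrightarrow> \<not> up (i + j)" using le not_le by blast
qed

lemma up_H: "up i \<Longrightarrow> \<exists>a\<in>H. E (c i) a" by (auto simp: up_def NH_def)

lemma not_up: "\<not> up i \<Longrightarrow> a \<in> H \<Longrightarrow> \<not> E (c i) a"
  using c_C[of i] C_V unfolding up_def NH_def by blast

text \<open>Shifting back by the smaller offset would put one of the two neighbours of
  \<open>H\<close> strictly inside the gap after the other.\<close>

lemma seg_disj:
  assumes "up p" "up j" "0 < x" "x < gap p" "0 < y" "y < gap j" "c (p + x) = c (j + y)"
  shows "c p = c j \<and> x = y"
proof -
  have *: "c p = c j \<and> x = y" if "up p" "up j" "0 < x" "y < gap j" "x \<le> y" "c (p + x) = c (j + y)" for p j x y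
  proof -
    have "c (p + x) = c ((j + (y - x)) + x)" using that by simp
    then have e: "c p = c (j + (y - x))" using c_shift by blast
    then have u: "up (j + (y - x))" using that(1) up_cong[of p "j + (y - x)" 0] by simp
    have "y - x = 0"
    proof (rule ccontr)
      assume "y - x \<noteq> 0"
      then show False using up_next(4)[OF that(2), of "y - x"] u that by simp
    qed
    then show ?thesis using e that by simp
  qed
  show ?thesis
  proof (cases "x \<le> y")
    case True
    then show ?thesis using * assms by blast
  next
    case False
    then show ?thesis using *[of j p y x] assms by simp
  qed
qed

lemma covU: "cov U" unfolding U_def by (rule cov_rest[OF C_in])

lemma kp: "0 < k" using k_pos C_in by blast

lemma big_cycle:
  assumes "cov W" "U \<subseteq> W" "pth zs" "3 \<le> length zs" "E (last zs) (hd zs)" "set zs \<inter> W = {}"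
    "C \<subseteq> W \<union> set zs" "x \<in> set zs" "x \<in> L"
  shows False
proof (rule cov_cyc[OF assms(1) kp cycsetI[OF assms(3-5)] assms(6)])
  show "\<Union>\<C> \<subseteq> W \<union> set zs" using assms(2,7) unfolding U_def by blast
  show "x \<in> set zs" "x \<notin> \<Union>\<C>" using assms(8,9) by (auto simp: L_def)
qed

text \<open>The two arcs that remain of the cycle when \<open>a\<close> vertices after \<open>p\<close> and \<open>b\<close> vertices after \<open>q\<close> are removed.\<close>
lemma arcs_facts:
  assumes "p < q" "q < p + N" "p + a < q" "q + b < p + N"
  shows "pth (seg (p + a + 1) (q + 1))" "pth (seg (q + b + 1) (p + N + 1))"
    "set (seg (p + a + 1) (q + 1)) \<inter> set (seg (q + b + 1) (p + N + 1)) = {}"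
    "(set (seg (p + a + 1) (q + 1)) \<union> set (seg (q + b + 1) (p + N + 1))) \<inter> (I p a \<union> I q b) = {}"
    "C = set (seg (p + a + 1) (q + 1)) \<union> set (seg (q + b + 1) (p + N + 1)) \<union> (I p a \<union> I q b)"
    "I p a \<inter> I q b = {}"
proof -
  show "pth (seg (p + a + 1) (q + 1))" "pth (seg (q + b + 1) (p + N + 1))"
    using assms by (intro seg_pth; linarith)+
  have inj: "inj_on c {p + 1..<p + 1 + N}" by (rule c_inj) simp
  have I: "I p a = c ` {p + 1..<p + a + 1}" "I q b = c ` {q + 1..<q + b + 1}"
    unfolding I_def by (rule arg_cong[where f="(`) c"]; auto)+
  have S: "{p + 1..<p + a + 1} \<subseteq> {p + 1..<p + 1 + N}" "{q + 1..<q + b + 1} \<subseteq> {p + 1..<p + 1 + N}"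
    "{p + a + 1..<q + 1} \<subseteq> {p + 1..<p + 1 + N}" "{q + b + 1..<p + N + 1} \<subseteq> {p + 1..<p + 1 + N}"
    using assms by auto
  show "set (seg (p + a + 1) (q + 1)) \<inter> set (seg (q + b + 1) (p + N + 1)) = {}"
    unfolding seg_simps inj_on_image_Int[OF inj S(3,4), symmetric] by auto
  show "I p a \<inter> I q b = {}"
    unfolding I inj_on_image_Int[OF inj S(1,2), symmetric] using assms by auto
  show "(set (seg (p + a + 1) (q + 1)) \<union> set (seg (q + b + 1) (p + N + 1))) \<inter> (I p a \<union> I q b) = {}"
    unfolding seg_simps I image_Un[symmetric]
    by (subst inj_on_image_Int[OF inj, symmetric]) (use assms in auto)
  have "{p + 1..<p + 1 + N} = {p + a + 1..<q + 1} \<union> {q + b + 1..<p + N + 1} \<union> ({p + 1..<p + a + 1} \<union> {q + 1..<q + b + 1})"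
    using assms by auto
  then show "C = set (seg (p + a + 1) (q + 1)) \<union> set (seg (q + b + 1) (p + N + 1)) \<union> (I p a \<union> I q b)"
    unfolding seg_simps I using c_full[of "p + 1"] by (simp add: image_Un)
qed

text \<open>Each excluded configuration gives a cycle through all vertices of \<open>C\<close> that
  are not absorbed and a path \<open>h\<close> through \<open>H\<close> between \<open>c q\<close>
  and \<open>c p\<close>; with the \<open>k - 1\<close> cycles on the absorbed set this would be a
  larger system. The three cases join the two arcs by an edge, by crossing chords, and by a common
  neighbour.\<close>

lemma crossing:
  assumes pq: "p < q" "q < p + N" "p + a < q" "q + b < p + N" and u: "up p" "up q"
    and cv: "cov (U \<union> I p a \<union> I q b)"
  shows "\<not> E (c (p + a + 1)) (c (q + b + 1))"
    and "p + a + 1 \<le> i \<Longrightarrow> i < q \<Longrightarrow> \<not> (E (c (q + b + 1)) (c i) \<and> E (c (p + a + 1)) (c (Suc i)))"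
    and "w \<in> L - H \<Longrightarrow> \<not> (E (c (p + a + 1)) w \<and> E (c (q + b + 1)) w)"
proof -
  let ?A = "seg (p + a + 1) (q + 1)" and ?B = "seg (q + b + 1) (p + N + 1)" and ?W = "U \<union> I p a \<union> I q b"
  note af = arcs_facts[OF pq]
  obtain h where h: "pth h" "h \<noteq> []" "set h \<subseteq> H" "E (c q) (hd h)" "E (last h) (c p)"
    using up_H[OF u(1)] up_H[OF u(2)] H_path E_sym by metis
  have A: "?A \<noteq> []" "hd ?A = c (p + a + 1)" "last ?A = c q" and B: "?B \<noteq> []" "hd ?B = c (q + b + 1)" "last ?B = c p"
    using pq by (simp_all add: seg_simps)
  have AC: "set ?A \<subseteq> C" "set ?B \<subseteq> C" using c_C by (auto simp: seg_simps)
  have "hd h \<in> set h" using h(2) by simp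
  then have hL: "hd h \<in> L" "hd h \<in> set h" using h(3) H_L by blast+
  have hd: "set h \<inter> C = {}" "set h \<inter> ?W = {}" using h(3) C_H I_C by blast+
  have AW: "(set ?A \<union> set ?B) \<inter> ?W = {}" using af(4) AC C_H(3) by blast
  have CC: "C \<subseteq> ?W \<union> (set ?A \<union> set ?B)" using af(5) by blast
  have ha: "set h \<inter> set ?A = {}" "set h \<inter> set ?B = {}" using hd(1) AC by blast+
  have lens: "1 \<le> length ?A" "1 \<le> length ?B" "1 \<le> length h" using A B h by (simp_all add: Suc_le_eq)
  have UW: "U \<subseteq> ?W" by blast
  show "\<not> E (c (p + a + 1)) (c (q + b + 1))"
  proof
    assume e: "E (c (p + a + 1)) (c (q + b + 1))"
    let ?z = "?A @ h @ rev ?B"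
    show False
    proof (rule big_cycle[OF cv UW, of ?z "hd h"])
      show "pth ?z" using af(1-3) h A B ha by (auto simp: pth_append pth_rev hd_rev E_commute)
      show "3 \<le> length ?z" using lens by simp
      show "E (last ?z) (hd ?z)" using e A B h by (simp add: last_rev E_commute)
    qed (use AW CC hd hL in auto)
  qed
  show "w \<in> L - H \<Longrightarrow> \<not> (E (c (p + a + 1)) w \<and> E (c (q + b + 1)) w)"
  proof
    assume w: "w \<in> L - H" and e: "E (c (p + a + 1)) w \<and> E (c (q + b + 1)) w"
    let ?z = "?A @ h @ rev ?B @ [w]"
    have wC: "w \<notin> C" "w \<notin> U" using w C_V unfolding L_def U_def by blast+
    then have wn: "w \<notin> C" "w \<notin> ?W" "w \<notin> set h" using w I_C[of p a] I_C[of q b] h(3) by blast+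
    then have wn2: "w \<notin> set ?A" "w \<notin> set ?B" using AC by blast+
    show False
    proof (rule big_cycle[OF cv UW, of ?z "hd h"])
      show "pth ?z" using af(1-3) h A B ha wn wn2 e by (auto simp: pth_append pth_rev hd_rev last_rev E_commute)
      show "3 \<le> length ?z" using lens by simp
      show "E (last ?z) (hd ?z)" using e A by (simp add: E_commute)
    qed (use AW CC hd hL wn in auto)
  qed
  show "\<not> (E (c (q + b + 1)) (c i) \<and> E (c (p + a + 1)) (c (Suc i)))" if i: "p + a + 1 \<le> i" "i < q"
  proof
    assume e: "E (c (q + b + 1)) (c i) \<and> E (c (p + a + 1)) (c (Suc i))"
    let ?A1 = "seg (p + a + 1) (i + 1)" and ?A2 = "seg (i + 1) (q + 1)"
    have s: "?A = ?A1 @ ?A2" by (rule seg_append) (use i in linarith)+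
    have A1: "?A1 \<noteq> []" "hd ?A1 = c (p + a + 1)" "last ?A1 = c i" and A2: "?A2 \<noteq> []" "hd ?A2 = c (Suc i)" "last ?A2 = c q"
      using i by (simp_all add: seg_simps)
    have p12: "pth ?A1" "pth ?A2" "set ?A1 \<inter> set ?A2 = {}" using af(1) unfolding s by (simp_all add: pth_append)
    have sA: "set ?A = set ?A1 \<union> set ?A2" unfolding s by simp
    \<comment> \<open>Forward to \<open>c i\<close>, over the first chord to the arc after
      \<open>q\<close>, along it to \<open>c p\<close>, through \<open>H\<close> to
      \<open>c q\<close>, back down to \<open>c (Suc i)\<close>, and over the second chord to the
      start.\<close>
    let ?z = "?A1 @ ?B @ rev h @ rev ?A2"
    show False
    proof (rule big_cycle[OF cv UW, of ?z "hd h"])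
      show "pth ?z" using p12 af(2,3) h A1 A2 B ha e unfolding sA
        by (auto simp: pth_append pth_rev hd_rev last_rev E_commute)
      show "3 \<le> length ?z" using lens A1 by (cases ?A1) auto
      show "E (last ?z) (hd ?z)" using e A1 A2 by (simp add: last_rev E_commute)
    qed (use AW CC hd hL sA in auto)
  qed
qed

lemma whole_arc:
  assumes "a + 1 < N"
  shows "pth (seg (p + a + 1) (p + N + 1))" "set (seg (p + a + 1) (p + N + 1)) \<inter> I p a = {}"
    "C = set (seg (p + a + 1) (p + N + 1)) \<union> I p a"
proof -
  show "pth (seg (p + a + 1) (p + N + 1))" using assms by (intro seg_pth) linarith
  have inj: "inj_on c {p + 1..<p + 1 + N}" by (rule c_inj) simp
  have I: "I p a = c ` {p + 1..<p + a + 1}" unfolding I_def by (rule arg_cong[where f="(`) c"]) auto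
  have S: "{p + 1..<p + a + 1} \<subseteq> {p + 1..<p + 1 + N}" "{p + a + 1..<p + N + 1} \<subseteq> {p + 1..<p + 1 + N}"
    using assms by auto
  show "set (seg (p + a + 1) (p + N + 1)) \<inter> I p a = {}"
    unfolding seg_simps I inj_on_image_Int[OF inj S(2,1), symmetric] by auto
  have "{p + 1..<p + 1 + N} = {p + a + 1..<p + N + 1} \<union> {p + 1..<p + a + 1}" using assms by auto
  then show "C = set (seg (p + a + 1) (p + N + 1)) \<union> I p a"
    unfolding seg_simps I using c_full[of "p + 1"] by (simp add: image_Un)
qed

text \<open>The argument of \<open>crossing\<close> with a vertex \<open>x\<close> of
  \<open>H\<close> in place of the second unabsorbed vertex: \<open>h\<close> ends in
  \<open>x\<close>, and there is only one arc.\<close>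

lemma crossing_H:
  assumes a: "a + 1 < N" and u: "up p" and cv: "cov (U \<union> I p a)" and x: "x \<in> H"
  shows "\<not> E (c (p + a + 1)) x"
    and "p + a + 1 \<le> i \<Longrightarrow> i < p + N \<Longrightarrow> \<not> (E x (c i) \<and> E (c (p + a + 1)) (c (Suc i)))"
proof -
  let ?A = "seg (p + a + 1) (p + N + 1)" and ?W = "U \<union> I p a"
  note af = whole_arc[OF a, of p]
  obtain y where y: "y \<in> H" "E (c p) y" using up_H[OF u] by blast
  obtain h where h: "pth h" "h \<noteq> []" "set h \<subseteq> H" "hd h = y" "last h = x" using H_conn[OF y(1) x] by blast
  have A: "?A \<noteq> []" "hd ?A = c (p + a + 1)" "last ?A = c p" using a by (simp_all add: seg_simps)
  have AC: "set ?A \<subseteq> C" using c_C by (auto simp: seg_simps)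
  have "hd h \<in> set h" using h(2) by simp
  then have hL: "hd h \<in> L" "hd h \<in> set h" using h(3) H_L by blast+
  have hd: "set h \<inter> C = {}" "set h \<inter> ?W = {}" using h(3) C_H I_C by blast+
  have AW: "set ?A \<inter> ?W = {}" using af(2) AC C_H(3) by blast
  have CC: "C \<subseteq> ?W \<union> set ?A" using af(3) by blast
  have ha: "set h \<inter> set ?A = {}" using hd(1) AC by blast
  have lens: "2 \<le> length ?A" "1 \<le> length h" using a h by (simp_all add: Suc_le_eq seg_simps)
  have UW: "U \<subseteq> ?W" by blast
  show "\<not> E (c (p + a + 1)) x"
  proof
    assume e: "E (c (p + a + 1)) x"
    let ?z = "?A @ h"
    show False
    proof (rule big_cycle[OF cv UW, of ?z "hd h"])
      show "pth ?z" using af(1) h A ha y by (auto simp: pth_append)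
      show "3 \<le> length ?z" using lens by simp
      show "E (last ?z) (hd ?z)" using e A h by (simp add: E_commute)
    qed (use AW CC hd hL in auto)
  qed
  show "\<not> (E x (c i) \<and> E (c (p + a + 1)) (c (Suc i)))" if i: "p + a + 1 \<le> i" "i < p + N"
  proof
    assume e: "E x (c i) \<and> E (c (p + a + 1)) (c (Suc i))"
    let ?A1 = "seg (p + a + 1) (i + 1)" and ?A2 = "seg (i + 1) (p + N + 1)"
    have s: "?A = ?A1 @ ?A2" by (rule seg_append) (use i in linarith)+
    have A1: "?A1 \<noteq> []" "hd ?A1 = c (p + a + 1)" "last ?A1 = c i" and A2: "?A2 \<noteq> []" "hd ?A2 = c (Suc i)" "last ?A2 = c p"
      using i by (simp_all add: seg_simps)
    have p12: "pth ?A1" "pth ?A2" "set ?A1 \<inter> set ?A2 = {}" using af(1) unfolding s by (simp_all add: pth_append)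
    have sA: "set ?A = set ?A1 \<union> set ?A2" unfolding s by simp
    let ?z = "?A1 @ rev h @ rev ?A2"
    show False
    proof (rule big_cycle[OF cv UW, of ?z "hd h"])
      show "pth ?z" using p12 h A1 A2 ha e y unfolding sA
        by (auto simp: pth_append pth_rev hd_rev last_rev E_commute)
      show "3 \<le> length ?z" using lens s by simp
      show "E (last ?z) (hd ?z)" using e A1 A2 by (simp add: last_rev E_commute)
    qed (use AW CC hd hL sA in auto)
  qed
qed

end

text \<open>The account for \<open>y p\<close> and \<open>y q\<close>: \<open>u\<close>,
  \<open>c\<close>, \<open>l\<close> are their degrees into the other cycles, \<open>C\<close> and
  the leftover; \<open>A\<close>, \<open>B\<close> those into the two arcs and \<open>I\<close>,
  \<open>J\<close> those into the segments of lengths \<open>a\<close>, \<open>b\<close>. The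
  surpluses \<open>e1\<close>, \<open>e2\<close> stem from blocking segments and \<open>m\<close> is
  the deficit on the arcs. Strictness comes from the leftover.\<close>

lemma pair_arith:
  fixes v w u1 u2 c1 c2 l1 l2 A1 A2 B1 B2 I1 I2 J1 J2 U N L a b e1 e2 m n :: nat
  assumes "v = u1 + c1 + l1" "w = u2 + c2 + l2" "n = U + N + L"
    "c1 = A1 + B1 + (I1 + J1)" "c2 = A2 + B2 + (I2 + J2)"
    "A1 + A2 + B1 + B2 + m + a + b \<le> N" "e1 + e2 \<le> a + b + 2 * m"
    "2 * (u1 + I1) \<le> U + a + e1" "2 * (u2 + J2) \<le> U + b + e2" "J1 = 0" "I2 = 0" "l1 + l2 < L"
  shows "v + w < n"
proof -
  have "u1 + I1 + u2 + J2 \<le> U + a + b + m" using assms(7-9) by simp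
  then have "u1 + I1 + u2 + J2 + (A1 + A2 + B1 + B2) \<le> U + N" using assms(6) by simp
  then show ?thesis using assms(1-5,10-12) by simp
qed
lemma pair_arith_H:
  fixes v w u1 u2 c1 c2 l1 l2 A1 A2 I1 I2 U N L a e n :: nat
  assumes "v = u1 + c1 + l1" "w = u2 + c2 + l2" "n = U + N + L"
    "c1 = A1 + I1" "c2 = A2 + I2" "A1 + A2 + e \<le> N - a" "a < N"
    "2 * (u1 + I1) \<le> U + a + e" "2 * u2 \<le> U" "I2 = 0" "l2 + l1 < L"
  shows "w + v < n"
proof -
  have "u1 + I1 + u2 \<le> U + (a + e)" using assms(8,9) by simp
  moreover have "A1 + A2 + (a + e) \<le> N" using assms(6,7) by simp
  ultimately have "u1 + I1 + u2 + (A1 + A2) \<le> U + N" by simp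
  then show ?thesis using assms(1-5,10,11) by simp
qed

section \<open>Maximal absorbable segments\<close>

context max_cycle
begin

text \<open>The label of a neighbour of \<open>H\<close> is the number of vertices after it on the cycle that can be absorbed by the other
  cycles; any two such segments must be absorbable at once.\<close>
definition good :: "('a \<Rightarrow> nat) \<Rightarrow> bool" where
  "good l \<longleftrightarrow> (\<forall>v. v \<notin> C \<inter> NH \<longrightarrow> l v = 0) \<and> (\<forall>i. up i \<longrightarrow> l (c i) < gap i) \<and>
    (\<forall>i j a b. up i \<longrightarrow> up j \<longrightarrow> a \<le> l (c i) \<longrightarrow> b \<le> l (c j) \<longrightarrow> cov (U \<union> I i a \<union> I j b))"

lemma I_0[simp]: "I i 0 = {}" by (simp add: I_def)

lemma I_Suc: "I i (Suc a) = insert (c (i + a + 1)) (I i a)"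
proof -
  have "{i<..i + Suc a} = insert (i + a + 1) {i<..i + a}" by auto
  then show ?thesis by (simp add: I_def)
qed

lemma I_mono: "a \<le> b \<Longrightarrow> I i a \<subseteq> I i b" by (auto simp: I_def)

lemma good_0: "good (\<lambda>_. 0)"
  using covU up_next(1) by (simp add: good_def)

lemma max_good:
  obtains l where "good l" "\<And>l'. good l' \<Longrightarrow> (\<Sum>v\<in>C \<inter> NH. l' v) \<le> (\<Sum>v\<in>C \<inter> NH. l v)"
proof -
  have "(\<Sum>v\<in>C \<inter> NH. l v) < N * N + 1" if g: "good l" for l
  proof -
    have "l v \<le> N" if "v \<in> C \<inter> NH" for v
    proof -
      have "v \<in> c ` {0..<0 + N}" using that c_full by blast
      then obtain i where i: "v = c i" by auto
      then have "up i" using that by (simp add: up_def)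
      then have "l (c i) < gap i" "gap i < N" using g up_next(3) by (auto simp: good_def)
      then show ?thesis using i by simp
    qed
    then have "(\<Sum>v\<in>C \<inter> NH. l v) \<le> card (C \<inter> NH) * N"
      using sum_bounded_above[of "C \<inter> NH" l N] by simp
    also have "\<dots> \<le> N * N"
      using card_mono[OF C_fin[OF C_in], of "C \<inter> NH"] card_C by (intro mult_le_mono1) simp
    finally show ?thesis by simp
  qed
  then show ?thesis
    using ex_has_greatest_nat[of good "\<lambda>_. 0" "\<lambda>l. \<Sum>v\<in>C \<inter> NH. l v" "N * N + 1"] good_0 that by blast
qed

end

locale max_family = max_cycle +
  fixes l :: "'a \<Rightarrow> nat"
  assumes l_good: "good l"
    and l_max: "good l' \<Longrightarrow> (\<Sum>v\<in>C \<inter> NH. l' v) \<le> (\<Sum>v\<in>C \<inter> NH. l v)"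
begin

definition y :: "nat \<Rightarrow> 'a" where "y p = c (p + l (c p) + 1)"

lemma l_gap: "up i \<Longrightarrow> l (c i) < gap i" using l_good by (simp add: good_def)

lemma l_cov: "up i \<Longrightarrow> up j \<Longrightarrow> a \<le> l (c i) \<Longrightarrow> b \<le> l (c j) \<Longrightarrow> cov (U \<union> I i a \<union> I j b)"
  using l_good unfolding good_def by blast

lemma l_cov1: "up i \<Longrightarrow> a \<le> l (c i) \<Longrightarrow> cov (U \<union> I i a)"
  using l_cov[of i i a 0] by simp

text \<open>If the whole segment could be moved to the other cycles, a path through \<open>H\<close> could replace it.\<close>
lemma l_gap': "up p \<Longrightarrow> l (c p) + 1 < gap p"
proof (rule ccontr)
  assume u: "up p" and "\<not> l (c p) + 1 < gap p"
  then have g: "gap p = l (c p) + 1" using l_gap[OF u] by simp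
  let ?a = "l (c p)"
  have aN: "?a + 1 < N" using up_next(3)[OF u] g by simp
  let ?A = "seg (p + ?a + 1) (p + N + 1)" and ?W = "U \<union> I p ?a"
  note af = whole_arc[OF aN, of p]
  have u2: "up (p + ?a + 1)" using up_next(2)[OF u] g by (simp add: add.assoc)
  obtain h where h: "pth h" "h \<noteq> []" "set h \<subseteq> H" "E (c p) (hd h)" "E (last h) (c (p + ?a + 1))"
    using up_H[OF u] up_H[OF u2] H_path E_sym by metis
  have A: "?A \<noteq> []" "hd ?A = c (p + ?a + 1)" "last ?A = c p" using aN by (simp_all add: seg_simps)
  have AC: "set ?A \<subseteq> C" using c_C by (auto simp: seg_simps)
  have "hd h \<in> set h" using h(2) by simp
  then have hL: "hd h \<in> L" "hd h \<in> set h" using h(3) H_L by blast+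
  have hd: "set h \<inter> C = {}" "set h \<inter> ?W = {}" using h(3) C_H I_C by blast+
  have AW: "set ?A \<inter> ?W = {}" using af(2) AC C_H(3) by blast
  have CC: "C \<subseteq> ?W \<union> set ?A" using af(3) by blast
  have ha: "set h \<inter> set ?A = {}" using hd(1) AC by blast
  have lens: "2 \<le> length ?A" "1 \<le> length h" using aN h by (simp_all add: Suc_le_eq seg_simps)
  have UW: "U \<subseteq> ?W" by blast
  let ?z = "?A @ h"
  show False
  proof (rule big_cycle[OF l_cov1[OF u order_refl] UW, of ?z "hd h"])
    show "pth ?z" using af(1) h A ha by (auto simp: pth_append)
    show "3 \<le> length ?z" using lens by simp
    show "E (last ?z) (hd ?z)" using A h by simp
  qed (use AW CC hd hL in auto)
qed

lemma y_C: "y p \<in> C" using c_C by (simp add: y_def)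

lemma y_cong: "c p = c q \<Longrightarrow> y p = y q"
  using c_shift[of p "l (c p) + 1" q] by (simp add: y_def add.assoc)

lemma y_H: "up p \<Longrightarrow> a \<in> H \<Longrightarrow> \<not> E (y p) a"
  using crossing_H(1)[of "l (c p)" p a] l_gap'[of p] up_next(3)[of p] l_cov1[of p "l (c p)"] by (simp add: y_def)

lemma y_notin: "up p \<Longrightarrow> up j \<Longrightarrow> b \<le> l (c j) \<Longrightarrow> y p \<notin> I j b"
proof
  assume u: "up p" "up j" and b: "b \<le> l (c j)" and "y p \<in> I j b"
  then obtain m where m: "j < m" "m \<le> j + b" "y p = c m" by (auto simp: I_def)
  have "c p = c j \<and> l (c p) + 1 = m - j"
  proof (rule seg_disj[OF u])
    show "l (c p) + 1 < gap p" by (rule l_gap'[OF u(1)])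
    show "m - j < gap j" using m b l_gap[OF u(2)] by linarith
    show "c (p + (l (c p) + 1)) = c (j + (m - j))" using m by (simp add: y_def add.assoc)
  qed (use m in auto)
  then show False using m b by auto
qed

text \<open>Otherwise the label of \<open>c p\<close> could be raised by one, and the new labelling
  would be good with a larger sum.\<close>

lemma blocked:
  assumes u: "up p"
  shows "\<exists>j b. up j \<and> b \<le> l (c j) \<and> \<not> cov (insert (y p) (U \<union> I p (l (c p)) \<union> I j b))"
proof (rule ccontr)
  assume n: "\<not> ?thesis"
  let ?a = "l (c p)"
  let ?l = "l(c p := Suc ?a)"
  have n': "cov (U \<union> I p (Suc ?a) \<union> I j b)" if "up j" "b \<le> l (c j)" for j b
    using n that by (simp add: I_Suc y_def add.commute)
  have fin: "finite (C \<inter> NH)" using C_fin[OF C_in] by simp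
  have cp: "c p \<in> C \<inter> NH" using u c_C by (simp add: up_def)
  have "good ?l"
    unfolding good_def
  proof (intro conjI allI impI)
    fix v assume "v \<notin> C \<inter> NH"
    then show "?l v = 0" using cp l_good by (auto simp: good_def)
  next
    fix i assume i: "up i"
    show "?l (c i) < gap i"
    proof (cases "c i = c p")
      case True
      then have "gap i = gap p" by (rule gap_cong)
      then show ?thesis using True l_gap'[OF u] by simp
    next
      case False
      then show ?thesis using l_gap[OF i] by simp
    qed
  next
    fix i j a b assume ij: "up i" "up j" and ab: "a \<le> ?l (c i)" "b \<le> ?l (c j)"
    have old: "a \<le> l (c i) \<or> (c i = c p \<and> a = Suc ?a)" "b \<le> l (c j) \<or> (c j = c p \<and> b = Suc ?a)"
      using ab by (auto split: if_splits)
    consider "a \<le> l (c i)" "b \<le> l (c j)" | "c i = c p" "a = Suc ?a" "b \<le> l (c j)"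
      | "a \<le> l (c i)" "c j = c p" "b = Suc ?a" | "c i = c p" "a = Suc ?a" "c j = c p" "b = Suc ?a"
      using old by blast
    then show "cov (U \<union> I i a \<union> I j b)"
    proof cases
      case 1
      then show ?thesis using l_cov ij by blast
    next
      case 2
      then show ?thesis using n'[OF ij(2), of b] I_cong[of i p] by simp
    next
      case 3
      then show ?thesis using n'[OF ij(1), of a] I_cong[of j p] by (simp add: Un_ac)
    next
      case 4
      \<comment> \<open>Both segments are the prolonged one, so an empty partner is enough.\<close>
      then show ?thesis using n'[OF u, of 0] I_cong[of i p] I_cong[of j p] by simp
    qed
  qed
  then have "(\<Sum>v\<in>C \<inter> NH. ?l v) \<le> (\<Sum>v\<in>C \<inter> NH. l v)" by (rule l_max)
  moreover have "(\<Sum>v\<in>C \<inter> NH. l v) < (\<Sum>v\<in>C \<inter> NH. ?l v)"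
    by (rule sum_strict_mono_ex1[OF fin]) (use cp in auto)
  ultimately show False by simp
qed

lemma U_fin: "finite U" using cov_fin[OF covU] .

lemma U_I: "U \<inter> I p a = {}" using C_H(3) I_C by blast

lemma card_I: "a < N \<Longrightarrow> card (I p a) = a"
proof -
  assume a: "a < N"
  have "inj_on c {p<..p + a}" by (rule inj_on_subset[OF c_inj[of "p + N" p]]) (use a in auto)
  then show ?thesis by (simp add: I_def card_image)
qed

lemma l_N: "up p \<Longrightarrow> l (c p) + 1 < N" using l_gap'[of p] up_next(3)[of p] by linarith

text \<open>By \<open>cov_insert\<close>, \<open>y p\<close> is adjacent to at most half of the set
  that blocks it. The surplus \<open>e\<close> is the length of the blocking segment, or zero if
  that lies inside the segment of \<open>p\<close> itself.\<close>

lemma y_U_bound: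
  assumes u: "up p"
  shows "\<exists>e. 2 * (dg U (y p) + dg (I p (l (c p))) (y p)) \<le> card U + l (c p) + e
    \<and> (e = 0 \<or> (\<exists>j. up j \<and> c j \<noteq> c p \<and> e \<le> l (c j)))"
proof -
  let ?a = "l (c p)"
  obtain j b where jb: "up j" "b \<le> l (c j)" "\<not> cov (insert (y p) (U \<union> I p ?a \<union> I j b))"
    using blocked[OF u] by blast
  let ?W = "U \<union> I p ?a \<union> I j b"
  have "y p \<notin> U" using y_C C_H(3) by blast
  then have "y p \<notin> ?W" using y_notin[OF u u order_refl] y_notin[OF u jb(1,2)] by blast
  then have b2: "2 * dg ?W (y p) \<le> card ?W" using cov_insert[OF l_cov[OF u jb(1) order_refl jb(2)]] jb(3) by blast
  have d: "dg U (y p) + dg (I p ?a) (y p) \<le> dg ?W (y p)"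
    using dg_Un[OF U_I] dg_mono[of "U \<union> I p ?a" ?W] by (metis Un_upper1)
  have cU: "card (U \<union> I p ?a) = card U + ?a"
    using card_Un_disjoint[OF U_fin I_fin U_I] card_I l_N[OF u] by simp
  show ?thesis
  proof (cases "c j = c p")
    case True
    then have "I j b \<subseteq> I p ?a" using I_cong[OF True] I_mono jb(2) by simp
    then have "?W = U \<union> I p ?a" by blast
    then show ?thesis using b2 d cU by (intro exI[of _ 0]) simp
  next
    case False
    have "card ?W \<le> card (U \<union> I p ?a) + card (I j b)" by (rule card_Un_le)
    also have "card (I j b) = b" using card_I[of b j] l_N[OF jb(1)] jb(2) by simp
    finally show ?thesis using b2 d cU False jb by (intro exI[of _ b]) auto
  qed
qed

lemma dg_arc:
  assumes "e < s + N"
  shows "dg (c ` {s..e}) v = card {i\<in>{s..e}. E v (c i)}"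
proof -
  have "{w\<in>c ` {s..e}. E v w} = c ` {i\<in>{s..e}. E v (c i)}" by auto
  moreover have "inj_on c {i\<in>{s..e}. E v (c i)}"
    by (rule inj_on_subset[OF c_inj[of "s + N" s]]) (use assms in auto)
  ultimately show ?thesis by (simp add: dg_def card_image)
qed

text \<open>This is \<open>crossing\<close> with only the first \<open>m\<close> vertices after
  \<open>j\<close> absorbed, the reason why \<open>good\<close> speaks of all prefixes of a
  segment.\<close>

lemma y_indep:
  assumes "up q" "up j" "c q \<noteq> c j" "m \<le> l (c j)"
  shows "\<not> E (y q) (c (j + m + 1))"
proof -
  have "c j \<in> c ` {q..<q + N}" using c_C c_full by blast
  then obtain j' where j': "q \<le> j'" "j' < q + N" "c j' = c j" by auto
  then have lt: "q < j'" using assms(3) by (cases "q = j'") auto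
  have up': "up j'" using assms(2) j'(3) by (simp add: up_def)
  have g: "q + gap q \<le> j'" using up_next(5)[OF assms(1), of "j' - q"] lt up' by simp
  have upN: "up (q + N)" using assms(1) by (simp add: up_def)
  have g2: "j' + gap j' \<le> q + N" using up_next(5)[OF up', of "q + N - j'"] j' upN by simp
  have lj: "m < gap j'" using assms(4) l_gap[OF up'] j'(3) by simp
  have "\<not> E (c (q + l (c q) + 1)) (c (j' + m + 1))"
  proof (rule crossing(1)[OF lt j'(2) _ _ assms(1) up'])
    show "q + l (c q) < j'" using g l_gap[OF assms(1)] by linarith
    show "j' + m < q + N" using g2 lj by linarith
    show "cov (U \<union> I q (l (c q)) \<union> I j' m)" using l_cov[OF assms(1) up' order_refl, of m] assms(4) j'(3) by simp
  qed
  moreover have "c (j' + m + 1) = c (j + m + 1)" using c_shift[of j' "m + 1" j] j'(3) by (simp add: add.assoc)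
  ultimately show ?thesis by (simp add: y_def)
qed

lemma y_I_other: "up q \<Longrightarrow> up j \<Longrightarrow> c q \<noteq> c j \<Longrightarrow> dg (I j (l (c j))) (y q) = 0"
proof -
  assume a: "up q" "up j" "c q \<noteq> c j"
  have "\<not> E (y q) w" if w: "w \<in> I j (l (c j))" for w
  proof -
    obtain i where i: "j < i" "i \<le> j + l (c j)" "w = c i" using w by (auto simp: I_def)
    have "\<not> E (y q) (c (j + (i - j - 1) + 1))" by (rule y_indep[OF a]) (use i in auto)
    then show ?thesis using i by simp
  qed
  then show ?thesis by (simp add: dg_eq_0)
qed

text \<open>One arc of the cycle, between the segments after \<open>p\<close> and before \<open>q\<close>. Each vertex of a removable prefix of a
  third segment contributes a deficit, as neither \<open>y p\<close> nor \<open>y q\<close> has neighbours there.\<close>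
lemma arc_count:
  assumes pq: "p < q" "q < p + N" and u: "up p" "up q"
    and T: "m = 0 \<or> (\<exists>j. up j \<and> p < j \<and> j < q \<and> m \<le> l (c j))"
  shows "dg (c ` {p + l (c p) + 1..q}) (y p) + dg (c ` {p + l (c p) + 1..q}) (y q) + m \<le> q - (p + l (c p))"
proof -
  let ?s = "p + l (c p) + 1"
  have upN: "up (p + N)" using u(1) by (simp add: up_def)
  have g: "p + gap p \<le> q" using up_next(5)[OF u(1), of "q - p"] pq u(2) by simp
  have g2: "q + gap q \<le> p + N" using up_next(5)[OF u(2), of "p + N - q"] pq upN by simp
  have s: "?s < q" using g l_gap'[OF u(1)] by linarith
  have qN: "q + l (c q) < p + N" using g2 l_gap[OF u(2)] by linarith
  have cpq: "c p \<noteq> c q" using c_neq pq by blast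
  have cv: "cov (U \<union> I p (l (c p)) \<union> I q (l (c q)))" using l_cov u by blast
  obtain T where TT: "T \<subseteq> {?s<..q}" "card T = m" "\<And>i. i \<in> T \<Longrightarrow> \<not> E (y p) (c i) \<and> \<not> E (y q) (c (i - 1))"
  proof (cases "m = 0")
    case True
    then show ?thesis using that[of "{}"] by simp
  next
    case False
    then obtain j where j: "up j" "p < j" "j < q" "m \<le> l (c j)" using T by blast
    have gj: "p + gap p \<le> j" using up_next(5)[OF u(1), of "j - p"] j by simp
    have gj2: "j + gap j \<le> q" using up_next(5)[OF j(1), of "q - j"] j u(2) by simp
    have cne: "c p \<noteq> c j" "c q \<noteq> c j" using c_neq[of p j] c_neq[of j q] j pq by auto
    show ?thesis
    \<comment> \<open>One place later than the prefix, because \<open>shifted_count\<close> looks at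
      \<open>y q\<close> one position earlier. The last position is the vertex just after the
      prefix, which \<open>y_indep\<close> still covers.\<close>
    proof (rule that[of "{j + 1<..j + 1 + m}"])
      show "{j + 1<..j + 1 + m} \<subseteq> {?s<..q}"
        using gj gj2 l_gap'[OF u(1)] l_gap'[OF j(1)] j(4) by auto
      fix i assume i: "i \<in> {j + 1<..j + 1 + m}"
      have i1: "j + (i - j - 1) + 1 = i" and i2: "j + (i - j - 2) + 1 = i - 1" using i by auto
      have "\<not> E (y p) (c (j + (i - j - 1) + 1))" by (rule y_indep[OF u(1) j(1) cne(1)]) (use i j(4) in auto)
      moreover have "\<not> E (y q) (c (j + (i - j - 2) + 1))" by (rule y_indep[OF u(2) j(1) cne(2)]) (use i j(4) in auto)
      ultimately show "\<not> E (y p) (c i) \<and> \<not> E (y q) (c (i - 1))" unfolding i1 i2 by blast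
    qed simp
  qed
  have "card {i\<in>{?s..q}. E (y p) (c i)} + card {i\<in>{?s..q}. E (y q) (c i)} + card T \<le> Suc q - ?s"
  proof (rule shifted_count)
    show "?s \<le> q" using s by simp
    show "\<not> E (y p) (c ?s)" using E_irrefl by (simp add: y_def)
    show "\<not> (E (y q) (c i) \<and> E (y p) (c (Suc i)))" if "?s \<le> i" "i < q" for i
      unfolding y_def using crossing(2)[OF pq _ qN u cv that] s by simp
  qed (use TT in auto)
  moreover have "q < ?s + N" using pq by simp
  ultimately show ?thesis using dg_arc TT(2) s by simp
qed

text \<open>The arc is now the whole cycle without the segment after \<open>p\<close>. Another
  segment contributes its length as a deficit, since \<open>x\<close> has no neighbours strictly
  inside a gap and \<open>y_indep\<close> handles \<open>y p\<close>.\<close>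

lemma arc_count_H:
  assumes u: "up p" and x: "x \<in> H" and T: "m = 0 \<or> (\<exists>j. up j \<and> c j \<noteq> c p \<and> m \<le> l (c j))"
  shows "dg (c ` {p + l (c p) + 1..p + N}) (y p) + dg (c ` {p + l (c p) + 1..p + N}) x + m \<le> N - l (c p)"
proof -
  let ?s = "p + l (c p) + 1"
  have aN: "l (c p) + 1 < N" using l_N[OF u] .
  obtain T where TT: "T \<subseteq> {?s<..p + N}" "card T = m" "\<And>i. i \<in> T \<Longrightarrow> \<not> E (y p) (c i) \<and> \<not> E x (c (i - 1))"
  proof (cases "m = 0")
    case True
    then show ?thesis using that[of "{}"] by simp
  next
    case False
    then obtain j0 where j0: "up j0" "c j0 \<noteq> c p" "m \<le> l (c j0)" using T by blast
    have "c j0 \<in> c ` {p..<p + N}" using c_C c_full by blast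
    then obtain j where j': "p \<le> j" "j < p + N" "c j = c j0" by auto
    have "p \<noteq> j" using j'(3) j0(2) by auto
    then have j: "up j" "p < j" "j < p + N" "m \<le> l (c j)" using j0 j' by (simp_all add: up_def)
    have upN: "up (p + N)" using u by (simp add: up_def)
    have gj: "p + gap p \<le> j" using up_next(5)[OF u, of "j - p"] j by simp
    have gj2: "j + gap j \<le> p + N" using up_next(5)[OF j(1), of "p + N - j"] j upN by simp
    have cne: "c p \<noteq> c j" using j' j0(2) by simp
    show ?thesis
    proof (rule that[of "{j + 1<..j + 1 + m}"])
      show "{j + 1<..j + 1 + m} \<subseteq> {?s<..p + N}"
        using gj gj2 l_gap'[OF u] l_gap'[OF j(1)] j(4) by auto
      fix i assume i: "i \<in> {j + 1<..j + 1 + m}"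
      have i1: "j + (i - j - 1) + 1 = i" and i2: "j + (i - j - 1) = i - 1" using i by auto
      have "\<not> E (y p) (c (j + (i - j - 1) + 1))" by (rule y_indep[OF u j(1) cne]) (use i j(4) in auto)
      moreover have "\<not> up (j + (i - j - 1))" by (rule up_next(4)[OF j(1)]) (use i j(4) l_gap[OF j(1)] in auto)
      then have "\<not> E (c (j + (i - j - 1))) x" using x by (rule not_up)
      then have "\<not> E x (c (j + (i - j - 1)))" using E_sym by blast
      ultimately show "\<not> E (y p) (c i) \<and> \<not> E x (c (i - 1))" unfolding i1 unfolding i2 by blast
    qed simp
  qed
  have "card {i\<in>{?s..p + N}. E (y p) (c i)} + card {i\<in>{?s..p + N}. E x (c i)} + card T \<le> Suc (p + N) - ?s"
  proof (rule shifted_count)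
    show "?s \<le> p + N" using aN by simp
    show "\<not> E (y p) (c ?s)" using E_irrefl by (simp add: y_def)
    show "\<not> (E x (c i) \<and> E (y p) (c (Suc i)))" if "?s \<le> i" "i < p + N" for i
      unfolding y_def using crossing_H(2)[OF aN u l_cov1[OF u order_refl] x that] .
  qed (use TT in auto)
  moreover have "p + N < ?s + N" by simp
  ultimately show ?thesis using dg_arc TT(2) aN by simp
qed

lemma V_split: "dg V v = dg U v + dg C v + dg L v" "card V = card U + N + card L"
proof -
  have V: "V = U \<union> C \<union> L" using csys_V[OF sys] C_V by (auto simp: U_def L_def)
  have d: "(U \<union> C) \<inter> L = {}" using C_V by (auto simp: U_def L_def)
  show "dg V v = dg U v + dg C v + dg L v" using dg_Un[OF d] dg_Un[OF C_H(3)] V by simp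
  show "card V = card U + N + card L"
    using card_Un_disjoint[OF _ finL(1) d] card_Un_disjoint[OF U_fin C_fin[OF C_in] C_H(3)] V U_fin C_fin[OF C_in] card_C by simp
qed

lemma pair_sum:
  assumes pq: "p < q" "q < p + N" and u: "up p" "up q"
  shows "\<not> E (y p) (y q)" "dg V (y p) + dg V (y q) < card V"
proof -
  have upN: "up (p + N)" using u(1) by (simp add: up_def)
  let ?a = "l (c p)" and ?b = "l (c q)"
  have cN: "c (p + N) = c p" by simp
  have g: "p + gap p \<le> q" using up_next(5)[OF u(1), of "q - p"] pq u(2) by simp
  have g2: "q + gap q \<le> p + N" using up_next(5)[OF u(2), of "p + N - q"] pq upN by simp
  have pa: "p + ?a < q" using g l_gap[OF u(1)] by linarith
  have qN: "q + ?b < p + N" using g2 l_gap[OF u(2)] by linarith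
  have cpq: "c p \<noteq> c q" using c_neq pq by blast
  have cv: "cov (U \<union> I p ?a \<union> I q ?b)" using l_cov u by blast
  show "\<not> E (y p) (y q)" unfolding y_def by (rule crossing(1)[OF pq pa qN u cv])
  note af = arcs_facts[OF pq pa qN]
  let ?A = "c ` {p + ?a + 1..q}" and ?B = "c ` {q + ?b + 1..p + N}"
  have AB: "set (seg (p + ?a + 1) (q + 1)) = ?A" "set (seg (q + ?b + 1) (p + N + 1)) = ?B"
    by (auto simp: seg_simps)
  note af2 = af(3-6)[unfolded AB]
  have dC: "dg C v = dg ?A v + dg ?B v + (dg (I p ?a) v + dg (I q ?b) v)" for v
    unfolding af2(3) using dg_Un[OF af2(1)] dg_Un[OF af2(2)] dg_Un[OF af2(4)] by simp
  obtain e1 where e1: "2 * (dg U (y p) + dg (I p ?a) (y p)) \<le> card U + ?a + e1"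
    "e1 = 0 \<or> (\<exists>j. up j \<and> c j \<noteq> c p \<and> e1 \<le> l (c j))" using y_U_bound[OF u(1)] by blast
  obtain e2 where e2: "2 * (dg U (y q) + dg (I q ?b) (y q)) \<le> card U + ?b + e2"
    "e2 = 0 \<or> (\<exists>j. up j \<and> c j \<noteq> c q \<and> e2 \<le> l (c j))" using y_U_bound[OF u(2)] by blast
  have z: "dg (I q ?b) (y p) = 0" "dg (I p ?a) (y q) = 0" using y_I_other u cpq by simp_all
  have cnt: "dg ?A (y p) + dg ?A (y q) + dg ?B (y p) + dg ?B (y q) + m + ?a + ?b \<le> N"
    if m: "m = 0 \<or> (\<exists>j. up j \<and> c j \<noteq> c p \<and> c j \<noteq> c q \<and> m \<le> l (c j))" for m
  proof -
    \<comment> \<open>The single segment that provides the deficit lies in one of the two arcs; the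
      other arc gets zero.\<close>
    obtain m1 m2 where m12: "m = m1 + m2" "m1 = 0 \<or> (\<exists>j. up j \<and> p < j \<and> j < q \<and> m1 \<le> l (c j))"
      "m2 = 0 \<or> (\<exists>j. up j \<and> q < j \<and> j < p + N \<and> m2 \<le> l (c j))"
    proof (cases "m = 0")
      case True
      then show ?thesis using that[of 0 0] by simp
    next
      case False
      then obtain j0 where j0: "up j0" "c j0 \<noteq> c p" "c j0 \<noteq> c q" "m \<le> l (c j0)" using m by blast
      have "c j0 \<in> c ` {p..<p + N}" using c_C c_full by blast
      then obtain j where j: "p \<le> j" "j < p + N" "c j = c j0" by auto
      have "p \<noteq> j" "j \<noteq> q" using j(3) j0(2,3) by auto
      then have j2: "up j" "p \<noteq> j" "j \<noteq> q" "m \<le> l (c j)" using j0 j by (simp_all add: up_def)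
      show ?thesis
      proof (cases "j < q")
        case True
        then have "up j \<and> p < j \<and> j < q \<and> m \<le> l (c j)" using j j2 by simp
        then show ?thesis using that[of m 0] by auto
      next
        case False
        then have "up j \<and> q < j \<and> j < p + N \<and> m \<le> l (c j)" using j j2 by simp
        then show ?thesis using that[of 0 m] by auto
      qed
    qed
    have "dg ?A (y p) + dg ?A (y q) + m1 \<le> q - (p + ?a)" by (rule arc_count[OF pq u m12(2)])
    moreover have "dg ?B (y q) + dg ?B (y (p + N)) + m2 \<le> p + N - (q + ?b)"
      by (rule arc_count[OF pq(2) _ u(2) upN m12(3)]) (use pq in simp)
    moreover have "y (p + N) = y p" by (rule y_cong) simp
    ultimately show ?thesis using m12(1) pa qN by simp
  qed
  \<comment> \<open>A surplus comes either from the segment of the other vertex, and is then at most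
    its label, or from a third segment. \<open>m\<close> is the larger of the surpluses of the
    latter kind, so one deficit pays for both.\<close>
  obtain m where m: "m = 0 \<or> (\<exists>j. up j \<and> c j \<noteq> c p \<and> c j \<noteq> c q \<and> m \<le> l (c j))" "e1 + e2 \<le> ?a + ?b + 2 * m"
  proof -
    have x1: "e1 \<le> ?b \<or> (\<exists>j. up j \<and> c j \<noteq> c p \<and> c j \<noteq> c q \<and> e1 \<le> l (c j))" using e1(2) by fastforce
    have x2: "e2 \<le> ?a \<or> (\<exists>j. up j \<and> c j \<noteq> c p \<and> c j \<noteq> c q \<and> e2 \<le> l (c j))" using e2(2) by fastforce
    show ?thesis
    proof (cases "e1 \<le> ?b")
      case True
      show ?thesis
      proof (cases "e2 \<le> ?a")
        case True
        then show ?thesis using that[of 0] \<open>e1 \<le> ?b\<close> by simp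
      next
        case False
        then show ?thesis using that[of e2] x2 \<open>e1 \<le> ?b\<close> by simp
      qed
    next
      case False
      then have o1: "\<exists>j. up j \<and> c j \<noteq> c p \<and> c j \<noteq> c q \<and> e1 \<le> l (c j)" using x1 by blast
      show ?thesis
      proof (cases "e2 \<le> ?a \<or> e2 \<le> e1")
        case True
        then show ?thesis using that[of e1] o1 by auto
      next
        case False
        then show ?thesis using that[of e2] x2 by auto
      qed
    qed
  qed
  have Lle: "dg L (y p) + dg L (y q) < card L"
  proof -
    have zH: "dg H (y p) = 0" "dg H (y q) = 0" using y_H u by (simp_all add: dg_eq_0)
    have LH: "L = H \<union> (L - H)" "H \<inter> (L - H) = {}" using H_L by auto
    have e: "dg L v = dg H v + dg (L - H) v" for v using dg_Un[OF LH(2), of v] LH(1) by simp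
    have "{w\<in>L - H. E (y p) w} \<inter> {w\<in>L - H. E (y q) w} = {}"
      using crossing(3)[OF pq pa qN u cv] unfolding y_def by blast
    then have "dg (L - H) (y p) + dg (L - H) (y q) = card ({w\<in>L - H. E (y p) w} \<union> {w\<in>L - H. E (y q) w})"
      unfolding dg_def by (rule card_Un_disjoint[symmetric, OF fin_nb fin_nb])
    also have "\<dots> \<le> card (L - H)" using finL by (intro card_mono) auto
    \<comment> \<open>\<open>H\<close> is nonempty and contains no neighbour of either vertex, which
      makes the degree sum strictly smaller than the order.\<close>
    also have "\<dots> < card L" using H_L H_ne finL by (intro psubset_card_mono) auto
    finally show ?thesis using e zH by simp
  qed
  show "dg V (y p) + dg V (y q) < card V"
    by (rule pair_arith[OF V_split(1) V_split(1) V_split(2) dC dC _ m(2) e1(1) e2(1) z Lle])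
      (use cnt[OF m(1)] in linarith)
qed

lemma pair_sum_H:
  assumes u: "up p" and x: "x \<in> H"
  shows "\<not> E x (y p)" "dg V x + dg V (y p) < card V"
proof -
  let ?a = "l (c p)"
  have aN: "?a + 1 < N" using l_N[OF u] .
  show "\<not> E x (y p)" using y_H[OF u x] E_sym by blast
  note af = whole_arc[OF aN, of p]
  let ?A = "c ` {p + ?a + 1..p + N}"
  have A: "set (seg (p + ?a + 1) (p + N + 1)) = ?A" by (auto simp: seg_simps)
  note af2 = af(2,3)[unfolded A]
  have dC: "dg C v = dg ?A v + dg (I p ?a) v" for v
    unfolding af2(2) using dg_Un[OF af2(1)] by simp
  obtain e where e: "2 * (dg U (y p) + dg (I p ?a) (y p)) \<le> card U + ?a + e"
    "e = 0 \<or> (\<exists>j. up j \<and> c j \<noteq> c p \<and> e \<le> l (c j))" using y_U_bound[OF u] by blast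
  have cnt: "dg ?A (y p) + dg ?A x + e \<le> N - ?a" by (rule arc_count_H[OF u x e(2)])
  have z: "dg (I p ?a) x = 0"
    unfolding dg_eq_0
  proof
    fix w assume "w \<in> I p ?a"
    then obtain i where i: "p < i" "i \<le> p + ?a" "w = c i" by (auto simp: I_def)
    have "\<not> up (p + (i - p))" by (rule up_next(4)[OF u]) (use i l_gap[OF u] in auto)
    then have "\<not> E (c i) x" using not_up[OF _ x] i by simp
    then show "\<not> E x w" using E_sym i(3) by blast
  qed
  \<comment> \<open>Otherwise the other cycles could absorb \<open>x\<close> while \<open>C\<close>
    is kept.\<close>
  have xU: "2 * dg U x \<le> card U"
  proof (rule cov_insert[OF covU])
    show xn: "x \<notin> U" using x C_H(2) by blast
    show "\<not> cov (insert x U)"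
    proof
      assume "cov (insert x U)"
      then obtain \<D> where D: "csys (k - 1) \<D>" "\<Union>\<D> = insert x U" by (auto simp: cov_def)
      have "C \<inter> \<Union>\<D> = {}" unfolding D(2) using C_H(1,3) x by blast
      then have "csys k (insert C \<D>)" using csys_add[OF D(1) C_cyc[OF C_in]] kp by simp
      moreover have "x \<notin> \<Union>\<C>" using x H_sub by blast
      then have "\<Union>\<C> \<subset> \<Union>(insert C \<D>)" unfolding Union_insert D(2) U_def by blast
      ultimately show False using no_larger by blast
    qed
  qed
  have Lle: "dg L x + dg L (y p) < card L"
  proof -
    have LH: "L = H \<union> (L - H)" "H \<inter> (L - H) = {}" using H_L by auto
    have e: "dg L v = dg H v + dg (L - H) v" for v using dg_Un[OF LH(2), of v] LH(1) by simp
    have z1: "dg H (y p) = 0" using y_H u by (simp add: dg_eq_0)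
    have z2: "dg (L - H) x = 0" unfolding dg_eq_0 L_def using H_closed[OF x] by blast
    have "dg H x < card H" using dg_less_card finL x by blast
    moreover have "dg (L - H) (y p) \<le> card (L - H)" using dg_le_card finL by blast
    moreover have "card L = card H + card (L - H)" using H_L finL by (simp add: card_Diff_subset card_mono)
    ultimately show ?thesis using e[of x] e[of "y p"] z1 z2 by linarith
  qed
  show "dg V x + dg V (y p) < card V"
    by (rule pair_arith_H[OF V_split(1) V_split(1) V_split(2) dC dC cnt _ e(1) xU z Lle]) (use aN in simp)
qed

lemma low_set:
  "\<exists>X\<subseteq>V. card X = card (C \<inter> NH) + 1 \<and> (\<forall>u\<in>X. \<forall>v\<in>X. \<not> E u v) \<and>
    (\<forall>u\<in>X. \<forall>v\<in>X. u \<noteq> v \<longrightarrow> dg V u + dg V v < card V)"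
proof -
  obtain x where x: "x \<in> H" using H_ne by blast
  let ?P = "{p\<in>{0..<0 + N}. up p}"
  have P: "c ` ?P = C \<inter> NH" using c_full[of 0] by (auto simp: up_def c_C)
  have inj: "inj_on c ?P" by (rule inj_on_subset[OF c_inj[of "0 + N" 0]]) auto
  have cP: "card ?P = card (C \<inter> NH)" using card_image[OF inj] P by simp
  have pairs: "\<not> E (y p) (y q) \<and> dg V (y p) + dg V (y q) < card V" if "p \<in> ?P" "q \<in> ?P" "p \<noteq> q" for p q
  proof (cases "p < q")
    case True
    then show ?thesis using pair_sum[of p q] that by auto
  next
    case False
    then have "q < p" using that(3) by simp
    then show ?thesis using pair_sum[of q p] that E_commute by (auto simp: add.commute)
  qed
  have injy: "inj_on y ?P"
  proof (rule inj_onI, rule ccontr)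
    fix p q assume pq: "p \<in> ?P" "q \<in> ?P" "y p = y q" "p \<noteq> q"
    have "c p = c q \<and> l (c p) + 1 = l (c q) + 1"
      by (rule seg_disj) (use pq l_gap' in \<open>auto simp: y_def add.assoc\<close>)
    then show False using inj pq by (auto dest: inj_onD)
  qed
  have yV: "y p \<in> V" for p using y_C cycset_V[OF C_cyc[OF C_in]] by blast
  have xy: "x \<noteq> y p" for p using y_C x C_H by blast
  show ?thesis
  proof (intro exI[of _ "insert x (y ` ?P)"] conjI ballI impI)
    show "insert x (y ` ?P) \<subseteq> V" using yV x H_sub by auto
    have "x \<notin> y ` ?P" using xy by blast
    then show "card (insert x (y ` ?P)) = card (C \<inter> NH) + 1" using card_image[OF injy] cP by simp
  next
    fix u v assume "u \<in> insert x (y ` ?P)" "v \<in> insert x (y ` ?P)"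
    then consider "u = x" "v = x" | p where "u = x" "v = y p" "p \<in> ?P" | p where "v = x" "u = y p" "p \<in> ?P"
      | p q where "u = y p" "v = y q" "p \<in> ?P" "q \<in> ?P" by blast
    note cs = this
    show "\<not> E u v"
      using cs
    proof cases
      case 1
      then show ?thesis using E_irrefl by simp
    next
      case (2 p)
      then show ?thesis using pair_sum_H(1)[OF _ x, of p] by simp
    next
      case (3 p)
      then show ?thesis using pair_sum_H(1)[OF _ x, of p] E_sym by auto
    next
      case (4 p q)
      then show ?thesis using pairs[of p q] E_irrefl by (cases "p = q") auto
    qed
    assume uv: "u \<noteq> v"
    from cs show "dg V u + dg V v < card V"
    proof cases
      case 1
      then show ?thesis using uv by simp
    next
      case (2 p)
      then show ?thesis using pair_sum_H(2)[OF _ x, of p] by simp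
    next
      case (3 p)
      then show ?thesis using pair_sum_H(2)[OF _ x, of p] by simp
    next
      case (4 p q)
      then show ?thesis using pairs[of p q] uv by auto
    qed
  qed
qed

end

section \<open>Cycles with few neighbours of the component\<close>

context max_csys
begin

lemma low_set_exists:
  assumes "C \<in> \<C>" "2 \<le> card (C \<inter> NH)"
  shows "\<exists>X\<subseteq>V. card X = card (C \<inter> NH) + 1 \<and> (\<forall>u\<in>X. \<forall>v\<in>X. \<not> E u v) \<and>
    (\<forall>u\<in>X. \<forall>v\<in>X. u \<noteq> v \<longrightarrow> dg V u + dg V v < card V)"
proof -
  obtain xs where "cyc xs" "set xs = C" using C_cyc[OF assms(1)] by (auto simp: cycset_def)
  then interpret m: max_cycle V E k \<C> H C xs by unfold_locales (use assms in auto)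
  obtain l where "m.good l" "\<And>l'. m.good l' \<Longrightarrow> (\<Sum>v\<in>C \<inter> NH. l' v) \<le> (\<Sum>v\<in>C \<inter> NH. l v)"
    using m.max_good by blast
  then interpret f: max_family V E k \<C> H C xs l by unfold_locales auto
  show ?thesis by (rule f.low_set)
qed


text \<open>Consecutive neighbours of \<open>H\<close> make a gap of length one, but
  \<open>l_gap'\<close> requires an unabsorbed vertex strictly inside every gap.\<close>

lemma not_all_neighbours:
  assumes "C \<in> \<C>" "2 \<le> card (C \<inter> NH)"
  shows "\<not> C \<subseteq> NH"
proof
  assume s: "C \<subseteq> NH"
  obtain xs where "cyc xs" "set xs = C" using C_cyc[OF assms(1)] by (auto simp: cycset_def)
  then interpret m: max_cycle V E k \<C> H C xs by unfold_locales (use assms in auto)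
  obtain l where "m.good l" "\<And>l'. m.good l' \<Longrightarrow> (\<Sum>v\<in>C \<inter> NH. l' v) \<le> (\<Sum>v\<in>C \<inter> NH. l v)"
    using m.max_good by blast
  then interpret f: max_family V E k \<C> H C xs l by unfold_locales auto
  have u: "m.up i" for i using m.c_C s by (auto simp: m.up_def)
  show False using f.l_gap'[OF u[of 0]] m.up_next(5)[OF u[of 0], of 1] u[of "0 + 1"] by simp
qed

lemma NH_neighbours: "{v\<in>V - H. \<exists>a\<in>H. E v a} = NH"
proof
  show "{v\<in>V - H. \<exists>a\<in>H. E v a} \<subseteq> NH"
  proof
    fix v assume "v \<in> {v\<in>V - H. \<exists>a\<in>H. E v a}"
    then obtain a where v: "v \<in> V" "v \<notin> H" "a \<in> H" "E v a" by blast
    have "v \<in> \<Union>\<C>"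
    proof (rule ccontr)
      assume "v \<notin> \<Union>\<C>"
      then show False using H_closed[OF v(3), of v] v E_sym by blast
    qed
    then show "v \<in> NH" using v by (auto simp: NH_def)
  qed
  show "NH \<subseteq> {v\<in>V - H. \<exists>a\<in>H. E v a}"
    using H_sub csys_V[OF sys] unfolding NH_def by blast
qed

lemma card_NH: "card NH \<le> (\<Sum>C\<in>\<C>. card (C \<inter> NH))"
proof -
  have "NH = (\<Union>C\<in>\<C>. C \<inter> NH)" unfolding NH_def by blast
  then have "card NH = card (\<Union>C\<in>\<C>. C \<inter> NH)" by simp
  also have "\<dots> \<le> (\<Sum>C\<in>\<C>. card (C \<inter> NH))" using sys by (intro card_UN_le) (simp add: csys_def)
  finally show ?thesis .
qed

lemma fin_UC: "finite {w\<in>\<Union>\<C>. Q w}"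
  by (rule finite_subset[OF _ csys_fin[OF sys]]) blast

definition nn :: "'a \<Rightarrow> nat" where "nn v = card {w\<in>\<Union>\<C>. w \<noteq> v \<and> \<not> E v w}"

text \<open>The degree of \<open>x\<close> is at most \<open>card H - 1 + card NH\<close>, while
  \<open>y\<close> misses itself, all of \<open>H\<close> and \<open>nn y\<close> vertices on the
  cycles.\<close>

lemma nn_bound:
  assumes "y \<in> \<Union>\<C>" "y \<notin> NH" "x \<in> H" "card V \<le> dg V x + dg V y"
  shows "nn y + 2 \<le> card NH"
proof -
  have finU: "finite (\<Union>\<C>)" using csys_fin[OF sys] .
  have finNH: "finite NH" unfolding NH_def by (rule finite_subset[OF _ finU]) blast
  have yH: "\<not> E y a" if "a \<in> H" for a using assms(1,2) that by (auto simp: NH_def)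
  let ?S = "{w\<in>V. E y w}" and ?T = "{w\<in>\<Union>\<C>. w \<noteq> y \<and> \<not> E y w}"
  have d1: "card (?S \<union> H) = dg V y + card H"
    unfolding dg_def by (rule card_Un_disjoint[OF fin_nb finL(2)]) (use yH in blast)
  have finT: "finite ?T" by (rule finite_subset[OF _ finU]) blast
  have HU: "H \<inter> \<Union>\<C> = {}" using H_sub by blast
  have "?T \<subseteq> \<Union>\<C>" by blast
  then have "H \<inter> ?T = {}" using HU by blast
  moreover have "?S \<inter> ?T = {}" by blast
  ultimately have "(?S \<union> H) \<inter> ?T = {}" by blast
  then have d2: "card (?S \<union> H \<union> ?T) = dg V y + card H + nn y"
    unfolding nn_def d1[symmetric] by (intro card_Un_disjoint finT finite_UnI fin_nb finL(2))
  have "y \<notin> H"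
  proof
    assume "y \<in> H"
    then have "y \<in> V - \<Union>\<C>" by (rule subsetD[OF H_sub])
    then show False using assms(1) by (rule DiffD2)
  qed
  then have "y \<notin> ?S \<union> H \<union> ?T" using E_irrefl[of y] by simp
  then have "card (insert y (?S \<union> H \<union> ?T)) = dg V y + card H + nn y + 1"
    by (subst card_insert_disjoint) (use d2 finT finL(2) in simp_all)
  moreover have "y \<in> V" by (rule subsetD[OF csys_V[OF sys] assms(1)])
  moreover have "?T \<subseteq> V" by (rule order_trans[OF _ csys_V[OF sys]]) blast
  moreover have "H \<subseteq> V" by (rule order_trans[OF H_sub]) (rule Diff_subset)
  ultimately have c: "card (insert y (?S \<union> H \<union> ?T)) = dg V y + card H + nn y + 1" "insert y (?S \<union> H \<union> ?T) \<subseteq> V"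
    by simp_all
  have n: "dg V y + card H + nn y + 1 \<le> card V" using card_mono[OF finV c(2)] unfolding c(1) .
  have "{w\<in>V. E x w} \<subseteq> (H - {x}) \<union> NH"
  proof
    fix w assume w: "w \<in> {w\<in>V. E x w}"
    then have "w \<in> H \<or> w \<in> \<Union>\<C>" using H_closed[OF assms(3), of w] by blast
    moreover have "E w x" "w \<noteq> x" using w E_irrefl[of x] E_sym[of x w] by auto
    ultimately show "w \<in> (H - {x}) \<union> NH" using assms(3) unfolding NH_def by blast
  qed
  then have "dg V x \<le> card ((H - {x}) \<union> NH)" unfolding dg_def using finL(2) finNH by (intro card_mono) auto
  also have "\<dots> \<le> card (H - {x}) + card NH" by (rule card_Un_le)
  also have "card (H - {x}) = card H - 1" using assms(3) finL(2) by simp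
  finally have "dg V x \<le> card H - 1 + card NH" .
  moreover have "1 \<le> card H" using assms(3) finL(2) by (metis card_gt_0_iff empty_iff Suc_leI One_nat_def)
  ultimately show ?thesis using n assms(4) by linarith
qed

text \<open>The \<open>k - 1\<close> cycles always have at least \<open>3 * (k - 1)\<close>
  vertices, and \<open>w\<close> misses at most \<open>k - 2\<close> of them, less than half. Hence
  the vertices of \<open>R\<close> can be inserted one by one.\<close>

lemma insert_many:
  assumes "finite R" "csys (k - 1) \<D>" "2 \<le> k" "R \<inter> \<Union>\<D> = {}" "R \<union> \<Union>\<D> \<subseteq> \<Union>\<C>" "\<And>w. w \<in> R \<Longrightarrow> nn w + 2 \<le> k"
  shows "cov (R \<union> \<Union>\<D>)"
  using assms(1,4-)
proof (induction R rule: finite_induct)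
  case empty
  then show ?case using assms(2) by (auto simp: cov_def)
next
  case (insert w R)
  then have "cov (R \<union> \<Union>\<D>)" by auto
  then obtain \<D>' where D: "csys (k - 1) \<D>'" "\<Union>\<D>' = R \<union> \<Union>\<D>" by (auto simp: cov_def)
  have fin: "finite (\<Union>\<D>')" using csys_fin[OF D(1)] .
  have w: "w \<notin> \<Union>\<D>'" unfolding D(2) using insert by blast
  have "(k - 1) * 3 \<le> (\<Sum>X\<in>\<D>'. card X)"
    using sum_bounded_below[of \<D>' 3 card] D(1) cycset_card by (simp add: csys_def)
  then have big: "(k - 1) * 3 \<le> card (\<Union>\<D>')" using csys_cards[OF D(1)] by simp
  have "{u\<in>\<Union>\<D>'. \<not> E w u} \<subseteq> {u\<in>\<Union>\<C>. u \<noteq> w \<and> \<not> E w u}" using w D(2) insert.prems(2) by blast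
  then have "card {u\<in>\<Union>\<D>'. \<not> E w u} \<le> nn w"
    unfolding nn_def by (rule card_mono[OF fin_UC])
  moreover have "nn w + 2 \<le> k" using insert.prems(3) by simp
  ultimately have "card (\<Union>\<D>') < 2 * dg (\<Union>\<D>') w"
    using dg_non[OF fin, of w] big assms(3) by linarith
  then obtain \<D>'' where "csys (k - 1) \<D>''" "\<Union>\<D>'' = insert w (\<Union>\<D>')"
    using csys_insert_vertex[OF D(1) w] by blast
  then show ?case using D(2) by (auto simp: cov_def)
qed

text \<open>If every cycle has at most one neighbour of \<open>H\<close>, two of the cycles are rebuilt: one of them through \<open>H\<close>.\<close>
lemma rebuild:
  assumes C: "C \<in> \<C>" and D: "D \<in> \<C>" "C \<noteq> D"
    and v: "cyc (v # cs)" "set (v # cs) = C" "C \<inter> NH = {v}"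
    and w: "cyc (w # ds)" "set (w # ds) = D" "w \<in> NH"
    and pq: "{p,q} = {hd cs, last cs}" "p \<noteq> q" "E p w" "E q (hd ds)" "E q (last ds)"
    and nn: "\<And>u. u \<in> C - {v} \<Longrightarrow> nn u + 2 \<le> k"
  shows False
proof -
  have cs: "2 \<le> length cs" "pth cs" "v \<notin> set cs" "E v (hd cs)" "E (last cs) v"
    using v(1) by (auto simp: cyc_pth pth_Cons split: if_splits)
  have ds: "2 \<le> length ds" "pth ds" "w \<notin> set ds"
    using w(1) by (auto simp: cyc_pth pth_Cons split: if_splits)
  have ne: "cs \<noteq> []" "ds \<noteq> []" using cs ds by auto
  have pC: "p \<in> C" "q \<in> C" "p \<noteq> v" "q \<noteq> v" "E v p"
  proof -
    have "hd cs \<in> set cs" "last cs \<in> set cs" using ne by auto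
    moreover have "p \<in> {hd cs, last cs}" "q \<in> {hd cs, last cs}" using pq(1) by blast+
    ultimately show "p \<in> C" "q \<in> C" "p \<noteq> v" "q \<noteq> v" "E v p" using cs(3-5) v(2) E_sym by auto
  qed
  have CD: "C \<inter> D = {}" using sys C D by (auto simp: csys_def disjoint_def)
  have vC: "v \<in> C" "w \<in> D" using v(2) w(2) by auto
  have k2: "2 \<le> k"
  proof -
    have "card {C,D} \<le> card \<C>" using sys C D by (intro card_mono) (auto simp: csys_def)
    then show ?thesis using D(2) sys by (simp add: csys_def)
  qed
  obtain a where a: "a \<in> H" "E v a" using v(3) by (auto simp: NH_def)
  obtain b where b: "b \<in> H" "E w b" using w(3) by (auto simp: NH_def)
  obtain h where h: "pth h" "h \<noteq> []" "set h \<subseteq> H" "E v (hd h)" "E (last h) w"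
    using H_path[OF a(1,2) b(1) E_sym[OF b(2)]] by blast
  have hC: "set h \<inter> \<Union>\<C> = {}" using h(3) H_sub by blast
  \<comment> \<open>\<open>q\<close> takes the place of \<open>w\<close> on the second cycle and so
    frees \<open>w\<close> for the cycle through \<open>H\<close>.\<close>
  have Z: "cycset (insert q (set ds))"
  proof -
    have "q \<notin> set ds" using pC(2) w(2) CD by auto
    then have "cycset (set (q # ds))" using ds ne pq(4,5) E_sym by (intro cycsetI) (auto simp: pth_Cons)
    then show ?thesis by simp
  qed
  let ?D1 = "\<C> - {C}"
  have s1: "csys (k - 1) ?D1" using csys_remove[of "k - 1" \<C> C] sys C k2 by simp
  have u1: "\<Union>?D1 = \<Union>\<C> - C" using csys_Diff[OF sys C] .
  have D1: "D \<in> ?D1" using D by simp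
  have i: "insert q (set ds) \<inter> (\<Union>?D1 - D) = {}" unfolding u1 using pC(2) w(2) by auto
  note r = csys_replace(1,2)[OF s1 D1 Z i]
  let ?D2 = "insert (insert q (set ds)) (?D1 - {D})"
  let ?R = "C - {v,p,q}"
  have u2: "\<Union>?D2 = insert q (set ds) \<union> (\<Union>\<C> - C - D)" unfolding r(2) u1 ..
  have "cov (?R \<union> \<Union>?D2)"
  proof (rule insert_many[OF _ r(1) k2])
    show "finite ?R" using C_fin[OF C] by simp
    show "?R \<inter> \<Union>?D2 = {}" unfolding u2 using CD w(2) by auto
    show "?R \<union> \<Union>?D2 \<subseteq> \<Union>\<C>" unfolding u2 using pC(2) C D w(2) by auto
  qed (use nn in blast)
  moreover have "?R \<union> \<Union>?D2 = \<Union>\<C> - {v,p,w}"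
  proof -
    have dw: "set ds = D - {w}" using w(2) ds(3) by auto
    have eq: "C - {v,p,q} \<union> (insert q (D - {w}) \<union> (M - C - D)) = M - {v,p,w}" if "C \<subseteq> M" "D \<subseteq> M" for M
      using that pC(1-4) pq(2) vC CD by auto
    show ?thesis unfolding u2 unfolding dw by (rule eq[OF Union_upper[OF C] Union_upper[OF D(1)]])
  qed
  ultimately have cv: "cov (\<Union>\<C> - {v,p,w})" by simp
  \<comment> \<open>From \<open>v\<close> through \<open>H\<close> to \<open>w\<close>, and back
    over \<open>p\<close>, a neighbour of \<open>v\<close> on its own cycle.\<close>
  let ?z = "v # h @ [w,p]"
  have wp: "w \<noteq> p" "v \<noteq> w" using vC pC CD by auto
  have hn: "v \<notin> set h" "w \<notin> set h" "p \<notin> set h" using hC C D(1) vC pC(1) by blast+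
  have zc: "cycset (set ?z)"
  proof (rule cycsetI)
    show "pth ?z" using h hn wp pC pq(3) E_sym by (auto simp: pth_Cons pth_append)
    show "3 \<le> length ?z" by simp
    show "E (last ?z) (hd ?z)" using pC(5) E_sym by simp
  qed
  have hh: "hd h \<in> set h" using h(2) by simp
  show False
  proof (rule cov_cyc[OF cv _ zc, of "hd h"])
    show "0 < k" using k2 by simp
    show "set ?z \<inter> (\<Union>\<C> - {v,p,w}) = {}" using hC by auto
    show "hd h \<in> set ?z" "hd h \<notin> \<Union>\<C>" using hh hC by auto
  qed auto
qed

text \<open>\<open>?T\<close> consists of the cycles that contain a neighbour of \<open>H\<close>,
  one each, so \<open>card NH \<le> card ?T\<close>. Ore's condition and \<open>nn_bound\<close>
  then let every other cycle vertex miss at most \<open>card ?T - 2\<close> vertices of the system,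
  and two of the cycles in \<open>?T\<close> can be rebuilt.\<close>

lemma no_sparse:
  assumes sigma2: "\<And>u v. u \<in> V \<Longrightarrow> v \<in> V \<Longrightarrow> u \<noteq> v \<Longrightarrow> \<not> E u v \<Longrightarrow> card V \<le> dg V u + dg V v"
    and one: "\<And>C. C \<in> \<C> \<Longrightarrow> card (C \<inter> NH) \<le> 1" and k: "0 < k"
  shows False
proof -
  obtain x where x: "x \<in> H" using H_ne by blast
  have finC: "finite \<C>" "card \<C> = k" using sys by (auto simp: csys_def)
  have nnb: "nn y + 2 \<le> card NH" if "y \<in> \<Union>\<C>" "y \<notin> NH" for y
  proof (rule nn_bound[OF that x])
    have "\<not> E y x" using that x unfolding NH_def by blast
    then have nE: "\<not> E x y" using E_sym by blast
    have xV: "x \<in> V - \<Union>\<C>" by (rule subsetD[OF H_sub x])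
    have yV: "y \<in> V" by (rule subsetD[OF csys_V[OF sys] that(1)])
    have "x \<noteq> y" using xV that(1) by auto
    then show "card V \<le> dg V x + dg V y" using sigma2[OF DiffD1[OF xV] yV _ nE] by simp
  qed
  let ?T = "{C\<in>\<C>. C \<inter> NH \<noteq> {}}"
  have "card NH \<le> (\<Sum>C\<in>\<C>. if C \<in> ?T then 1 else 0)"
    by (rule order_trans[OF card_NH]) (intro sum_mono, use one in auto)
  also have "\<dots> = (\<Sum>C\<in>?T. 1)" using finC(1) by (intro sum.mono_neutral_cong_right) auto
  also have "\<dots> = card ?T" by simp
  finally have rT: "card NH \<le> card ?T" .
  have Tk: "card ?T \<le> k" using card_mono[of \<C> ?T] finC by simp
  have ex: "\<exists>y\<in>C. y \<notin> NH" if "C \<in> \<C>" for C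
  proof (rule ccontr)
    assume "\<not> ?thesis"
    then have "C \<inter> NH = C" by blast
    then show False using one[OF that] cycset_card[OF C_cyc[OF that]] by simp
  qed
  obtain C0 where "C0 \<in> \<C>" using finC k by fastforce
  then obtain y0 where "y0 \<in> C0" "y0 \<notin> NH" "y0 \<in> \<Union>\<C>" using ex[of C0] by blast
  then have "2 \<le> card NH" using nnb[of y0] by simp
  then have "card ?T \<noteq> 0" using rT by linarith
  then have "?T \<noteq> {}" by (metis card.empty)
  then obtain C where C: "C \<in> \<C>" "C \<inter> NH \<noteq> {}" by blast
  obtain v where v: "v \<in> C \<inter> NH" using C(2) by blast
  have vu: "C \<inter> NH = {v}"
  proof -
    have "finite (C \<inter> NH)" using C_fin[OF C(1)] by simp
    then show ?thesis using one[OF C(1)] v by (metis card_le_Suc0_iff_eq One_nat_def is_singletonI' is_singleton_def singletonD empty_iff)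
  qed
  obtain cs where cs: "cyc (v # cs)" "set (v # cs) = C" using cyc_startE[OF C_cyc[OF C(1)]] v by blast
  have l: "2 \<le> length cs" "distinct (v # cs)" using cs(1) by (auto simp: cyc_def)
  define a s where "a = hd cs" and "s = last cs"
  have as: "a \<noteq> s" "a \<in> C" "s \<in> C" "a \<noteq> v" "s \<noteq> v"
  proof -
    have ne: "cs \<noteq> []" using l by auto
    then have "a \<in> set cs" "s \<in> set cs" by (auto simp: a_def s_def)
    then show "a \<in> C" "s \<in> C" "a \<noteq> v" "s \<noteq> v" using cs(2) l(2) by auto
    show "a \<noteq> s" using l ne by (cases cs) (auto simp: a_def s_def split: if_splits)
  qed
  have asN: "a \<notin> NH" "s \<notin> NH" using as vu by blast+
  have sT: "csys (card (?T - {C})) (?T - {C})"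
    using sys by (auto simp: csys_def disjoint_def)
  define nd where "nd D u = card {w\<in>D. \<not> E u w}" for D u
  have sum_nd: "(\<Sum>D\<in>?T - {C}. nd D u) \<le> nn u" if "u \<in> C" for u
  proof -
    have "(\<Sum>D\<in>?T - {C}. dg D u) + (\<Sum>D\<in>?T - {C}. nd D u) = (\<Sum>D\<in>?T - {C}. card D)"
      unfolding sum.distrib[symmetric] nd_def by (intro sum.cong) (use dg_non C_fin in auto)
    also have "\<dots> = dg (\<Union>(?T - {C})) u + card {w\<in>\<Union>(?T - {C}). \<not> E u w}"
      using csys_cards[OF sT] dg_non[OF csys_fin[OF sT], of u] by simp
    finally have "(\<Sum>D\<in>?T - {C}. nd D u) = card {w\<in>\<Union>(?T - {C}). \<not> E u w}"
      using dg_csys[OF sT, of u] by simp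
    also have "\<dots> \<le> nn u"
    proof -
      have "u \<notin> D" if "D \<in> ?T - {C}" for D
        using \<open>u \<in> C\<close> that C(1) sys by (auto simp: csys_def disjoint_def)
      then show ?thesis
        unfolding nn_def by (intro card_mono fin_UC) auto
    qed
    finally show ?thesis .
  qed
  \<comment> \<open>\<open>a\<close> and \<open>s\<close>, the neighbours of \<open>v\<close> on
    \<open>C\<close>, miss at most \<open>2 * card ?T - 4\<close> vertices together, fewer than two
    for each of the \<open>card ?T - 1\<close> other cycles.\<close>
  have "\<exists>D\<in>?T - {C}. nd D a + nd D s \<le> 1"
  proof (rule ccontr)
    assume "\<not> ?thesis"
    then have "(\<Sum>D\<in>?T - {C}. 2) \<le> (\<Sum>D\<in>?T - {C}. nd D a + nd D s)" by (intro sum_mono) force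
    also have "\<dots> \<le> nn a + nn s" unfolding sum.distrib using sum_nd as by (intro add_mono) auto
    finally have "2 * card (?T - {C}) \<le> nn a + nn s" by simp
    moreover have "card (?T - {C}) = card ?T - 1" using C finC by simp
    moreover have "nn a + 2 \<le> card ?T" "nn s + 2 \<le> card ?T" 
      using order_trans[OF nnb[of a] rT] order_trans[OF nnb[of s] rT] as(2,3) asN UnionI[OF C(1)] by blast+
    ultimately show False by linarith
  qed
  then obtain D where D: "D \<in> \<C>" "D \<inter> NH \<noteq> {}" "D \<noteq> C" "nd D a + nd D s \<le> 1" by blast
  obtain w where w: "w \<in> D" "w \<in> NH" using D(2) by blast
  obtain ds where ds: "cyc (w # ds)" "set (w # ds) = D" using cyc_startE[OF C_cyc[OF D(1)] w(1)] by blast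
  have dl: "2 \<le> length ds" "distinct (w # ds)" using ds(1) by (auto simp: cyc_def)
  have dne: "ds \<noteq> []" using dl by auto
  have dd: "hd ds \<in> D" "last ds \<in> D" "hd ds \<noteq> w" "last ds \<noteq> w" using ds(2) dl dne by auto
  have full: "\<forall>z\<in>D. E u z" if "nd D u = 0" for u
    using that C_fin[OF D(1)] by (auto simp: nd_def)
  have almost: "z = z'" if "nd D u \<le> 1" "z \<in> D" "z' \<in> D" "\<not> E u z" "\<not> E u z'" for u z z'
  proof -
    have "finite {w\<in>D. \<not> E u w}" using C_fin[OF D(1)] by simp
    then show ?thesis using that card_le_Suc0_iff_eq[of "{w\<in>D. \<not> E u w}"] by (auto simp: nd_def)
  qed
  \<comment> \<open>If \<open>q\<close> misses \<open>w\<close>, it misses nothing else on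
    \<open>D\<close> and can replace \<open>w\<close> there; otherwise \<open>q\<close> leads back
    from \<open>w\<close>, and \<open>p\<close>, which misses nothing, replaces it.\<close>
  have key: "(E p w \<and> E q (hd ds) \<and> E q (last ds)) \<or> (E q w \<and> E p (hd ds) \<and> E p (last ds))"
    if "nd D p = 0" "nd D q \<le> 1" for p q
  proof (cases "E q w")
    case True
    then show ?thesis using full[OF that(1)] dd by blast
  next
    case False
    then have "E q (hd ds)" "E q (last ds)" using almost[OF that(2) w(1)] dd by blast+
    then show ?thesis using full[OF that(1)] w(1) by blast
  qed
  have "nd D a = 0 \<and> nd D s \<le> 1 \<or> nd D s = 0 \<and> nd D a \<le> 1" using D(4) by linarith
  then have alt: "(E a w \<and> E s (hd ds) \<and> E s (last ds)) \<or> (E s w \<and> E a (hd ds) \<and> E a (last ds))"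
    using key by blast
  have nnC: "nn u + 2 \<le> k" if "u \<in> C - {v}" for u
  proof -
    have "u \<in> \<Union>\<C>" "u \<notin> NH" using that vu UnionI[OF C(1), of u] by auto
    then show ?thesis using nnb[of u] rT Tk by linarith
  qed
  from alt show False
  proof
    assume "E a w \<and> E s (hd ds) \<and> E s (last ds)"
    then show False using rebuild[OF C(1) D(1) D(3)[symmetric] cs vu ds w(2), of a s] as(1) nnC
      by (simp add: a_def s_def)
  next
    assume "E s w \<and> E a (hd ds) \<and> E a (last ds)"
    then show False using rebuild[OF C(1) D(1) D(3)[symmetric] cs vu ds w(2), of s a] as(1) nnC
      by (simp add: a_def s_def insert_commute)
  qed
qed

end

section \<open>Spanning systems\<close>

context fin_sgraph
begin

lemma rtrancl_path:
  assumes "(a, b) \<in> {(u,v). u \<in> S \<and> v \<in> S \<and> E u v}\<^sup>*"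
  shows "\<exists>h. pth h \<and> h \<noteq> [] \<and> set h \<subseteq> {w. (a, w) \<in> {(u,v). u \<in> S \<and> v \<in> S \<and> E u v}\<^sup>*} \<and> hd h = a \<and> last h = b"
  using assms
proof (induction rule: rtrancl_induct)
  case base
  show ?case by (rule exI[of _ "[a]"]) simp
next
  case (step b c)
  let ?R = "{(u,v). u \<in> S \<and> v \<in> S \<and> E u v}"
  obtain h where h: "pth h" "h \<noteq> []" "set h \<subseteq> {w. (a, w) \<in> ?R\<^sup>*}" "hd h = a" "last h = b" using step by blast
  have ac: "(a, c) \<in> ?R\<^sup>*" by (rule rtrancl_into_rtrancl[OF step(1,2)])
  show ?case
  proof (cases "c \<in> set h")
    case True
    then obtain xs ys where xy: "h = xs @ c # ys" using split_list by metis
    then have "pth (xs @ [c])" using h(1) by (auto simp: pth_append pth_Cons)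
    moreover have "hd (xs @ [c]) = a" using h(4) xy by (cases xs) auto
    moreover have "set (xs @ [c]) \<subseteq> {w. (a, w) \<in> ?R\<^sup>*}" using h(3) xy by auto
    ultimately show ?thesis by (intro exI[of _ "xs @ [c]"]) simp
  next
    case False
    have "E b c" using step(2) by simp
    then have "pth (h @ [c])" using h False by (simp add: pth_append)
    then show ?thesis using h ac by (intro exI[of _ "h @ [c]"]) simp
  qed
qed

theorem spanning_cycles:
  assumes ex: "csys k \<C>0" and k: "0 < k" and t: "1 \<le> t" "k * (t - 1) < m"
    and conn: "\<And>A. A \<subseteq> V \<Longrightarrow> A \<noteq> {} \<Longrightarrow> V - A - {v\<in>V - A. \<exists>a\<in>A. E v a} \<noteq> {} \<Longrightarrow> m \<le> card {v\<in>V - A. \<exists>a\<in>A. E v a}"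
    and deg: "\<And>X. X \<subseteq> V \<Longrightarrow> card X = t + 1 \<Longrightarrow> (\<forall>u\<in>X. \<forall>v\<in>X. \<not> E u v) \<Longrightarrow>
      \<exists>u\<in>X. \<exists>v\<in>X. u \<noteq> v \<and> card V \<le> dg V u + dg V v"
  shows "\<exists>\<C>. csys k \<C> \<and> \<Union>\<C> = V"
proof -
  have "\<forall>\<D>. csys k \<D> \<longrightarrow> card (\<Union>\<D>) < card V + 1"
    using csys_V card_mono[OF finV] by (simp add: le_imp_less_Suc)
  then obtain \<C> where C: "csys k \<C>" "\<And>\<D>. csys k \<D> \<Longrightarrow> card (\<Union>\<D>) \<le> card (\<Union>\<C>)"
    using ex_has_greatest_nat[of "csys k" \<C>0 "\<lambda>\<C>. card (\<Union>\<C>)" "card V + 1"] ex by blast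
  have "\<Union>\<C> = V"
  proof (rule ccontr)
    assume "\<Union>\<C> \<noteq> V"
    then have "V - \<Union>\<C> \<noteq> {}" using csys_V[OF C(1)] by simp
    then obtain x where x: "x \<in> V - \<Union>\<C>" by blast
    define S where "S = V - \<Union>\<C>"
    let ?R = "{(u,v). u \<in> S \<and> v \<in> S \<and> E u v}"
    define H where "H = {w. (x, w) \<in> ?R\<^sup>*}"
    have symR: "sym (?R\<^sup>*)" by (rule sym_rtrancl) (simp add: sym_def E_commute)
    have HS: "H \<subseteq> S"
    proof
      fix w assume "w \<in> H"
      then have "(x, w) \<in> ?R\<^sup>*" by (simp add: H_def)
      then show "w \<in> S" by (cases rule: rtranclE) (use x in \<open>auto simp: S_def\<close>)
    qed
    have "max_csys V E k \<C> H"
    proof unfold_locales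
      show "H \<subseteq> V - \<Union>\<C>" using HS by (simp add: S_def)
      show "H \<noteq> {}" by (auto simp: H_def)
      fix a b
      { assume ab: "a \<in> H" "b \<in> H"
        have ax: "(a, x) \<in> ?R\<^sup>*" using ab(1) symD[OF symR, of x a] by (simp add: H_def)
        have "(x, b) \<in> ?R\<^sup>*" using ab(2) by (simp add: H_def)
        with ax have abR: "(a, b) \<in> ?R\<^sup>*" by (rule rtrancl_trans)
        have xa: "(x, a) \<in> ?R\<^sup>*" using ab(1) by (simp add: H_def)
        have sub: "{w. (a, w) \<in> ?R\<^sup>*} \<subseteq> H"
          unfolding H_def using rtrancl_trans[OF xa] by (intro subsetI) simp
        obtain h where "pth h" "h \<noteq> []" "set h \<subseteq> {w. (a, w) \<in> ?R\<^sup>*}" "hd h = a" "last h = b"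
          using rtrancl_path[OF abR] by auto
        then show "\<exists>h. pth h \<and> h \<noteq> [] \<and> set h \<subseteq> H \<and> hd h = a \<and> last h = b"
          using sub by (intro exI[of _ h]) (simp add: order_trans) }
      { fix w assume aw: "a \<in> H" "w \<in> V - \<Union>\<C> - H"
        show "\<not> E a w"
        proof
          assume "E a w"
          moreover have "a \<in> S" using aw(1) HS by blast
          moreover have "w \<in> S" using aw(2) by (simp add: S_def)
          ultimately have "(a, w) \<in> ?R" by simp
          moreover have "(x, a) \<in> ?R\<^sup>*" using aw(1) by (simp add: H_def)
          ultimately have "(x, w) \<in> ?R\<^sup>*" by (rule rtrancl_into_rtrancl[rotated])
          then show False using aw(2) by (simp add: H_def)
        qed }
      show "csys k \<C>" by (rule C(1))
      show "card (\<Union>\<D>) \<le> card (\<Union>\<C>)" if "csys k \<D>" for \<D> by (rule C(2)[OF that])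
    qed
    then interpret m: max_csys V E k \<C> H .
    \<comment> \<open>The maximum reflects the two requirements: \<open>low_set_exists\<close>
      applies from two neighbours on, and \<open>t\<close> of them give the \<open>t + 1\<close>
      independent vertices that contradict \<open>deg\<close>.\<close>
    have small: "card (D \<inter> m.NH) < max 2 t" if D: "D \<in> \<C>" for D
    proof (rule ccontr)
      assume "\<not> ?thesis"
      then have b: "2 \<le> card (D \<inter> m.NH)" "t \<le> card (D \<inter> m.NH)" by auto
      obtain X where X: "X \<subseteq> V" "card X = card (D \<inter> m.NH) + 1" "\<forall>u\<in>X. \<forall>v\<in>X. \<not> E u v"
        "\<forall>u\<in>X. \<forall>v\<in>X. u \<noteq> v \<longrightarrow> dg V u + dg V v < card V" using m.low_set_exists[OF D b(1)] by blast
      have "t + 1 \<le> card X" using X(2) b(2) by simp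
      then obtain Y where Y: "Y \<subseteq> X" "card Y = t + 1" using obtain_subset_with_card_n by metis
      have YV: "Y \<subseteq> V" and Yi: "\<forall>u\<in>Y. \<forall>v\<in>Y. \<not> E u v" using X(1,3) Y(1) by blast+
      obtain u v where uv: "u \<in> Y" "v \<in> Y" "u \<noteq> v" "card V \<le> dg V u + dg V v"
        using deg[OF YV Y(2) Yi] by blast
      then have "dg V u + dg V v < card V" using X(4) subsetD[OF Y(1)] by simp
      then show False using uv(4) by simp
    qed
    have finC: "finite \<C>" "card \<C> = k" using C(1) by (auto simp: csys_def)
    show False
    proof (cases "t = 1")
      case True
      show False
      proof (rule m.no_sparse[OF _ _ k])
        show "card V \<le> dg V u + dg V v" if uv: "u \<in> V" "v \<in> V" "u \<noteq> v" "\<not> E u v" for u v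
        proof -
          have i: "\<forall>a\<in>{u,v}. \<forall>b\<in>{u,v}. \<not> E a b" using uv(4) E_commute[of v u] E_irrefl[of u] E_irrefl[of v] by simp
          have c: "card {u,v} = t + 1" and sub: "{u,v} \<subseteq> V" using uv True by auto
          obtain a b where "a \<in> {u,v}" "b \<in> {u,v}" "a \<noteq> b" "card V \<le> dg V a + dg V b"
            using deg[OF sub c i] by blast
          then show ?thesis by (auto simp: add.commute)
        qed
        show "card (D \<inter> m.NH) \<le> 1" if "D \<in> \<C>" for D using small[OF that] True by simp
      qed
    next
      case False
      then have t2: "2 \<le> t" using t by simp
      then have le: "card (D \<inter> m.NH) \<le> t - 1" if "D \<in> \<C>" for D using small[OF that] by simp
      have "card m.NH \<le> (\<Sum>D\<in>\<C>. card (D \<inter> m.NH))" by (rule m.card_NH)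
      also have "\<dots> \<le> k * (t - 1)" using sum_bounded_above[of \<C> "\<lambda>D. card (D \<inter> m.NH)" "t - 1"] le finC by simp
      finally have lt: "card m.NH < m" using t(2) by simp
      have HV: "H \<subseteq> V" using HS by (auto simp: S_def)
      \<comment> \<open>Fewer than \<open>m\<close> neighbours cannot separate \<open>H\<close> from
        another vertex. So every vertex on the cycles is a neighbour of \<open>H\<close>, which
        \<open>not_all_neighbours\<close> excludes.\<close>
      have e: "V - H - m.NH = {}"
      proof (rule ccontr)
        assume "V - H - m.NH \<noteq> {}"
        then have "m \<le> card m.NH" using conn[OF HV m.H_ne, unfolded m.NH_neighbours] by simp
        then show False using lt by simp
      qed
      have cov: "\<Union>\<C> \<subseteq> m.NH"
      proof
        fix w assume w: "w \<in> \<Union>\<C>"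
        then have "w \<in> V" by (rule subsetD[OF csys_V[OF C(1)]])
        moreover have "w \<notin> H" using w subsetD[OF m.H_sub, of w] by auto
        ultimately show "w \<in> m.NH" using e by blast
      qed
      obtain D where D: "D \<in> \<C>" using finC k by fastforce
      then have sub: "D \<subseteq> m.NH" using cov by blast
      then have "D \<inter> m.NH = D" by blast
      then have "2 \<le> card (D \<inter> m.NH)" using cycset_card[OF m.C_cyc[OF D]] by simp
      then show False using m.not_all_neighbours[OF D] sub by blast
    qed
  qed
  then show ?thesis using C(1) by blast
qed


text \<open>The bounds for \<open>disjoint_cycles\<close> come from the pair condition alone if
  \<open>t = 1\<close>, and from a minimum degree of at least \<open>2 * k + 1\<close> alone if
  \<open>t \<ge> 3\<close>. For \<open>t = 2\<close> the minimum degree \<open>k + 1\<close> gives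
  the pair bound, and both together give the triple bound.\<close>

theorem spanning_cycles_of_connectivity:
  assumes k: "1 \<le> k" and order: "5 * k \<le> card V + 2" and t: "1 \<le> t" "k * (t - 1) < m"
    and conn: "\<And>A. A \<subseteq> V \<Longrightarrow> A \<noteq> {} \<Longrightarrow> V - A - {v\<in>V - A. \<exists>a\<in>A. E v a} \<noteq> {} \<Longrightarrow>
      m \<le> card {v\<in>V - A. \<exists>a\<in>A. E v a}"
    and min_deg: "\<And>v. v \<in> V \<Longrightarrow> m \<le> dg V v"
    and deg: "\<And>X. X \<subseteq> V \<Longrightarrow> card X = t + 1 \<Longrightarrow> (\<forall>u\<in>X. \<forall>v\<in>X. \<not> E u v) \<Longrightarrow>
      \<exists>u\<in>X. \<exists>v\<in>X. u \<noteq> v \<and> card V \<le> dg V u + dg V v"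
  shows "\<exists>\<C>. csys k \<C> \<and> \<Union>\<C> = V"
proof -
  consider (1) "t = 1" | (2) "t = 2" | (3) "3 \<le> t" using t(1) by linarith
  then have "(\<forall>a b. a \<in> V \<longrightarrow> b \<in> V \<longrightarrow> a \<noteq> b \<longrightarrow> \<not> E a b \<longrightarrow>
        2 * k + 1 \<le> dg V a + dg V b \<and> (1 < k \<longrightarrow> 2 * k + 2 \<le> dg V a + dg V b)) \<and>
      (\<forall>a b c. a \<in> V \<longrightarrow> b \<in> V \<longrightarrow> c \<in> V \<longrightarrow> a \<noteq> b \<longrightarrow> b \<noteq> c \<longrightarrow> a \<noteq> c \<longrightarrow>
        \<not> E a b \<longrightarrow> \<not> E b c \<longrightarrow> \<not> E a c \<longrightarrow> 6 * k \<le> dg V a + dg V b + dg V c + 1)"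
  proof cases
    case 1
    have p: "card V \<le> dg V a + dg V b" if h: "a \<in> V" "b \<in> V" "a \<noteq> b" "\<not> E a b" for a b
    proof -
      have "\<not> E b a" using h(4) E_sym[of b a] by blast
      then have "\<forall>u\<in>{a, b}. \<forall>v\<in>{a, b}. \<not> E u v" using h(4) E_irrefl by simp
      moreover have "card {a, b} = t + 1" using h(3) 1 by simp
      ultimately obtain u v where "u \<in> {a, b}" "v \<in> {a, b}" "u \<noteq> v" "card V \<le> dg V u + dg V v"
        using deg[of "{a, b}"] h(1,2) by blast
      then show ?thesis by (auto simp: add.commute)
    qed
    show ?thesis
    proof (intro conjI allI impI)
      fix a b assume "a \<in> V" "b \<in> V" "a \<noteq> b" "\<not> E a b"
      then show "2 * k + 1 \<le> dg V a + dg V b" "1 < k \<Longrightarrow> 2 * k + 2 \<le> dg V a + dg V b"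
        using p[of a b] order k by linarith+
    next
      fix a b c assume v: "a \<in> V" "b \<in> V" "c \<in> V" "a \<noteq> b" "b \<noteq> c" "a \<noteq> c" "\<not> E a b" "\<not> E b c" "\<not> E a c"
      have "3 * card V \<le> 2 * (dg V a + dg V b + dg V c)"
        using p[of a b] p[of b c] p[of a c] v by (simp add: algebra_simps)
      moreover have "card V \<ge> 3" using order k by linarith
      moreover have "6 * k \<le> s + 1" if "3 * n \<le> 2 * s" "3 \<le> n" "5 * k \<le> n + 2" for n s :: nat
        using that k by presburger
      ultimately show "6 * k \<le> dg V a + dg V b + dg V c + 1" using order by blast
    qed
  next
    case 2
    have d: "k + 1 \<le> dg V v" if "v \<in> V" for v using min_deg[OF that] t(2) 2 by simp
    show ?thesis
    proof (intro conjI allI impI)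
      fix a b assume "a \<in> V" "b \<in> V" "a \<noteq> b" "\<not> E a b"
      then show "2 * k + 1 \<le> dg V a + dg V b" "1 < k \<Longrightarrow> 2 * k + 2 \<le> dg V a + dg V b"
        using d[of a] d[of b] by linarith+
    next
      fix a b c assume v: "a \<in> V" "b \<in> V" "c \<in> V" "a \<noteq> b" "b \<noteq> c" "a \<noteq> c" "\<not> E a b" "\<not> E b c" "\<not> E a c"
      have "\<not> E b a" "\<not> E c b" "\<not> E c a" using v(7-9) E_sym[of b a] E_sym[of c b] E_sym[of c a] by blast+
      then have "\<forall>u\<in>{a, b, c}. \<forall>v\<in>{a, b, c}. \<not> E u v" using v(7-9) E_irrefl by simp
      moreover have "card {a, b, c} = t + 1" using v(4-6) 2 by simp
      ultimately obtain u w where u: "u \<in> {a, b, c}" "w \<in> {a, b, c}" "u \<noteq> w" "card V \<le> dg V u + dg V w"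
        using deg[of "{a, b, c}"] v(1-3) by blast
      \<comment> \<open>With \<open>5 * k - 2\<close> for the order this is exactly
        \<open>6 * k - 1\<close>.\<close>
      then have "card V + (k + 1) \<le> dg V a + dg V b + dg V c"
        using d[OF v(1)] d[OF v(2)] d[OF v(3)] by auto
      then show "6 * k \<le> dg V a + dg V b + dg V c + 1" using order by linarith
    qed
  next
    case 3
    have "k * 2 \<le> k * (t - 1)" using 3 by (intro mult_le_mono2) simp
    then have d: "2 * k + 1 \<le> dg V v" if "v \<in> V" for v using min_deg[OF that] t(2) by linarith
    show ?thesis
    proof (intro conjI allI impI)
      fix a b assume "a \<in> V" "b \<in> V" "a \<noteq> b" "\<not> E a b"
      then show "2 * k + 1 \<le> dg V a + dg V b" "1 < k \<Longrightarrow> 2 * k + 2 \<le> dg V a + dg V b"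
        using d[of a] d[of b] by linarith+
    next
      fix a b c assume "a \<in> V" "b \<in> V" "c \<in> V"
      then show "6 * k \<le> dg V a + dg V b + dg V c + 1" using d[of a] d[of b] d[of c] by linarith
    qed
  qed
  note s = this
  have "\<exists>\<C>. csys k \<C>" by (rule disjoint_cycles[OF order]) (use s in blast)+
  then obtain \<C>0 where "csys k \<C>0" by blast
  then show ?thesis by (rule spanning_cycles[OF _ _ t conn deg]) (use k in auto)
qed

end

section \<open>Graphs as symmetric digraphs\<close>

context graph
begin

lemma fin_sgraph: "fin_sgraph (verts G) (\<lambda>u v. u \<rightarrow>\<^bsub>G\<^esub> v)"
proof
  show "u \<rightarrow>\<^bsub>G\<^esub> v \<Longrightarrow> v \<rightarrow>\<^bsub>G\<^esub> u" for u v by (rule graph_symmetric)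
  show "\<not> u \<rightarrow>\<^bsub>G\<^esub> u" for u using adj_not_same by blast
  show "u \<rightarrow>\<^bsub>G\<^esub> v \<Longrightarrow> u \<in> verts G" for u v by (auto simp: arcs_ends_conv)
qed simp

sublocale s: fin_sgraph "verts G" "\<lambda>u v. u \<rightarrow>\<^bsub>G\<^esub> v"
  by (rule fin_sgraph)

lemma out_degree_eq_dg: "out_degree G x = s.dg (verts G) x"
proof -
  have "head G ` out_arcs G x = {w\<in>verts G. x \<rightarrow>\<^bsub>G\<^esub> w}" by (auto simp: arcs_ends_conv out_arcs_def)
  moreover have "inj_on (head G) (out_arcs G x)"
    by (rule inj_onI) (auto simp: arc_to_ends_def intro: no_multi_arcs)
  ultimately show ?thesis unfolding out_degree_def s.dg_def using card_image by fastforce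
qed

lemma independent_card_le: "independent_set G X \<Longrightarrow> card X \<le> independence_number G"
proof -
  assume X: "independent_set G X"
  have "{card X | X. independent_set G X} \<subseteq> card ` Pow (verts G)" by (auto simp: independent_set_def)
  then have "finite {card X | X. independent_set G X}" by (rule finite_subset) simp
  then show ?thesis unfolding independence_number_def using X by (intro Max_ge) auto
qed

lemma sigma_le:
  assumes X: "independent_set G X"
  shows "sigma (card X) G \<le> enat (\<Sum>x\<in>X. s.dg (verts G) x)"
proof -
  have "{\<Sum>x\<in>Y. out_degree G x | Y. independent_set G Y \<and> card Y = card X} \<subseteq> (\<lambda>Y. \<Sum>x\<in>Y. out_degree G x) ` Pow (verts G)"
    by (auto simp: independent_set_def)
  then have "finite {\<Sum>x\<in>Y. out_degree G x | Y. independent_set G Y \<and> card Y = card X}" by (rule finite_subset) simp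
  then have "Min {\<Sum>x\<in>Y. out_degree G x | Y. independent_set G Y \<and> card Y = card X} \<le> (\<Sum>x\<in>X. out_degree G x)"
    using X by (intro Min_le) auto
  then show ?thesis using independent_card_le[OF X] by (simp add: sigma_def out_degree_eq_dg)
qed

lemma vertex_connectivity_le_cut:
  assumes "vertex_cut G S" "\<not> complete_digraph (card (verts G)) G"
  shows "vertex_connectivity G \<le> card S"
proof -
  have "{card S | S. vertex_cut G S} \<subseteq> card ` Pow (verts G)" by (auto simp: vertex_cut_def)
  then have "finite {card S | S. vertex_cut G S}" by (rule finite_subset) simp
  then show ?thesis using assms by (auto simp: vertex_connectivity_def intro: Min_le)
qed

text \<open>Removing the boundary of \<open>A\<close> separates \<open>A\<close> from the vertices
  beyond it, so the boundary is a vertex cut; the missing edges between the two sides also rule out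
  the complete case of the definition.\<close>

lemma vertex_connectivity_le_boundary:
  assumes A: "A \<subseteq> verts G" "A \<noteq> {}"
    and B: "verts G - A - {v\<in>verts G - A. \<exists>a\<in>A. v \<rightarrow>\<^bsub>G\<^esub> a} \<noteq> {}"
  shows "vertex_connectivity G \<le> card {v\<in>verts G - A. \<exists>a\<in>A. v \<rightarrow>\<^bsub>G\<^esub> a}"
proof -
  define S where "S = {v\<in>verts G - A. \<exists>a\<in>A. v \<rightarrow>\<^bsub>G\<^esub> a}"
  obtain a b where ab: "a \<in> A" "b \<in> verts G" "b \<notin> A" "b \<notin> S" using A(2) B unfolding S_def by blast
  let ?H = "G \<restriction> (verts G - S)"
  have "\<not> Digraph_Component.connected ?H"
  proof
    assume "Digraph_Component.connected ?H"
    moreover have "a \<in> verts ?H" "b \<in> verts ?H" using ab A(1) by (auto simp: S_def)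
    ultimately have "(a, b) \<in> rtrancl_on (verts ?H) ((arcs_ends ?H)\<^sup>s)" unfolding connected_conv by blast
    then have "b \<in> A"
    proof (induction rule: rtrancl_on_induct)
      case base
      then show ?case using ab(1) by simp
    next
      case (step y z)
      have "y \<rightarrow>\<^bsub>?H\<^esub> z \<or> z \<rightarrow>\<^bsub>?H\<^esub> y" using step.hyps(2) by (auto simp: symcl_def)
      then have "z \<rightarrow>\<^bsub>G\<^esub> y" by (meson dominates_induce_subgraphD graph_symmetric)
      then show ?case using step.hyps(4) step.IH by (auto simp: S_def)
    qed
    then show False using ab(3) by simp
  qed
  moreover have "S \<subset> verts G" using ab A(1) by (auto simp: S_def)
  ultimately have "vertex_cut G S" by (simp add: vertex_cut_def)
  moreover have "\<not> complete_digraph (card (verts G)) G"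
  proof
    assume "complete_digraph (card (verts G)) G"
    then have "b \<rightarrow>\<^bsub>G\<^esub> a" using ab A(1) by (auto simp: complete_digraph_def)
    then show False using ab by (auto simp: S_def)
  qed
  ultimately show ?thesis unfolding S_def[symmetric] by (rule vertex_connectivity_le_cut)
qed

lemma vertex_connectivity_le_order:
  assumes "verts G \<noteq> {}"
  shows "vertex_connectivity G \<le> card (verts G) - 1"
proof (cases "complete_digraph (card (verts G)) G")
  case False
  then have "arcs_ends G \<noteq> {(u,v). (u,v) \<in> verts G \<times> verts G \<and> u \<noteq> v}"
    using graph_axioms by (auto simp: complete_digraph_def graph_def)
  moreover have "arcs_ends G \<subseteq> {(u,v). (u,v) \<in> verts G \<times> verts G \<and> u \<noteq> v}"
    using s.E_V s.E_V2 s.E_irrefl by auto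
  ultimately obtain u v where uv: "u \<in> verts G" "v \<in> verts G" "u \<noteq> v" "\<not> u \<rightarrow>\<^bsub>G\<^esub> v" by blast
  then have "\<not> v \<rightarrow>\<^bsub>G\<^esub> u" using graph_symmetric by blast
  then have "vertex_connectivity G \<le> card {w\<in>verts G - {u}. \<exists>a\<in>{u}. w \<rightarrow>\<^bsub>G\<^esub> a}"
    using uv by (intro vertex_connectivity_le_boundary) auto
  also have "\<dots> \<le> card (verts G - {u})" by (intro card_mono) auto
  finally show ?thesis using uv(1) by simp
qed (simp add: vertex_connectivity_def)

text \<open>The neighbours of \<open>x\<close> are the boundary of \<open>{x}\<close>; if nothing
  lies beyond them, the degree is the order minus one.\<close>

lemma vertex_connectivity_le_degree:
  assumes x: "x \<in> verts G"
  shows "vertex_connectivity G \<le> s.dg (verts G) x"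
proof -
  have eq: "{v\<in>verts G - {x}. \<exists>a\<in>{x}. v \<rightarrow>\<^bsub>G\<^esub> a} = {w\<in>verts G. x \<rightarrow>\<^bsub>G\<^esub> w}"
    using graph_symmetric s.E_irrefl by auto
  show ?thesis
  proof (cases "verts G - {x} - {v\<in>verts G - {x}. \<exists>a\<in>{x}. v \<rightarrow>\<^bsub>G\<^esub> a} = {}")
    case True
    then have "verts G - {x} \<subseteq> {w\<in>verts G. x \<rightarrow>\<^bsub>G\<^esub> w}" unfolding eq by blast
    then have "card (verts G - {x}) \<le> s.dg (verts G) x" unfolding s.dg_def by (intro card_mono) auto
    then show ?thesis using vertex_connectivity_le_order x by fastforce
  next
    case False
    then show ?thesis
      using vertex_connectivity_le_boundary[of "{x}"] x unfolding eq s.dg_def by simp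
  qed
qed

end

text \<open>If \<open>u\<close> has the largest value, every other \<open>v\<close> has
  \<open>2 * d v \<le> d u + d v \<le> N\<close>. Only \<open>u\<close> may exceed half of
  \<open>N\<close>, and it is paired with one \<open>w\<close>.\<close>

lemma twice_sum_le_of_pairs:
  fixes d :: "'a \<Rightarrow> nat"
  assumes X: "finite X" "2 \<le> card X" and pairs: "\<And>u v. u \<in> X \<Longrightarrow> v \<in> X \<Longrightarrow> u \<noteq> v \<Longrightarrow> d u + d v \<le> N"
  shows "2 * sum d X \<le> card X * N"
proof -
  have ne: "X \<noteq> {}" using X by auto
  obtain u where u: "u \<in> X" "\<And>v. v \<in> X \<Longrightarrow> d v \<le> d u"
    using Max_in[of "d ` X"] Max_ge[of "d ` X"] X(1) ne by (metis (no_types, lifting) finite_imageI image_iff image_is_empty)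
  have c: "card (X - {u}) = card X - 1" using u(1) by simp
  then have "X - {u} \<noteq> {}" using X(2) by fastforce
  then obtain w where w: "w \<in> X - {u}" by blast
  have c2: "card (X - {u} - {w}) = card X - 2" using w c by simp
  have "(\<Sum>v\<in>X - {u} - {w}. 2 * d v) \<le> card (X - {u} - {w}) * N"
  proof (intro sum_bounded_above[where K = N, simplified])
    fix v assume v: "v \<in> X - {u} - {w}"
    then show "2 * d v \<le> N" using u(2)[of v] pairs[of u v] u(1) by auto
  qed
  moreover have "sum d X = d u + (d w + sum d (X - {u} - {w}))"
    using X(1) u(1) w by (simp add: sum.remove)
  moreover have "d u + d w \<le> N" using pairs u(1) w by auto
  moreover have "(card X - 2) * N + 2 * N = card X * N" using le_Suc_ex[OF X(2)] by auto
  ultimately show ?thesis by (simp add: c2 sum_distrib_left)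
qed


section \<open>Turning a cycle system into a 2-factor\<close>

definition edge_subgraph :: "('a,'b) pre_digraph \<Rightarrow> 'a set \<Rightarrow> 'a rel \<Rightarrow> ('a,'b) pre_digraph" where
  "edge_subgraph G S T = \<lparr>verts = S, arcs = {a\<in>arcs G. arc_to_ends G a \<in> T}, tail = tail G, head = head G\<rparr>"

lemma edge_subgraph_simps[simp]:
  "verts (edge_subgraph G S T) = S" "arcs (edge_subgraph G S T) = {a\<in>arcs G. arc_to_ends G a \<in> T}"
  "tail (edge_subgraph G S T) = tail G" "head (edge_subgraph G S T) = head G"
  "arc_to_ends (edge_subgraph G S T) = arc_to_ends G"
  by (auto simp: edge_subgraph_def arc_to_ends_def fun_eq_iff)

lemma arcs_ends_edge_subgraph: "T \<subseteq> arcs_ends G \<Longrightarrow> arcs_ends (edge_subgraph G S T) = T"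
  by (auto simp: arcs_ends_def)

lemma symcl_sym: "sym R \<Longrightarrow> R\<^sup>s = R"
  by (auto simp: symcl_def sym_def)

lemma sym_symcl: "sym (R\<^sup>s)"
  by (auto simp: symcl_def sym_def)

lemma wf_edge_subgraph: "T \<subseteq> S \<times> S \<Longrightarrow> wf_digraph (edge_subgraph G S T)"
  by unfold_locales (auto simp: arc_to_ends_def)

lemma subgraph_edge_subgraph:
  assumes "T \<subseteq> S \<times> S" "T' \<subseteq> S' \<times> S'" "S \<subseteq> S'" "T \<subseteq> T'"
  shows "subgraph (edge_subgraph G S T) (edge_subgraph G S' T')"
  using assms(3,4) wf_edge_subgraph[OF assms(1)] wf_edge_subgraph[OF assms(2)]
  by (auto simp: subgraph_def compatible_def)

lemma (in graph) graph_edge_subgraph: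
  assumes "S \<subseteq> verts G" "T \<subseteq> S \<times> S" "T \<subseteq> arcs_ends G" "sym T"
  shows "graph (edge_subgraph G S T)"
proof -
  interpret w: wf_digraph "edge_subgraph G S T" using assms(2) by (rule wf_edge_subgraph)
  show ?thesis
  proof unfold_locales
    show "finite (verts (edge_subgraph G S T))" using finite_subset[OF assms(1)] by simp
    show "finite (arcs (edge_subgraph G S T))" by simp
    show "e \<in> arcs (edge_subgraph G S T) \<Longrightarrow> tail (edge_subgraph G S T) e \<noteq> head (edge_subgraph G S T) e" for e
      using no_loops by simp
    show "e1 \<in> arcs (edge_subgraph G S T) \<Longrightarrow> e2 \<in> arcs (edge_subgraph G S T) \<Longrightarrow>
      arc_to_ends (edge_subgraph G S T) e1 = arc_to_ends (edge_subgraph G S T) e2 \<Longrightarrow> e1 = e2" for e1 e2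
      using no_multi_arcs by simp
    show "symmetric (edge_subgraph G S T)"
      unfolding symmetric_def arcs_ends_edge_subgraph[OF assms(3)] by (rule assms(4))
  qed
qed

text \<open>The end \<open>y\<close> is kept apart from the start \<open>x\<close> for the
  induction; the closed walk is the case where they agree.\<close>

lemma cas_zip:
  assumes "\<And>q. q \<in> set (zip (x # ys) (ys @ [y])) \<Longrightarrow> tail C (e q) = fst q \<and> head C (e q) = snd q"
  shows "pre_digraph.cas C x (map e (zip (x # ys) (ys @ [y]))) y \<and>
    pre_digraph.awalk_verts C x (map e (zip (x # ys) (ys @ [y]))) = x # ys @ [y]"
  using assms
proof (induction ys arbitrary: x)
  case Nil
  then show ?case by (simp add: pre_digraph.cas.simps pre_digraph.awalk_verts.simps)
next
  case (Cons z zs)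
  have "pre_digraph.cas C z (map e (zip (z # zs) (zs @ [y]))) y \<and>
    pre_digraph.awalk_verts C z (map e (zip (z # zs) (zs @ [y]))) = z # zs @ [y]"
    by (rule Cons.IH) (use Cons.prems in simp)
  then show ?case using Cons.prems[of "(x, z)"] by (simp add: pre_digraph.cas.simps pre_digraph.awalk_verts.simps)
qed

definition cyclic_pairs :: "'a list \<Rightarrow> 'a rel" where
  "cyclic_pairs xs = set (zip xs (rotate1 xs))"

lemma cyclic_pairs_nth:
  "cyclic_pairs xs = {(xs ! i, xs ! (Suc i mod length xs)) | i. i < length xs}"
  by (auto simp: cyclic_pairs_def set_zip nth_rotate1)

lemma cyclic_pairs_sub: "cyclic_pairs xs \<subseteq> set xs \<times> set xs"
  unfolding cyclic_pairs_def using set_zip_leftD set_zip_rightD by fastforce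

lemma cycle_graph_edge_subgraph:
  assumes G: "graph G" and xs: "distinct xs" "3 \<le> length xs" "set xs \<subseteq> verts G" "cyclic_pairs xs \<subseteq> arcs_ends G"
  shows "cycle_graph (edge_subgraph G (set xs) ((cyclic_pairs xs)\<^sup>s))"
    and "Digraph_Component.connected (edge_subgraph G (set xs) ((cyclic_pairs xs)\<^sup>s))"
proof -
  interpret graph G by fact
  let ?T = "(cyclic_pairs xs)\<^sup>s"
  let ?C = "edge_subgraph G (set xs) ?T"
  have T: "?T \<subseteq> set xs \<times> set xs" using cyclic_pairs_sub[of xs] by (auto simp: symcl_def)
  have TG: "?T \<subseteq> arcs_ends G" using xs(4) graph_symmetric by (auto simp: symcl_def)
  define e where "e q = (SOME a. a \<in> arcs G \<and> arc_to_ends G a = q)" for q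
  have e: "e q \<in> arcs G \<and> arc_to_ends G (e q) = q" if "q \<in> cyclic_pairs xs" for q
  proof -
    have "\<exists>a. a \<in> arcs G \<and> arc_to_ends G a = q" using that xs(4) by (auto simp: arcs_ends_def)
    then show ?thesis unfolding e_def by (rule someI_ex)
  qed
  obtain x ys where xy: "xs = x # ys" using xs(2) by (cases xs) auto
  define p where "p = map e (zip xs (rotate1 xs))"
  have set_p: "set p = e ` cyclic_pairs xs" by (simp add: p_def cyclic_pairs_def)
  have ends: "arc_to_ends G ` set p = cyclic_pairs xs" unfolding set_p image_image using e by simp
  have "pre_digraph.cas ?C x p x \<and> pre_digraph.awalk_verts ?C x p = x # ys @ [x]"
    unfolding p_def xy rotate1.simps
    by (rule cas_zip) (use e in \<open>auto simp: xy cyclic_pairs_def arc_to_ends_def\<close>)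
  moreover have "set p \<subseteq> arcs ?C" using e by (auto simp: set_p symcl_def)
  moreover have "p \<noteq> []" "x \<in> verts ?C" by (auto simp: p_def xy)
  ultimately have "pre_digraph.cycle ?C p"
    unfolding pre_digraph.cycle_def pre_digraph.awalk_def
    using xs(1) by (intro exI[of _ x]) (auto simp: xy)
  note cyc = this
  have heads: "verts ?C = head ?C ` set p"
  proof -
    have "head G ` set p = snd ` (arc_to_ends G ` set p)" by (auto simp: arc_to_ends_def image_image)
    also have "\<dots> = set (map snd (zip xs (rotate1 xs)))" unfolding ends by (simp only: cyclic_pairs_def set_map)
    finally show ?thesis unfolding map_snd_zip[OF length_rotate1[symmetric]] set_rotate1 edge_subgraph_simps by (rule sym)
  qed
  have gr: "graph ?C" using xs(3) T TG sym_symcl by (rule graph_edge_subgraph)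
  have len: "3 \<le> length p" using xs(2) by (simp add: p_def)
  have arcs: "arcs_ends ?C = symcl (arc_to_ends ?C ` set p)"
    unfolding edge_subgraph_simps ends by (rule arcs_ends_edge_subgraph[OF TG])
  show "cycle_graph ?C"
    unfolding cycle_graph_def by (intro conjI exI[of _ p] gr cyc len heads arcs)
  have r: "(xs ! 0, xs ! i) \<in> rtrancl_on (set xs) ?T" if "i < length xs" for i
    using that
  proof (induction i)
    case (Suc i)
    have "\<exists>j. (xs ! i, xs ! Suc i) = (xs ! j, xs ! (Suc j mod length xs)) \<and> j < length xs"
      using Suc.prems by (intro exI[of _ i]) simp
    then have "(xs ! i, xs ! Suc i) \<in> ?T" unfolding symcl_def cyclic_pairs_nth by blast
    moreover have "(xs ! 0, xs ! i) \<in> rtrancl_on (set xs) ?T" using Suc by simp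
    moreover have "xs ! Suc i \<in> set xs" using Suc.prems by simp
    ultimately show ?case using rtrancl_on_into_rtrancl_on by fast
  qed simp
  have "(u, v) \<in> rtrancl_on (set xs) ?T" if "u \<in> set xs" "v \<in> set xs" for u v
  proof -
    have "(xs ! 0, u) \<in> rtrancl_on (set xs) ?T" "(xs ! 0, v) \<in> rtrancl_on (set xs) ?T"
      using that r by (metis in_set_conv_nth)+
    then show ?thesis using symD[OF rtrancl_on_sym[OF sym_symcl]] rtrancl_on_trans by metis
  qed
  then show "Digraph_Component.connected ?C"
    unfolding connected_conv edge_subgraph_simps arcs_ends_edge_subgraph[OF TG] symcl_sym[OF sym_symcl]
    using xy by blast
qed

text \<open>Every arc stays inside one part, so reachability cannot lead from one part to
  another.\<close>

lemma connected_in_part: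
  assumes K: "Digraph_Component.connected K" "verts K \<subseteq> \<Union>\<C>"
    and T: "arcs_ends K \<subseteq> (\<Union>C\<in>\<C>. C \<times> C)" and disj: "disjoint \<C>"
  obtains C where "C \<in> \<C>" "verts K \<subseteq> C"
proof -
  obtain u where u: "u \<in> verts K" using K(1) unfolding connected_conv by blast
  then obtain C where C: "C \<in> \<C>" "u \<in> C" using K(2) by blast
  have "v \<in> C" if "v \<in> verts K" for v
  proof -
    have "(u, v) \<in> rtrancl_on (verts K) ((arcs_ends K)\<^sup>s)" using K(1) u that unfolding connected_conv by blast
    then show ?thesis
    proof (induction rule: rtrancl_on_induct)
      case base
      then show ?case using C by simp
    next
      case (step y z)
      obtain D where "D \<in> \<C>" "y \<in> D" "z \<in> D" using step.hyps(2) T by (fastforce simp: symcl_def)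
      then show ?case using step.IH C(1) disj by (metis disjnt_iff disjointD Int_iff empty_iff)
    qed
  qed
  then show ?thesis using that C(1) by blast
qed

text \<open>Components are maximal connected subgraphs. A connected subgraph of \<open>H\<close>
  lies in one part \<open>C\<close> and is then a subgraph of \<open>K C\<close>, so the maximal
  ones are exactly the \<open>K C\<close>.\<close>

lemma has_two_factorI:
  assumes G: "graph G" and fin: "card \<C> = k" and disj: "disjoint \<C>" and span: "\<Union>\<C> = verts G"
    and cyc: "\<And>C. C \<in> \<C> \<Longrightarrow> \<exists>xs. set xs = C \<and> distinct xs \<and> 3 \<le> length xs \<and> cyclic_pairs xs \<subseteq> arcs_ends G"
  shows "has_two_factor_with_cycles G k"
proof -
  interpret graph G by fact
  obtain f where f: "\<And>C. C \<in> \<C> \<Longrightarrow> set (f C) = C \<and> distinct (f C) \<and> 3 \<le> length (f C) \<and> cyclic_pairs (f C) \<subseteq> arcs_ends G"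
    using cyc by metis
  define R where "R C = (cyclic_pairs (f C))\<^sup>s" for C
  define T where "T = (\<Union>C\<in>\<C>. R C)"
  define H where "H = edge_subgraph G (verts G) T"
  define K where "K C = edge_subgraph G C (R C)" for C
  have R: "R C \<subseteq> C \<times> C" "R C \<subseteq> arcs_ends G" "C \<subseteq> verts G" "sym (R C)" if "C \<in> \<C>" for C
  proof -
    show "R C \<subseteq> C \<times> C" using cyclic_pairs_sub[of "f C"] f[OF that] by (auto simp: R_def symcl_def)
    show "R C \<subseteq> arcs_ends G" using f[OF that] graph_symmetric by (auto simp: R_def symcl_def)
    show "C \<subseteq> verts G" using that span by blast
    show "sym (R C)" unfolding R_def by (rule sym_symcl)
  qed
  have T: "T \<subseteq> verts G \<times> verts G" "T \<subseteq> arcs_ends G" "sym T" "T \<subseteq> (\<Union>C\<in>\<C>. C \<times> C)"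
  proof -
    show "T \<subseteq> verts G \<times> verts G" unfolding T_def using R(1,3) by blast
    show "T \<subseteq> arcs_ends G" unfolding T_def using R(2) by blast
    show "sym T" unfolding T_def using R(4) by (auto simp: sym_def)
    show "T \<subseteq> (\<Union>C\<in>\<C>. C \<times> C)" unfolding T_def using R(1) by blast
  qed
  have H: "graph H" unfolding H_def using T by (intro graph_edge_subgraph) auto
  have aH: "arcs_ends H = T" unfolding H_def using T(2) by (rule arcs_ends_edge_subgraph)
  have K: "cycle_graph (K C)" "Digraph_Component.connected (K C)" "subgraph (K C) H" if "C \<in> \<C>" for C
  proof -
    show "cycle_graph (K C)" "Digraph_Component.connected (K C)"
      using cycle_graph_edge_subgraph[OF G, of "f C"] f[OF that] R(3)[OF that] by (auto simp: K_def R_def)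
    show "subgraph (K C) H" unfolding K_def H_def
      by (rule subgraph_edge_subgraph) (use R[OF that] T that in \<open>auto simp: T_def\<close>)
  qed
  \<comment> \<open>An arc of \<open>J\<close> comes from some \<open>R D\<close>, and its tail lies
    in both \<open>C\<close> and \<open>D\<close>, so the two parts coincide by
    disjointness.\<close>
  have max: "subgraph J (K C)" if J: "subgraph J H" "C \<in> \<C>" "verts J \<subseteq> C" for J C
  proof -
    interpret J: wf_digraph J using J(1) by blast
    have comp: "compatible H J" and sub: "arcs J \<subseteq> arcs H" using J(1) by auto
    have "arc_to_ends G a \<in> R C" if a: "a \<in> arcs J" for a
    proof -
      have "tail G a \<in> C" "head G a \<in> C"
        using J.wellformed[OF a] J(3) comp by (auto simp: compatible_def H_def)
      moreover obtain D where D: "D \<in> \<C>" "arc_to_ends G a \<in> R D" using sub a by (auto simp: H_def T_def)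
      moreover have "tail G a \<in> D" using R(1)[OF D(1)] D(2) by (auto simp: arc_to_ends_def)
      ultimately show ?thesis using disjointD[OF disj J(2), of D] by blast
    qed
    then show ?thesis
      using J comp sub wf_edge_subgraph[OF R(1)[OF J(2)]] J.wf_digraph
      by (auto simp: subgraph_def K_def H_def compatible_def)
  qed
  have part: "\<exists>C\<in>\<C>. verts J \<subseteq> C" if "subgraph J H" "Digraph_Component.connected J" for J
  proof (rule connected_in_part[OF that(2)])
    show "verts J \<subseteq> \<Union>\<C>" using subgraph_imp_subverts[OF that(1)] span by (simp add: H_def)
    have "arcs_ends J \<subseteq> arcs_ends H" using that(1) by (rule arcs_ends_mono)
    then show "arcs_ends J \<subseteq> (\<Union>C\<in>\<C>. C \<times> C)" using aH T(4) by blast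
  qed (use disj in auto)
  have antisym: "J = K C" if "subgraph J (K C)" "subgraph (K C) J" for J C
    using that by (auto simp: subgraph_def compatible_def intro!: pre_digraph.equality)
  have comp: "components H = K ` \<C>"
  proof (intro equalityI subsetI)
    fix J assume "J \<in> components H"
    then have J: "subgraph J H" "Digraph_Component.connected J"
      "\<And>L. L \<noteq> J \<Longrightarrow> subgraph J L \<Longrightarrow> \<not> (subgraph L H \<and> Digraph_Component.connected L)"
      by (auto simp: components_def pre_digraph.max_subgraph_def)
    obtain C where C: "C \<in> \<C>" "verts J \<subseteq> C" using part[OF J(1,2)] by blast
    then have "K C = J" using J(3)[of "K C"] max[OF J(1) C] K[OF C(1)] by blast
    then show "J \<in> K ` \<C>" using C(1) by blast
  next
    fix J assume "J \<in> K ` \<C>"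
    then obtain C where C: "C \<in> \<C>" "J = K C" by blast
    have "L = K C" if L: "subgraph (K C) L" "subgraph L H" "Digraph_Component.connected L" for L
    proof -
      obtain D where D: "D \<in> \<C>" "verts L \<subseteq> D" using part[OF L(2,3)] by blast
      have "C \<subseteq> D" using subgraph_imp_subverts[OF L(1)] D(2) by (simp add: K_def)
      moreover have "C \<noteq> {}" using f[OF C(1)] by fastforce
      ultimately have "D = C" using disjointD[OF disj C(1) D(1)] by blast
      then show ?thesis using antisym[OF max[OF L(2) D] ] L(1) by simp
    qed
    then show "J \<in> components H"
      using K[OF C(1)] C(2) by (auto simp: components_def pre_digraph.max_subgraph_def)
  qed
  have "inj_on K \<C>" by (rule inj_onI) (metis K_def edge_subgraph_simps(1))
  then have "card (components H) = k" using comp fin card_image by metis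
  moreover have "two_factor H G"
    unfolding two_factor_def spanning_def comp
  proof (intro conjI ballI H)
    show "subgraph H G" using T(1) wf_edge_subgraph[OF T(1)] wf_digraph
      by (auto simp: subgraph_def H_def compatible_def)
    show "verts G = verts H" by (simp add: H_def)
    show "cycle_graph J" if "J \<in> K ` \<C>" for J using that K(1) by blast
  qed
  ultimately show ?thesis unfolding has_two_factor_with_cycles_def by blast
qed

text \<open>The second claim carries the meaning of the ceiling: \<open>k\<close> cycles with at
  most \<open>t - 1\<close> neighbours each cannot hold \<open>m\<close> of them.\<close>

lemma ceiling_quotient:
  assumes "1 \<le> k" "1 \<le> m"
  defines "t \<equiv> nat \<lceil>real m / real k\<rceil>"
  shows "1 \<le> t" "k * (t - 1) < m" "real_of_int \<lceil>real m / real k\<rceil> = real t"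
proof -
  have "0 < real m / real k" using assms(1,2) by simp
  then have "1 \<le> \<lceil>real m / real k\<rceil>" by simp
  then show t: "1 \<le> t" and e: "real_of_int \<lceil>real m / real k\<rceil> = real t" unfolding t_def by linarith+
  have "real t - 1 < real m / real k" using e ceiling_correct[of "real m / real k"] by linarith
  then have "real k * real (t - 1) < real m" using assms(1) t by (simp add: field_simps of_nat_diff)
  then show "k * (t - 1) < m" by (metis of_nat_less_iff of_nat_mult)
qed

section \<open>The two sufficient conditions\<close>

lemma (in graph) two_factor_if_pairs:
  assumes k: "1 \<le> k" and order: "5 * k \<le> card (verts G) + 2"
    and m: "m \<le> vertex_connectivity G" and t: "1 \<le> t" "k * (t - 1) < m"
    and deg: "\<And>X. independent_set G X \<Longrightarrow> card X = t + 1 \<Longrightarrow>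
      \<exists>u\<in>X. \<exists>v\<in>X. u \<noteq> v \<and> card (verts G) \<le> s.dg (verts G) u + s.dg (verts G) v"
  shows "has_two_factor_with_cycles G k"
proof -
  have "\<exists>\<C>. s.csys k \<C> \<and> \<Union>\<C> = verts G"
  proof (rule s.spanning_cycles_of_connectivity[OF k order t])
    fix A assume "A \<subseteq> verts G" "A \<noteq> {}" "verts G - A - {v\<in>verts G - A. \<exists>a\<in>A. v \<rightarrow>\<^bsub>G\<^esub> a} \<noteq> {}"
    then show "m \<le> card {v\<in>verts G - A. \<exists>a\<in>A. v \<rightarrow>\<^bsub>G\<^esub> a}"
      using vertex_connectivity_le_boundary[of A] m by linarith
  next
    fix v assume "v \<in> verts G"
    then show "m \<le> s.dg (verts G) v" using vertex_connectivity_le_degree[of v] m by linarith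
  next
    fix X assume "X \<subseteq> verts G" "card X = t + 1" "\<forall>u\<in>X. \<forall>v\<in>X. \<not> u \<rightarrow>\<^bsub>G\<^esub> v"
    then show "\<exists>u\<in>X. \<exists>v\<in>X. u \<noteq> v \<and> card (verts G) \<le> s.dg (verts G) u + s.dg (verts G) v"
      by (intro deg) (auto simp: independent_set_def)
  qed
  then obtain \<C> where \<C>: "s.csys k \<C>" "\<Union>\<C> = verts G" by blast
  show ?thesis
  proof (rule has_two_factorI[OF graph_axioms _ _ \<C>(2)])
    show "card \<C> = k" "disjoint \<C>" using \<C>(1) by (auto simp: s.csys_def)
    fix C assume "C \<in> \<C>"
    then obtain xs where xs: "s.cyc xs" "set xs = C" using \<C>(1) by (auto simp: s.csys_def s.cycset_def)
    have "(xs ! i, xs ! (Suc i mod length xs)) \<in> arcs_ends G" if "i < length xs" for i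
    proof (cases "Suc i < length xs")
      case True
      then show ?thesis using xs(1) by (simp add: s.cyc_def successively_conv_nth)
    next
      case False
      then have "Suc i = length xs" "xs \<noteq> []" using that by auto
      then have "xs ! i = last xs" "xs ! 0 = hd xs" by (simp_all add: last_conv_nth hd_conv_nth flip: \<open>Suc i = length xs\<close>)
      then show ?thesis using xs(1) \<open>Suc i = length xs\<close> by (simp add: s.cyc_def)
    qed
    then have "cyclic_pairs xs \<subseteq> arcs_ends G" by (auto simp: cyclic_pairs_nth)
    then show "\<exists>xs. set xs = C \<and> distinct xs \<and> 3 \<le> length xs \<and> cyclic_pairs xs \<subseteq> arcs_ends G"
      using xs by (auto simp: s.cyc_def)
  qed
qed

lemma (in graph) two_factor_if_sigma:
  assumes k: "1 \<le> k" and order: "5 * k \<le> card (verts G) + 2" and m: "1 \<le> m" "m_connected m G"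
    and sig: "ereal (1 / 2 * (real_of_int \<lceil>real m / real k\<rceil> + 1) * (real (card (verts G)) - 1))
      < ereal_of_enat (sigma (nat \<lceil>real m / real k\<rceil> + 1) G)"
  shows "has_two_factor_with_cycles G k"
proof -
  define t where "t = nat \<lceil>real m / real k\<rceil>"
  note t = ceiling_quotient[OF k m(1), folded t_def]
  show ?thesis
  proof (rule two_factor_if_pairs[OF k order _ t(1,2)])
    show "m \<le> vertex_connectivity G" using m(2) by (simp add: m_connected_def)
    fix X assume X: "independent_set G X" "card X = t + 1"
    show "\<exists>u\<in>X. \<exists>v\<in>X. u \<noteq> v \<and> card (verts G) \<le> s.dg (verts G) u + s.dg (verts G) v"
    proof (rule ccontr)
      assume no: "\<not> ?thesis"
      have n: "1 \<le> card (verts G)" using order k by linarith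
      have "2 * sum (s.dg (verts G)) X \<le> card X * (card (verts G) - 1)"
      proof (rule twice_sum_le_of_pairs)
        show "finite X" using X(2) card.infinite by fastforce
        show "2 \<le> card X" using X(2) t(1) by simp
        show "s.dg (verts G) u + s.dg (verts G) v \<le> card (verts G) - 1" if "u \<in> X" "v \<in> X" "u \<noteq> v" for u v
          using no that by fastforce
      qed
      then have "real (2 * sum (s.dg (verts G)) X) \<le> real ((t + 1) * (card (verts G) - 1))"
        unfolding X(2) of_nat_le_iff .
      also have "\<dots> = (real t + 1) * (real (card (verts G)) - 1)"
        using n by (simp only: of_nat_mult of_nat_diff of_nat_add of_nat_1)
      finally have "real (sum (s.dg (verts G)) X) \<le> 1 / 2 * (real t + 1) * (real (card (verts G)) - 1)"
        unfolding mult.assoc of_nat_mult by linarith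
      moreover have "ereal_of_enat (sigma (t + 1) G) \<le> ereal_of_enat (enat (sum (s.dg (verts G)) X))"
        using sigma_le[OF X(1)] X(2) by (simp only: ereal_of_enat_le_iff)
      ultimately have "ereal_of_enat (sigma (t + 1) G) \<le> ereal (1 / 2 * (real t + 1) * (real (card (verts G)) - 1))"
        by (smt (verit) ereal_of_enat_simps(1) ereal_less_eq(3) order_trans)
      then show False using sig unfolding t(3) t_def[symmetric] by simp
    qed
  qed
qed

lemma (in graph) two_factor_if_independence:
  assumes k: "1 \<le> k" and order: "5 * k \<le> card (verts G) + 2"
    and ind: "independence_number G \<le> nat \<lceil>real (vertex_connectivity G) / real k\<rceil>"
  shows "has_two_factor_with_cycles G k"
proof -
  have "card (verts G) \<noteq> 0" using order k by linarith
  then obtain x where "x \<in> verts G" by fastforce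
  then have "independent_set G {x}" using s.E_irrefl by (simp add: independent_set_def)
  then have "1 \<le> independence_number G" using independent_card_le by fastforce
  \<comment> \<open>A single vertex is independent, so the ceiling is positive and the connectivity
    itself can serve as \<open>m\<close>.\<close>
  then have m: "1 \<le> vertex_connectivity G" using ind by (cases "vertex_connectivity G") auto
  note t = ceiling_quotient[OF k m]
  show ?thesis
  proof (rule two_factor_if_pairs[OF k order order_refl t(1,2)])
    fix X assume "independent_set G X" "card X = nat \<lceil>real (vertex_connectivity G) / real k\<rceil> + 1"
    then show "\<exists>u\<in>X. \<exists>v\<in>X. u \<noteq> v \<and> card (verts G) \<le> s.dg (verts G) u + s.dg (verts G) v"
      using independent_card_le[of X] ind by linarith
  qed
qed

theorem mainTheorem2:
  fixes k :: nat and G :: "('a,'b) pre_digraph"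
  assumes "k \<ge> 1"
    and "graph G"
    and "card (verts G) \<ge> 5 * k - 2"
  shows "(\<forall>m::nat. m \<ge> 1 \<longrightarrow> m_connected m G \<longrightarrow>
            ereal_of_enat (sigma (nat \<lceil>real m / real k\<rceil> + 1) G)
              > ereal (1 / 2 * (real_of_int \<lceil>real m / real k\<rceil> + 1) * (real (card (verts G)) - 1)) \<longrightarrow>
            has_two_factor_with_cycles G k) \<and>
         (independence_number G \<le> nat \<lceil>real (vertex_connectivity G) / real k\<rceil> \<longrightarrow>
            has_two_factor_with_cycles G k)"
proof -
  interpret graph G by fact
  have "5 * k \<le> card (verts G) + 2" using assms(1,3) by linarith
  then show ?thesis using two_factor_if_sigma two_factor_if_independence assms(1) by blast
qed

end
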